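(* For every word $w\in\mathcal B_n^*$ there is a unique orthogonal tableau $P^B(w)$ of type $B$ with $\mathrm w(P^B(w))\sim w$, and for any two words $w_1,w_2\in\mathcal B_n^*$: $$w_1\sim w_2\iff w_1\equiv^B w_2\iff P^B(w_1)=P^B(w_2).$$
   Context: Fix $n\ge2$. $\mathcal B_n=\{1\prec\cdots\prec n\prec0\prec\bar n\prec\cdots\prec\bar1\}$ (total order), $\bar{\bar k}=k$, $\bar0=0$, $x$ unbarred iff $x\preceq n$. Vector crystal: arrows $i\xrightarrow{i}i+1$, $\overline{i+1}\xrightarrow{i}\bar i$ ($1\le i<n$), $n\xrightarrow{n}0\xrightarrow{n}\bar n$ ($a\xrightarrow{i}b$ means $\tilde f_ia=b$). Tensor rule: $\tilde f_i(u\otimes v)=\tilde f_iu\otimes v$ if $\varphi_i(u)>\varepsilon_i(v)$, else $u\otimes\tilde f_iv$; $\tilde e_i(u\otimes v)=u\otimes\tilde e_iv$ if $\varphi_i(u)<\varepsilon_i(v)$, else $\tilde e_iu\otimes v$ ($\varepsilon_i,\varphi_i$ = lengths of $i$-strings). $G_n^B$ is the crystal on $\mathcal B_n^*$ obtained by identifying $u_1\cdots u_l$ with $u_1\otimes\cdots\otimes u_l$. $w_1\sim w_2$ means: the connected components of $w_1,w_2$ are isomorphic as colored graphs and, with $w_j^0$ their highest weight vertices (killed by all $\tilde e_i$), there are $i_1,\dots,i_r$ with $w_j=\tilde f_{i_1}\cdots\tilde f_{i_r}w_j^0$ for $j=1,2$. Columns of type $B$: sequences $x_1,\dots,x_l$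 of letters, strictly increasing except $0$ may repeat; reading $\mathrm w(C)=x_1\cdots x_l$. $N(z)$ (for $z\preceq n$) is the number of letters $x$ of $C$ with $x\preceq z$ or $x\succeq\bar z$. $C$ is admissible if $h(C)\le n$ and for every $z=x_p$, $\bar z=x_q$ with $z\preceq n$, $|q-p|\ge h(C)-z+1$ (equivalently $N(z)\le z$). Orthogonal tableaux: a tabloid $T=C_1\cdots C_r$ is a sequence of columns with $h(C_1)\ge\cdots\ge h(C_r)$ (shape $Y$), reading $\mathrm w(T)=\mathrm w(C_r)\cdots\mathrm w(C_1)$; it is an orthogonal tableau if $\mathrm w(T)$ lies in the connected component of $G_n^B$ containing $\mathrm w(T_Y)$, where $T_Y$ fills each column of height $k$ with $1,\dots,k$. $\equiv^B$ is the smallest congruence on the free monoid $\mathcal B_n^*$ containing: (R1) $yzx\equiv yxz$ and $xzy\equiv zxy$ for $x\prec y\prec z$, $x\ne\bar z$; (R2) for $x\prec y$, $x\ne\bar y$: $xyx\equiv xxy$ if $x\ne0$, and $xyy\equiv yxy$ if $y\ne0$; (R3) for $1\prec x\preceq n$ and $x\preceq y\preceq\bar x$: $y\,\overline{x-1}\,(x-1)\equiv y\,x\,\bar x$ and $x\,\bar x\,y\equiv\overline{x-1}\,(x-1)\,y$; and $0\bar nn\equiv\bar nn0$; (R4) for $x\preceq n$: $00x\equiv0x0$ and $0\bar x0\equiv\bar x00$; (R5) if $w=\mathrm w(C)$ is the reading of a non-admissible column $C$ of type $B$ all of whose proper factors are readings of admissible columns: if $C$ contains some unbarred $z$ with $\bar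 z\in C$ and $N(z)>z$, take the lowest such $z$ and let $\tilde w$ be $w$ with $z$ and $\bar z$ erased; otherwise let $\tilde w$ be $w$ with a letter $0$ erased; then $w\equiv\tilde w$. *)

theory Defs
  imports Main
begin

text \<open>Letters are integers: k (1 <= k <= n) is the unbarred letter k, 0 is 0,
  and -k is the barred letter bar k.  So B_n = {-n..n} and bar x = -x.\<close>

definition is_letter :: "nat \<Rightarrow> int \<Rightarrow> bool" where
  "is_letter n x \<longleftrightarrow> - int n \<le> x \<and> x \<le> int n"

definition is_word :: "nat \<Rightarrow> int list \<Rightarrow> bool" where
  "is_word n w \<longleftrightarrow> (\<forall>x\<in>set w. is_letter n x)"

text \<open>Rank realizing the total order 1 < ... < n < 0 < bar n < ... < bar 1.\<close>
definition rk :: "nat \<Rightarrow> int \<Rightarrow> int" where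
  "rk n x = (if x > 0 then x else if x = 0 then int n + 1 else 2 * int n + 2 + x)"

definition lt :: "nat \<Rightarrow> int \<Rightarrow> int \<Rightarrow> bool" where
  "lt n x y \<longleftrightarrow> rk n x < rk n y"

definition le :: "nat \<Rightarrow> int \<Rightarrow> int \<Rightarrow> bool" where
  "le n x y \<longleftrightarrow> rk n x \<le> rk n y"

definition fL :: "nat \<Rightarrow> nat \<Rightarrow> int \<Rightarrow> int option" where
  "fL n i x =
     (if 1 \<le> i \<and> i < n then
        (if x = int i then Some (int i + 1)
         else if x = - (int i + 1) then Some (- int i) else None)
      else if i = n then
        (if x = int n then Some 0 else if x = 0 then Some (- int n) else None)
      else None)"

definition eL :: "nat \<Rightarrow> nat \<Rightarrow> int \<Rightarrow> int option" where
  "eL n i x =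
     (if 1 \<le> i \<and> i < n then
        (if x = int i + 1 then Some (int i)
         else if x = - int i then Some (- (int i + 1)) else None)
      else if i = n then
        (if x = 0 then Some (int n) else if x = - int n then Some 0 else None)
      else None)"

definition strlen :: "('a \<Rightarrow> 'a option) \<Rightarrow> 'a \<Rightarrow> nat" where
  "strlen g x = (GREATEST k. ((\<lambda>m. Option.bind m g) ^^ k) (Some x) \<noteq> None)"

definition epsL :: "nat \<Rightarrow> nat \<Rightarrow> int \<Rightarrow> nat" where
  "epsL n i a = strlen (eL n i) a"

definition phiL :: "nat \<Rightarrow> nat \<Rightarrow> int \<Rightarrow> nat" where
  "phiL n i a = strlen (fL n i) a"

text \<open>Operators on words of length k; a word a#v is identified with a \<otimes> v.\<close>
primrec E :: "nat \<Rightarrow> nat \<Rightarrow> nat \<Rightarrow> int list \<Rightarrow> int list option" where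
  "E n i 0 = (\<lambda>w. None)"
| "E n i (Suc k) = (\<lambda>w. case w of [] \<Rightarrow> None
     | a # v \<Rightarrow> (if phiL n i a < strlen (E n i k) v
                 then map_option (Cons a) (E n i k v)
                 else map_option (\<lambda>b. b # v) (eL n i a)))"

primrec F :: "nat \<Rightarrow> nat \<Rightarrow> nat \<Rightarrow> int list \<Rightarrow> int list option" where
  "F n i 0 = (\<lambda>w. None)"
| "F n i (Suc k) = (\<lambda>w. case w of [] \<Rightarrow> None
     | a # v \<Rightarrow> (if phiL n i a > strlen (E n i k) v
                 then map_option (\<lambda>b. b # v) (fL n i a)
                 else map_option (Cons a) (F n i k v)))"

definition ew :: "nat \<Rightarrow> nat \<Rightarrow> int list \<Rightarrow> int list option" where
  "ew n i w = E n i (length w) w"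

definition fw :: "nat \<Rightarrow> nat \<Rightarrow> int list \<Rightarrow> int list option" where
  "fw n i w = F n i (length w) w"

fun fs :: "nat \<Rightarrow> nat list \<Rightarrow> int list \<Rightarrow> int list option" where
  "fs n [] w = Some w"
| "fs n (i # is) w = Option.bind (fs n is w) (fw n i)"

definition edge :: "nat \<Rightarrow> int list \<Rightarrow> int list \<Rightarrow> bool" where
  "edge n u v \<longleftrightarrow> is_word n u \<and> is_word n v \<and> (\<exists>i\<in>{1..n}. fw n i u = Some v)"

definition comp :: "nat \<Rightarrow> int list \<Rightarrow> int list set" where
  "comp n w = {v. (\<lambda>x y. edge n x y \<or> edge n y x)\<^sup>*\<^sup>* w v}"

definition highest :: "nat \<Rightarrow> int list \<Rightarrow> bool" where
  "highest n w \<longleftrightarrow> (\<forall>i\<in>{1..n}. ew n i w = None)"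

definition crys_sim :: "nat \<Rightarrow> int list \<Rightarrow> int list \<Rightarrow> bool" where
  "crys_sim n w1 w2 \<longleftrightarrow>
     (\<exists>g. bij_betw g (comp n w1) (comp n w2) \<and>
          (\<forall>x\<in>comp n w1. \<forall>y\<in>comp n w1. \<forall>i\<in>{1..n}.
              fw n i x = Some y \<longleftrightarrow> fw n i (g x) = Some (g y))) \<and>
     (\<exists>h1 h2 is. h1 \<in> comp n w1 \<and> highest n h1 \<and> h2 \<in> comp n w2 \<and> highest n h2 \<and>
          set is \<subseteq> {1..n} \<and> fs n is h1 = Some w1 \<and> fs n is h2 = Some w2)"

text \<open>A column is represented by its reading x_1 ... x_l (top to bottom).\<close>
definition is_col :: "nat \<Rightarrow> int list \<Rightarrow> bool" where
  "is_col n C \<longleftrightarrow> is_word n C \<and>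
     (\<forall>p. Suc p < length C \<longrightarrow> lt n (C ! p) (C ! Suc p) \<or> (C ! p = 0 \<and> C ! Suc p = 0))"

definition Ncount :: "nat \<Rightarrow> int list \<Rightarrow> int \<Rightarrow> nat" where
  "Ncount n C z = length (filter (\<lambda>x. le n x z \<or> le n (- z) x) C)"

definition admissible :: "nat \<Rightarrow> int list \<Rightarrow> bool" where
  "admissible n C \<longleftrightarrow> is_col n C \<and> length C \<le> n \<and>
     (\<forall>z p q. 1 \<le> z \<and> z \<le> int n \<and> p < length C \<and> q < length C \<and> C ! p = z \<and> C ! q = - z
        \<longrightarrow> \<bar>int q - int p\<bar> \<ge> int (length C) - z + 1)"

definition tabloid :: "nat \<Rightarrow> int list list \<Rightarrow> bool" where
  "tabloid n T \<longleftrightarrow> (\<forall>C\<in>set T. is_col n C \<and> C \<noteq> []) \<and>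
     (\<forall>j. Suc j < length T \<longrightarrow> length (T ! Suc j) \<le> length (T ! j))"

definition reading :: "int list list \<Rightarrow> int list" where
  "reading T = concat (rev T)"

definition TY :: "int list list \<Rightarrow> int list list" where
  "TY T = map (\<lambda>C. map int [1..<Suc (length C)]) T"

definition orth_tableau :: "nat \<Rightarrow> int list list \<Rightarrow> bool" where
  "orth_tableau n T \<longleftrightarrow> tabloid n T \<and> is_word n (reading (TY T)) \<and>
     reading T \<in> comp n (reading (TY T))"

definition R5_tilde :: "nat \<Rightarrow> int list \<Rightarrow> int list" where
  "R5_tilde n w =
     (if \<exists>z. 1 \<le> z \<and> z \<le> int n \<and> z \<in> set w \<and> - z \<in> set w \<and> int (Ncount n w z) > z
      then (let z = (LEAST z. 1 \<le> z \<and> z \<le> int n \<and> z \<in> set w \<and> - z \<in> set w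
                              \<and> int (Ncount n w z) > z)
            in remove1 z (remove1 (- z) w))
      else remove1 0 w)"

definition R5_word :: "nat \<Rightarrow> int list \<Rightarrow> bool" where
  "R5_word n w \<longleftrightarrow> is_col n w \<and> \<not> admissible n w \<and>
     (\<forall>i j. i \<le> j \<and> j \<le> length w \<and> (i, j) \<noteq> (0, length w)
        \<longrightarrow> admissible n (take (j - i) (drop i w)))"

inductive rel :: "nat \<Rightarrow> int list \<Rightarrow> int list \<Rightarrow> bool" for n where
  R1a: "\<lbrakk>is_word n [x, y, z]; lt n x y; lt n y z; x \<noteq> - z\<rbrakk> \<Longrightarrow> rel n [y, z, x] [y, x, z]"
| R1b: "\<lbrakk>is_word n [x, y, z]; lt n x y; lt n y z; x \<noteq> - z\<rbrakk> \<Longrightarrow> rel n [x, z, y] [z, x, y]"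
| R2a: "\<lbrakk>is_word n [x, y]; lt n x y; x \<noteq> - y; x \<noteq> 0\<rbrakk> \<Longrightarrow> rel n [x, y, x] [x, x, y]"
| R2b: "\<lbrakk>is_word n [x, y]; lt n x y; x \<noteq> - y; y \<noteq> 0\<rbrakk> \<Longrightarrow> rel n [x, y, y] [y, x, y]"
| R3a: "\<lbrakk>is_word n [y]; 2 \<le> x; x \<le> int n; le n x y; le n y (- x)\<rbrakk>
          \<Longrightarrow> rel n [y, - (x - 1), x - 1] [y, x, - x]"
| R3b: "\<lbrakk>is_word n [y]; 2 \<le> x; x \<le> int n; le n x y; le n y (- x)\<rbrakk>
          \<Longrightarrow> rel n [x, - x, y] [- (x - 1), x - 1, y]"
| R3c: "rel n [0, - int n, int n] [- int n, int n, 0]"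
| R4a: "\<lbrakk>1 \<le> x; x \<le> int n\<rbrakk> \<Longrightarrow> rel n [0, 0, x] [0, x, 0]"
| R4b: "\<lbrakk>1 \<le> x; x \<le> int n\<rbrakk> \<Longrightarrow> rel n [0, - x, 0] [- x, 0, 0]"
| R5: "R5_word n w \<Longrightarrow> rel n w (R5_tilde n w)"

inductive congB :: "nat \<Rightarrow> int list \<Rightarrow> int list \<Rightarrow> bool" for n where
  base: "rel n u v \<Longrightarrow> congB n u v"
| refl: "is_word n w \<Longrightarrow> congB n w w"
| sym: "congB n u v \<Longrightarrow> congB n v u"
| trans: "congB n u v \<Longrightarrow> congB n v w \<Longrightarrow> congB n u w"
| ctxt: "congB n u v \<Longrightarrow> is_word n x \<Longrightarrow> is_word n y \<Longrightarrow> congB n (x @ u @ y) (x @ v @ y)"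

definition PB :: "nat \<Rightarrow> int list \<Rightarrow> int list list" where
  "PB n w = (THE P. orth_tableau n P \<and> crys_sim n (reading P) w)"

end

theory Submission
  imports Defs "HOL-Library.Multiset"
begin

text \<open>
  Raising operators transport congruent words to congruent words: each defining pair of words is
  mapped by a raising operator to a defining pair of the same kind. For the column relation this
  becomes visible in terms of the counting function \<open>N\<close>: a minimal non-admissible column is a column
  of length at most \<open>n + 1\<close> with \<open>N(k) \<le> k + 1\<close> for all \<open>k\<close>, where one of these bounds is attained,
  and the erased letter is the least \<open>z\<close> with \<open>N(z) = z + 1\<close>. Reversing and barring a word exchanges
  raising and lowering operators and preserves the congruence.

  Each component contains a single highest weight word, by Newman's lemma: raising as often as
  possible along \<open>i\<close> is a transducer reading the word from left to right, and these transducers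
  satisfy the braid relations of type \<open>A\<^sub>2\<close> and \<open>B\<^sub>2\<close>. The two sides of a braid relation are related by
  a simulation on their states, namely the piecewise linear change of string parametrisation.

  A highest weight word is congruent to a product of columns \<open>1 \<dots> c\<close>: such columns commute, and the
  next letter is absorbed by one of them. Its shape is determined by the lengths of the lowering
  strings, so congruence and crystal similarity agree, and since lowering operators map
  columns to columns, lowering the canonical highest weight word produces the tableau.
\<close>

subsection \<open>Signature rules on words\<close>

text \<open>Nothing about crystals of modules is presupposed: a component is only a connected set of
  words, so that it has a single source has to be proved. Newman's lemma asks for a common
  descendant of two raisings along different indices, and a search for short joining paths would
  meet many local patterns. Raising to the top along an alternating word of indices gives one join
  for every pair, since the top of a string forgets where in the string one started. The equality of
  the two alternating products is then checked letter by letter, with an invariant in linear integer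
  arithmetic.

  The column relation shortens words, so congruent words cannot be matched letter by letter. What is
  transported is the pair of string lengths together with the congruence class of the raised word;
  this survives multiplication by a context because the tensor rule consults nothing else.
  Uniqueness of sources then makes congruent words of one component equal, and this turns congruence
  into an isomorphism of components.\<close>

definition el :: "nat \<Rightarrow> nat \<Rightarrow> int \<Rightarrow> nat" where
  "el n i x = (if 1 \<le> i \<and> i < n then (if x = int i + 1 \<or> x = - int i then 1 else 0)
     else if i = n then (if x = 0 then 1 else if x = - int n then 2 else 0) else 0)"

definition pl :: "nat \<Rightarrow> nat \<Rightarrow> int \<Rightarrow> nat" where
  "pl n i x = el n i (- x)"

lemma pl_alt: "pl n i x = (if 1 \<le> i \<and> i < n then (if x = int i \<or> x = - (int i + 1) then 1 else 0)
     else if i = n then (if x = 0 then 1 else if x = int n then 2 else 0) else 0)"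
  by (auto simp: pl_def el_def)

lemma iterate_bound:
  fixes mu :: "'a \<Rightarrow> nat"
  assumes "\<And>x y. g x = Some y \<Longrightarrow> mu y < mu x"
  shows "((\<lambda>m. Option.bind m g) ^^ k) (Some x) = Some y \<Longrightarrow> mu y + k \<le> mu x"
proof (induction k arbitrary: y)
  case (Suc k)
  then obtain z where "((\<lambda>m. Option.bind m g) ^^ k) (Some x) = Some z" "g z = Some y"
    by (auto simp: bind_eq_Some_conv)
  with Suc.IH assms[of z y] show ?case by fastforce
qed simp

lemma strlen_0: "g x = None \<Longrightarrow> strlen g x = 0"
  unfolding strlen_def
proof (rule Greatest_equality)
  fix k assume "g x = None" "((\<lambda>m. Option.bind m g) ^^ k) (Some x) \<noteq> None"
  moreover have "((\<lambda>m. Option.bind m g) ^^ j) None = None" for j by (induction j) auto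
  ultimately show "k \<le> 0" by (cases k) (auto simp del: funpow.simps simp: funpow_Suc_right)
qed simp

text \<open>The decreasing measure bounds the number of iterations; without such a bound
  \<open>GREATEST\<close> would be unspecified. This recursion computes all string lengths
  below.\<close>

lemma strlen_Suc:
  fixes mu :: "'a \<Rightarrow> nat"
  assumes mu: "\<And>x y. g x = Some y \<Longrightarrow> mu y < mu x" and gx: "g x = Some y"
  shows "strlen g x = Suc (strlen g y)"
proof -
  let ?I = "\<lambda>k x. ((\<lambda>m. Option.bind m g) ^^ k) (Some x)"
  have bd: "?I k z \<noteq> None \<Longrightarrow> k \<le> mu z" for k z
    using iterate_bound[of g mu, OF mu] by fastforce
  have st: "?I (Suc k) x = ?I k y" for k
    by (simp del: funpow.simps add: funpow_Suc_right gx)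
  have 1: "?I (strlen g y) y \<noteq> None"
    unfolding strlen_def by (rule GreatestI_nat[of "\<lambda>k. ?I k y \<noteq> None" 0 "mu y"]) (use bd in auto)
  show ?thesis
    unfolding strlen_def[of g x]
  proof (rule Greatest_equality)
    show "?I (Suc (strlen g y)) x \<noteq> None" using 1 st by simp
    fix k assume k: "?I k x \<noteq> None"
    show "k \<le> Suc (strlen g y)"
    proof (cases k)
      case (Suc j)
      then have "?I j y \<noteq> None" using k st by simp
      then have "j \<le> strlen g y"
        unfolding strlen_def by (intro Greatest_le_nat[of _ _ "mu y"]) (use bd in auto)
      then show ?thesis using Suc by simp
    qed simp
  qed
qed

section \<open>String lengths of letters and words\<close>

definition muL :: "nat \<Rightarrow> int \<Rightarrow> nat" where "muL n x = nat (rk n x)"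

lemma eL_mu: "0 < n \<Longrightarrow> eL n i x = Some y \<Longrightarrow> muL n y < muL n x"
  by (auto simp: eL_def muL_def rk_def split: if_splits)

lemma fL_mu: "0 < n \<Longrightarrow> fL n i x = Some y \<Longrightarrow> nat (2 * int n + 2 - rk n y) < nat (2 * int n + 2 - rk n x)"
  by (auto simp: fL_def rk_def split: if_splits)

lemma el_None: "0 < n \<Longrightarrow> eL n i x = None \<longleftrightarrow> el n i x = 0"
  by (auto simp: eL_def el_def)

lemma eL_Some: "0 < n \<Longrightarrow> eL n i x = Some y \<Longrightarrow> el n i x = Suc (el n i y) \<and> pl n i y = Suc (pl n i x)"
  unfolding eL_def el_def pl_alt by (cases "1 \<le> i \<and> i < n"; cases "i = n") (simp_all split: if_splits)

lemma fL_uminus: "fL n i x = map_option uminus (eL n i (- x))"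
  by (auto simp: fL_def eL_def)

lemma eL_fL: "0 < n \<Longrightarrow> eL n i x = Some y \<longleftrightarrow> fL n i y = Some x"
  by (auto simp: fL_def eL_def split: if_splits)

lemma phiL_eq: assumes "0 < n" shows "phiL n i x = pl n i x"
proof (induction "nat (2 * int n + 2 - rk n x)" arbitrary: x rule: less_induct)
  case less
  show ?case
  proof (cases "fL n i x")
    case None
    then show ?thesis using strlen_0[of "fL n i"] assms
      by (simp add: phiL_def fL_uminus el_None pl_def)
  next
    case (Some y)
    then have "phiL n i y = pl n i y" using fL_mu[OF assms] less by blast
    then show ?thesis
      using strlen_Suc[of "fL n i" "\<lambda>x. nat (2 * int n + 2 - rk n x)", OF fL_mu[OF assms] Some]
        eL_Some[OF assms] eL_fL[OF assms, of i y x] Some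
      by (simp add: phiL_def)
  qed
qed

text \<open>Truncated subtraction on \<open>nat\<close> is the positive part in the tensor product
  formula: lowerings of \<open>a\<close> cancel against raisings of \<open>v\<close>.\<close>

primrec eps :: "nat \<Rightarrow> nat \<Rightarrow> int list \<Rightarrow> nat" where
  "eps n i [] = 0"
| "eps n i (a # v) = el n i a + (eps n i v - pl n i a)"

primrec phi :: "nat \<Rightarrow> nat \<Rightarrow> int list \<Rightarrow> nat" where
  "phi n i [] = 0"
| "phi n i (a # v) = phi n i v + (pl n i a - eps n i v)"

primrec en :: "nat \<Rightarrow> nat \<Rightarrow> int list \<Rightarrow> int list option" where
  "en n i [] = None"
| "en n i (a # v) = (if pl n i a < eps n i v then map_option (Cons a) (en n i v)
      else map_option (\<lambda>b. b # v) (eL n i a))"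

primrec fn :: "nat \<Rightarrow> nat \<Rightarrow> int list \<Rightarrow> int list option" where
  "fn n i [] = None"
| "fn n i (a # v) = (if eps n i v < pl n i a then map_option (\<lambda>b. b # v) (fL n i a)
      else map_option (Cons a) (fn n i v))"

definition mu :: "nat \<Rightarrow> int list \<Rightarrow> nat" where "mu n w = sum_list (map (muL n) w)"

lemma mu_simps [simp]: "mu n [] = 0" "mu n (a # v) = muL n a + mu n v"
  by (auto simp: mu_def)

lemma E_mu: "0 < n \<Longrightarrow> E n i k w = Some w' \<Longrightarrow> mu n w' < mu n w"
  by (induction k arbitrary: w w') (auto split: list.splits if_splits dest: eL_mu)

lemma E_length: "E n i k w = Some w' \<Longrightarrow> length w = k \<Longrightarrow> length w' = k"
  by (induction k arbitrary: w w') (auto split: list.splits if_splits)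

text \<open>Two nested inductions: on the length, because the test in \<open>E\<close> consults the
  string length of the tail, and on the sum of ranks, because a string length is computed from that
  of the raised word, which has the same length.\<close>

lemma strlen_E:
  assumes "0 < n"
  shows "length w = k \<Longrightarrow> strlen (E n i k) w = eps n i w"
proof (induction k arbitrary: w)
  case 0
  then show ?case by (simp add: strlen_0)
next
  case (Suc k)
  note IHk = Suc.IH and len = Suc.prems
  have mono: "\<And>k x y. E n i k x = Some y \<Longrightarrow> mu n y < mu n x"
    using E_mu[OF assms] by blast
  have "length w = Suc k \<Longrightarrow> strlen (E n i (Suc k)) w = eps n i w" for w
  proof (induction "mu n w" arbitrary: w rule: less_induct)
    case less
    then obtain a u where w: "w = a # u" "length u = k" by (auto simp: length_Suc_conv)
    note su = IHk[OF w(2)]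
    have rec: "strlen (E n i (Suc k)) w = Suc (eps n i w')" if w': "E n i (Suc k) w = Some w'" for w'
    proof -
      have "strlen (E n i (Suc k)) w' = eps n i w'"
        using less(1) E_mu[OF assms w'] E_length[OF w' less.prems] by blast
      then show ?thesis
        using strlen_Suc[where g = "E n i (Suc k)" and mu = "mu n", OF mono[of "Suc k"] w'] by metis
    qed
    show ?case
    proof (cases "pl n i a < eps n i u")
      case True
      then obtain u' where u': "E n i k u = Some u'"
        using su strlen_0[of "E n i k" u] by fastforce
      then have "eps n i u = Suc (eps n i u')"
        using strlen_Suc[where g = "E n i k" and mu = "mu n", OF mono[of k] u'] su
          IHk[of u'] E_length[OF u' w(2)] by simp
      moreover have "E n i (Suc k) w = Some (a # u')" using True w u' su by (simp add: phiL_eq assms)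
      ultimately show ?thesis using rec[of "a # u'"] True w(1) by (simp del: E.simps)
    next
      case False
      show ?thesis
      proof (cases "eL n i a")
        case None
        then have "E n i (Suc k) w = None" using False w su by (simp add: phiL_eq assms)
        then show ?thesis using None False w el_None[OF assms, of i a] by (simp add: strlen_0 del: E.simps)
      next
        case (Some b)
        then have "E n i (Suc k) w = Some (b # u)" using False w su by (simp add: phiL_eq assms)
        then show ?thesis
          using rec[of "b # u"] False w(1) eL_Some[OF assms Some] by (simp del: E.simps)
      qed
    qed
  qed
  then show ?case using len by blast
qed

lemma ew_eq: assumes "0 < n" shows "ew n i w = en n i w"
proof -
  have "E n i (length w) w = en n i w"
    by (induction w) (auto simp: strlen_E[OF assms] phiL_eq[OF assms])
  then show ?thesis by (simp add: ew_def)
qed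

lemma fw_eq: assumes "0 < n" shows "fw n i w = fn n i w"
proof -
  have "F n i (length w) w = fn n i w"
    by (induction w) (auto simp: strlen_E[OF assms] phiL_eq[OF assms])
  then show ?thesis by (simp add: fw_def)
qed

lemma eps_append: "eps n i (u @ v) = eps n i u + (eps n i v - phi n i u)"
proof -
  have "eps n i (u @ v) = eps n i u + (eps n i v - phi n i u) \<and>
        phi n i (u @ v) = phi n i v + (phi n i u - eps n i v)"
    by (induction u) auto
  then show ?thesis by simp
qed

lemma phi_append: "phi n i (u @ v) = phi n i v + (phi n i u - eps n i v)"
  by (induction u) (auto simp: eps_append)

lemma en_None: "0 < n \<Longrightarrow> en n i w = None \<longleftrightarrow> eps n i w = 0"
  by (induction w) (auto simp: el_None)

text \<open>Associativity of the tensor rule: the recursion along the first letter may be replaced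
  by any cut of the word, with ties still decided in favour of the left factor.\<close>

lemma en_append: assumes "0 < n" shows "en n i (u @ v) =
    (if phi n i u < eps n i v then map_option ((@) u) (en n i v) else map_option (\<lambda>u'. u' @ v) (en n i u))"
proof (induction u)
  case Nil
  then show ?case using en_None[OF assms, of i v] by (cases "en n i v") auto
next
  case (Cons a u)
  then show ?case by (auto simp: eps_append option.map_comp o_def)
qed

lemma en_Some: "0 < n \<Longrightarrow> en n i w = Some w' \<Longrightarrow>
    eps n i w = Suc (eps n i w') \<and> phi n i w' = Suc (phi n i w)"
proof (induction w arbitrary: w')
  case (Cons a u)
  then show ?case using eL_Some[of n i a] by (auto split: if_splits)
qed simp

lemma en_length: "en n i w = Some w' \<Longrightarrow> length w' = length w"
  by (induction w arbitrary: w') (auto split: if_splits)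

lemma en_mu: "0 < n \<Longrightarrow> en n i w = Some w' \<Longrightarrow> mu n w' < mu n w"
  by (induction w arbitrary: w') (auto split: if_splits dest: eL_mu)

lemma eL_letter: "0 < n \<Longrightarrow> eL n i x = Some y \<Longrightarrow> is_letter n y"
  by (auto simp: eL_def is_letter_def split: if_splits)

lemma is_word_simps [simp]: "is_word n []" "is_word n (a # v) \<longleftrightarrow> is_letter n a \<and> is_word n v"
  "is_word n (u @ v) \<longleftrightarrow> is_word n u \<and> is_word n v"
  by (auto simp: is_word_def)

lemma en_word: "0 < n \<Longrightarrow> en n i w = Some w' \<Longrightarrow> is_word n w \<Longrightarrow> is_word n w'"
  by (induction w arbitrary: w') (auto split: if_splits dest: eL_letter)

lemma en_imp_fn: "0 < n \<Longrightarrow> en n i w = Some w' \<Longrightarrow> fn n i w' = Some w"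
proof (induction w arbitrary: w')
  case (Cons a u)
  then show ?case using eL_Some[of n i a] eL_fL[of n i a] en_Some[of n i u]
    by (fastforce split: if_splits)
qed simp

section \<open>Duality: reversing and barring a word\<close>

definition winv :: "int list \<Rightarrow> int list" where
  "winv w = rev (map uminus w)"

lemma winv_simps [simp]: "winv [] = []" "winv (a # v) = winv v @ [- a]" "winv (u @ v) = winv v @ winv u"
  "winv (winv w) = w" "length (winv w) = length w"
  by (auto simp: winv_def rev_map o_def)

lemma is_letter_uminus [simp]: "is_letter n (- x) = is_letter n x"
  by (auto simp: is_letter_def)

lemma is_word_winv [simp]: "is_word n (winv w) = is_word n w"
  by (auto simp: is_word_def winv_def)

lemma pl_uminus [simp]: "pl n i (- x) = el n i x" by (simp add: pl_def)

lemma el_uminus: "el n i (- x) = pl n i x" by (simp add: pl_def)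

lemma eps_winv [simp]: "eps n i (winv w) = phi n i w"
  and phi_winv [simp]: "phi n i (winv w) = eps n i w"
proof -
  have "eps n i (winv w) = phi n i w \<and> phi n i (winv w) = eps n i w"
    by (induction w) (auto simp: eps_append phi_append el_uminus)
  then show "eps n i (winv w) = phi n i w" "phi n i (winv w) = eps n i w" by auto
qed

text \<open>The strict inequalities match: lowering acts on the left factor under a strict test,
  raising on the right one, and reversal exchanges the sides. Facts about lowering are therefore
  read off from raising.\<close>

lemma fn_winv: assumes "0 < n" shows "fn n i w = map_option winv (en n i (winv w))"
proof (induction w)
  case (Cons a v)
  then show ?case
    by (auto simp: en_append[OF assms] fL_uminus option.map_comp o_def el_uminus)
qed simp

lemma fn_None: "0 < n \<Longrightarrow> fn n i w = None \<longleftrightarrow> phi n i w = 0"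
  by (simp add: fn_winv en_None)

lemma fn_imp_en: assumes "0 < n" "fn n i w = Some w'" shows "en n i w' = Some w"
proof -
  obtain v where "en n i (winv w) = Some v" "w' = winv v"
    using assms by (auto simp: fn_winv)
  then show ?thesis using en_imp_fn[OF assms(1), of i "winv w" v] fn_winv[OF assms(1), of i v]
    by (metis map_option_eq_Some winv_simps(4))
qed

lemma en_fn: "0 < n \<Longrightarrow> en n i w = Some w' \<longleftrightarrow> fn n i w' = Some w"
  using en_imp_fn fn_imp_en by blast

lemma fn_word: "0 < n \<Longrightarrow> fn n i w = Some w' \<Longrightarrow> is_word n w \<Longrightarrow> is_word n w'"
  by (auto simp: fn_winv dest: en_word)

subsection \<open>Uniqueness of highest weight words\<close>

declare [[smt_timeout = 300]]

section \<open>Transducers that raise to the top along one index\<close>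

definition pst :: "nat \<Rightarrow> nat \<Rightarrow> int \<Rightarrow> int \<Rightarrow> int" where
  "pst n i m x = (if m < int (el n i x) then 0 else m - int (el n i x)) + int (pl n i x)"

text \<open>After cancellation against the \<open>m\<close> lowerings of the prefix,
  \<open>el n i x - m\<close> raisings of \<open>x\<close> are left. For \<open>i = n\<close> the
  letter \<open>- int n\<close> can be raised twice: it becomes \<open>0\<close> for
  \<open>m = 1\<close> and \<open>int n\<close> for \<open>m = 0\<close>.\<close>

definition pout :: "nat \<Rightarrow> nat \<Rightarrow> int \<Rightarrow> int \<Rightarrow> int" where
  "pout n i m x =
     (if el n i x = 0 \<or> int (el n i x) \<le> m then x
      else if i < n then (if x = int i + 1 then int i else - (int i + 1))
      else if m < 1 then int n else 0)"

primrec pit :: "nat \<Rightarrow> nat \<Rightarrow> int \<Rightarrow> int list \<Rightarrow> int list" where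
  "pit n i m [] = []"
| "pit n i m (x # w) = pout n i m x # pit n i (pst n i m x) w"

text \<open>The transducer along \<open>i\<close> stores the length of the lowering string of the part of the word read
  so far. In the simulations below \<open>m1, m2, \<dots>\<close> and \<open>p1, p2, \<dots>\<close> are the states of the transducers in
  the two sides of a braid relation, \<open>l1, l2\<close> is the weight of the word read so far after all raisings,
  and \<open>a, b, \<dots>\<close> and \<open>A, B, \<dots>\<close> count the raisings made by each transducer.\<close>

definition RA :: "int \<Rightarrow> int \<Rightarrow> int \<Rightarrow> int \<Rightarrow> int \<Rightarrow> int \<Rightarrow> int \<Rightarrow> int \<Rightarrow>
    int \<Rightarrow> int \<Rightarrow> int \<Rightarrow> int \<Rightarrow> int \<Rightarrow> int \<Rightarrow> bool" where
  "RA l1 l2 a b c A B C m1 m2 m3 p1 p2 p3 \<longleftrightarrow>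
    m3 = l1 - c \<and> m2 = l2 + c - b \<and> m1 = l1 - 2 * c + b - a \<and>
    p3 = l2 - C \<and> p2 = l1 + C - B \<and> p1 = l2 - 2 * C + B - A \<and>
    B = a + c \<and> A + C = b \<and> c \<le> A \<and> b - a \<le> A \<and> (A = c \<or> A = b - a) \<and>
    0 \<le> a \<and> 0 \<le> c \<and> c \<le> b \<and> 0 \<le> m1 \<and> 0 \<le> m2 \<and> 0 \<le> m3"

text \<open>Only \<open>i\<close>, \<open>i + 1\<close>, \<open>i + 2\<close> and their bars react
  to either index, so reading one letter is a finite case distinction over linear constraints. Each
  count grows by the number of raisings just made.\<close>

lemma RA_step:
  fixes n i j :: nat and x l1 l2 a b c A B C m1 m2 m3 p1 p2 p3 :: int
  assumes ij: "1 \<le> i" "j = Suc i" "j < n"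
    and R: "RA l1 l2 a b c A B C m1 m2 m3 p1 p2 p3"
  defines "y1 \<equiv> pout n i m1 x" and "z1 \<equiv> pout n j p1 x"
  defines "y2 \<equiv> pout n j m2 y1" and "z2 \<equiv> pout n i p2 z1"
  defines "y3 \<equiv> pout n i m3 y2" and "z3 \<equiv> pout n j p3 z2"
  shows "y3 = z3 \<and> RA (l1 + int (pl n i y3) - int (el n i y3)) (l2 + int (pl n j y3) - int (el n j y3))
     (a + (if m1 < int (el n i x) then int (el n i x) - m1 else 0)) (b + (if m2 < int (el n j y1) then int (el n j y1) - m2 else 0)) (c + (if m3 < int (el n i y2) then int (el n i y2) - m3 else 0))
     (A + (if p1 < int (el n j x) then int (el n j x) - p1 else 0)) (B + (if p2 < int (el n i z1) then int (el n i z1) - p2 else 0)) (C + (if p3 < int (el n j z2) then int (el n j z2) - p3 else 0))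
     (pst n i m1 x) (pst n j m2 y1) (pst n i m3 y2) (pst n j p1 x) (pst n i p2 z1) (pst n j p3 z2)"
proof -
  have s: "el n i t = (if t = int i + 1 \<or> t = - int i then 1 else 0)"
    "pl n i t = (if t = int i \<or> t = - int i - 1 then 1 else 0)"
    "el n j t = (if t = int i + 2 \<or> t = - int i - 1 then 1 else 0)"
    "pl n j t = (if t = int i + 1 \<or> t = - int i - 2 then 1 else 0)" for t
    using ij by (auto simp: el_def pl_alt)
  have p: "pout n i m t = (if t = int i + 1 \<and> m < 1 then int i else if t = - int i \<and> m < 1 then - int i - 1 else t)"
     "pout n j m t = (if t = int i + 2 \<and> m < 1 then int i + 1 else if t = - int i - 1 \<and> m < 1 then - int i - 2 else t)" for m t
    unfolding pout_def s using ij by auto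
  have i: "int i > 0" using ij by simp
  note f = R[unfolded RA_def]
  \<comment> \<open>With nonnegative states the test \<open>m < el\<close> fails for every letter
    that cannot be raised.\<close>
  have nn: "\<not> m1 < 0" "\<not> m2 < 0" "\<not> m3 < 0" "\<not> p1 < 0" "\<not> p2 < 0" "\<not> p3 < 0"
    using f by (smt (z3))+
  note d = y3_def y2_def y1_def z1_def z2_def z3_def pst_def RA_def
  consider "x = int i" | "x = int i + 1" | "x = int i + 2" | "x = - int i" | "x = - int i - 1" | "x = - int i - 2"
    | "x \<noteq> int i" "x \<noteq> int i + 1" "x \<noteq> int i + 2" "x \<noteq> - int i" "x \<noteq> - int i - 1" "x \<noteq> - int i - 2"
    by blast
  then show ?thesis
  proof cases
    case 1
    show ?thesis unfolding d using i by (simp add: s p nn 1) (use f in \<open>smt (z3)\<close>)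
  next
    case 2
    \<comment> \<open>These are the combinations of small states that the invariant permits. Each of
      them fixes all output letters, after which the invariant for the new states is a linear
      problem.\<close>
    have "1 \<le> m1 \<and> 1 \<le> m3 \<and> 1 \<le> p2
        \<or> 1 \<le> m1 \<and> m3 < 1 \<and> p2 < 1
        \<or> m1 < 1 \<and> p2 < 1"
      using f by (smt (z3))
    then show ?thesis unfolding d using i
      apply (elim disjE conjE)
      apply (simp_all add: s p nn 2)
      using f by (smt (z3))+
  next
    case 3
    have "1 \<le> m2 \<and> 1 \<le> p1 \<and> 1 \<le> p3
        \<or> m2 < 1 \<and> 1 \<le> m3 \<and> 1 \<le> p1 \<and> p3 < 1
        \<or> m2 < 1 \<and> 1 \<le> m3 \<and> p1 < 1 \<and> 1 \<le> p2
        \<or> m2 < 1 \<and> m3 < 1 \<and> p1 < 1 \<and> p2 < 1"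
      using f by (smt (z3))
    then show ?thesis unfolding d using i
      apply (elim disjE conjE)
      apply (simp_all add: s p nn 3)
      using f by (smt (z3))+
  next
    case 4
    have "1 \<le> m1 \<and> 1 \<le> m3 \<and> 1 \<le> p2
        \<or> 1 \<le> m1 \<and> m3 < 1 \<and> p2 < 1 \<and> 1 \<le> p3
        \<or> m1 < 1 \<and> 1 \<le> m2 \<and> p2 < 1 \<and> 1 \<le> p3
        \<or> m1 < 1 \<and> m2 < 1 \<and> p2 < 1 \<and> p3 < 1"
      using f by (smt (z3))
    then show ?thesis unfolding d using i
      apply (elim disjE conjE)
      apply (simp_all add: s p nn 4)
      using f by (smt (z3))+
  next
    case 5
    have "1 \<le> m2 \<and> 1 \<le> p1 \<and> 1 \<le> p3
        \<or> m2 < 1 \<and> 1 \<le> p1 \<and> p3 < 1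
        \<or> m2 < 1 \<and> p1 < 1"
      using f by (smt (z3))
    then show ?thesis unfolding d using i
      apply (elim disjE conjE)
      apply (simp_all add: s p nn 5)
      using f by (smt (z3))+
  next
    case 6
    show ?thesis unfolding d using i by (simp add: s p nn 6) (use f in \<open>smt (z3)\<close>)
  next
    case 7
    show ?thesis unfolding d using i by (simp add: s p nn 7) (use f in \<open>smt (z3)\<close>)
  qed
qed

text \<open>The change of string parametrisation is A = max(d, 2c - b, b - 2a), D = min(a, b - c, c
  - d), B = a + c - D, C = b + d - A; in \<open>RA\<close> it is A = max(c, b - a), B = a + c, C = b
  - A. A state is the weight right after the raisings of its own transducer minus their number,
  because a word raised to the top has \<open>phi\<close> equal to its weight and each raising
  lengthens the lowering string by one. Raising along \<open>i\<close> changes the weight for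
  \<open>n\<close> by -2, raising along \<open>n\<close> changes the weight for \<open>i\<close> by
  -1.\<close>

definition RB :: "int \<Rightarrow> int \<Rightarrow> int \<Rightarrow> int \<Rightarrow> int \<Rightarrow> int \<Rightarrow> int \<Rightarrow> int \<Rightarrow> int \<Rightarrow>
    int \<Rightarrow> int \<Rightarrow> int \<Rightarrow> int \<Rightarrow> int \<Rightarrow> int \<Rightarrow> int \<Rightarrow> int \<Rightarrow> int \<Rightarrow> bool" where
  "RB l1 l2 a b c d A B C D m1 m2 m3 m4 p1 p2 p3 p4 \<longleftrightarrow>
    m4 = l2 - d \<and> m3 = l1 + d - c \<and> m2 = l2 - 2 * d + 2 * c - b \<and> m1 = l1 + d - 2 * c + b - a \<and>
    p4 = l1 - D \<and> p3 = l2 + 2 * D - C \<and> p2 = l1 - 2 * D + C - B \<and> p1 = l2 + 2 * D - 2 * C + 2 * B - A \<and>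
    a + c = B + D \<and> b + d = A + C \<and>
    A \<ge> d \<and> A \<ge> 2 * c - b \<and> A \<ge> b - 2 * a \<and> (A = d \<or> A = 2 * c - b \<or> A = b - 2 * a) \<and>
    D \<le> a \<and> D \<le> b - c \<and> D \<le> c - d \<and> (D = a \<or> D = b - c \<or> D = c - d) \<and>
    0 \<le> a \<and> 0 \<le> d \<and> d \<le> c \<and> c \<le> b \<and> 0 \<le> m1 \<and> 0 \<le> m2 \<and> 0 \<le> m3 \<and> 0 \<le> m4"

lemma RB_step:
  fixes n i :: nat and x l1 l2 a b c d A B C D m1 m2 m3 m4 p1 p2 p3 p4 :: int
  assumes ij: "1 \<le> i" "n = Suc i"
    and R: "RB l1 l2 a b c d A B C D m1 m2 m3 m4 p1 p2 p3 p4"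
  defines "y1 \<equiv> pout n i m1 x" and "z1 \<equiv> pout n n p1 x"
  defines "y2 \<equiv> pout n n m2 y1" and "z2 \<equiv> pout n i p2 z1"
  defines "y3 \<equiv> pout n i m3 y2" and "z3 \<equiv> pout n n p3 z2"
  defines "y4 \<equiv> pout n n m4 y3" and "z4 \<equiv> pout n i p4 z3"
  shows "y4 = z4 \<and> RB (l1 + int (pl n i y4) - int (el n i y4)) (l2 + int (pl n n y4) - int (el n n y4))
     (a + (if m1 < int (el n i x) then int (el n i x) - m1 else 0)) (b + (if m2 < int (el n n y1) then int (el n n y1) - m2 else 0))
     (c + (if m3 < int (el n i y2) then int (el n i y2) - m3 else 0)) (d + (if m4 < int (el n n y3) then int (el n n y3) - m4 else 0))
     (A + (if p1 < int (el n n x) then int (el n n x) - p1 else 0)) (B + (if p2 < int (el n i z1) then int (el n i z1) - p2 else 0))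
     (C + (if p3 < int (el n n z2) then int (el n n z2) - p3 else 0)) (D + (if p4 < int (el n i z3) then int (el n i z3) - p4 else 0))
     (pst n i m1 x) (pst n n m2 y1) (pst n i m3 y2) (pst n n m4 y3) (pst n n p1 x) (pst n i p2 z1) (pst n n p3 z2) (pst n i p4 z3)"
proof -
  have s: "el n i t = (if t = int i + 1 \<or> t = - int i then 1 else 0)"
    "pl n i t = (if t = int i \<or> t = - int i - 1 then 1 else 0)"
    "el n n t = (if t = 0 then 1 else if t = - int i - 1 then 2 else 0)"
    "pl n n t = (if t = 0 then 1 else if t = int i + 1 then 2 else 0)" for t
    using ij by (auto simp: el_def pl_alt)
  have p: "pout n i m t = (if t = int i + 1 \<and> m < 1 then int i else if t = - int i \<and> m < 1 then - int i - 1 else t)"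
     "pout n n m t = (if t = 0 \<and> m < 1 \<or> t = - int i - 1 \<and> m < 1 then int i + 1
        else if t = - int i - 1 \<and> m < 2 then 0 else t)" for m t
    unfolding pout_def s using ij by auto
  have i: "int i > 0" using ij by simp
  note f = R[unfolded RB_def]
  have nn: "\<not> m1 < 0" "\<not> m2 < 0" "\<not> m3 < 0" "\<not> m4 < 0" "\<not> p1 < 0" "\<not> p2 < 0" "\<not> p3 < 0" "\<not> p4 < 0"
    using f by (smt (z3))+
  note d = y4_def z4_def y3_def y2_def y1_def z1_def z2_def z3_def pst_def RB_def
  consider "x = int i" | "x = int i + 1" | "x = 0" | "x = - int i - 1" | "x = - int i"
    | "x \<noteq> int i" "x \<noteq> int i + 1" "x \<noteq> 0" "x \<noteq> - int i - 1" "x \<noteq> - int i"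
    by blast
  then show ?thesis
  proof cases
    case 1
    show ?thesis unfolding d using i by (simp add: s p nn 1) (use f in \<open>smt (z3)\<close>)
  next
    case 2
    have "1 \<le> m1 \<and> 1 \<le> m3 \<and> 1 \<le> p2 \<and> 1 \<le> p4
        \<or> 1 \<le> m1 \<and> m3 < 1 \<and> 1 \<le> p2 \<and> p4 < 1
        \<or> 1 \<le> m1 \<and> m3 < 1 \<and> p2 < 1
        \<or> m1 < 1 \<and> p2 < 1"
      using f by (smt (z3))
    then show ?thesis unfolding d using i
      apply (elim disjE conjE)
      apply (simp_all add: s p nn 2)
      using f by (smt (z3))+
  next
    case 3
    have "1 \<le> m2 \<and> 1 \<le> m4 \<and> 1 \<le> p1 \<and> 1 \<le> p3
        \<or> 1 \<le> m2 \<and> m4 < 1 \<and> 1 \<le> p1 \<and> p3 < 1 \<and> 1 \<le> p4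
        \<or> m2 < 1 \<and> 1 \<le> m3 \<and> 1 \<le> p1 \<and> p3 < 1 \<and> 1 \<le> p4
        \<or> m2 < 1 \<and> 1 \<le> m3 \<and> p1 < 1 \<and> 1 \<le> p2 \<and> 1 \<le> p4
        \<or> m2 < 1 \<and> m3 < 1 \<and> 1 \<le> p1 \<and> p3 < 1 \<and> p4 < 1
        \<or> m2 < 1 \<and> m3 < 1 \<and> p1 < 1 \<and> 1 \<le> p2 \<and> p4 < 1
        \<or> m2 < 1 \<and> m3 < 1 \<and> p1 < 1 \<and> p2 < 1"
      using f by (smt (z3))
    then show ?thesis unfolding d using i
      apply (elim disjE conjE)
      apply (simp_all add: s p nn 3)
      using f by (smt (z3))+
  next
    case 4
    \<comment> \<open>Here \<open>x\<close> is the bar of \<open>n\<close>, which can be raised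
      twice along \<open>n\<close>. The states are therefore also compared with 2, and the
      intermediate letter 0 appears when a state equals 1.\<close>
    have "2 \<le> m2 \<and> 2 \<le> m4 \<and> 2 \<le> p1 \<and> 2 \<le> p3
        \<or> 2 \<le> m2 \<and> m4 < 1 \<and> 2 \<le> p1 \<and> p3 < 1 \<and> 1 \<le> p4
        \<or> 2 \<le> m2 \<and> m4 = 1 \<and> 2 \<le> p1 \<and> p3 = 1
        \<or> m2 < 1 \<and> 1 \<le> m3 \<and> 2 \<le> p1 \<and> p3 < 1 \<and> 1 \<le> p4
        \<or> m2 < 1 \<and> 1 \<le> m3 \<and> p1 < 1 \<and> 1 \<le> p2 \<and> 1 \<le> p4
        \<or> m2 < 1 \<and> 1 \<le> m3 \<and> p1 = 1 \<and> p3 < 1 \<and> 1 \<le> p4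
        \<or> m2 < 1 \<and> m3 < 1 \<and> 2 \<le> p1 \<and> p3 < 1 \<and> p4 < 1
        \<or> m2 < 1 \<and> m3 < 1 \<and> p1 < 1 \<and> 1 \<le> p2 \<and> p4 < 1
        \<or> m2 < 1 \<and> m3 < 1 \<and> p1 < 1 \<and> p2 < 1
        \<or> m2 < 1 \<and> m3 < 1 \<and> p1 = 1 \<and> p3 < 1 \<and> p4 < 1
        \<or> m2 = 1 \<and> 1 \<le> m4 \<and> 2 \<le> p1 \<and> p3 = 1
        \<or> m2 = 1 \<and> 1 \<le> m4 \<and> p1 = 1 \<and> 1 \<le> p3
        \<or> m2 = 1 \<and> m4 < 1 \<and> 2 \<le> p1 \<and> p3 < 1 \<and> 1 \<le> p4
        \<or> m2 = 1 \<and> m4 < 1 \<and> p1 = 1 \<and> p3 < 1 \<and> 1 \<le> p4"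
      using f by (smt (z3))
    then show ?thesis unfolding d using i
      apply (elim disjE conjE)
      apply (simp_all add: s p nn 4)
      using f by (smt (z3))+
  next
    case 5
    have "1 \<le> m1 \<and> 1 \<le> m3 \<and> 1 \<le> p2 \<and> 1 \<le> p4
        \<or> 1 \<le> m1 \<and> m3 < 1 \<and> 2 \<le> m4 \<and> 1 \<le> p2 \<and> p4 < 1
        \<or> 1 \<le> m1 \<and> m3 < 1 \<and> 2 \<le> m4 \<and> p2 < 1 \<and> 2 \<le> p3
        \<or> 1 \<le> m1 \<and> m3 < 1 \<and> m4 < 1 \<and> p2 < 1 \<and> p3 < 1 \<and> 1 \<le> p4
        \<or> 1 \<le> m1 \<and> m3 < 1 \<and> m4 = 1 \<and> p2 < 1 \<and> p3 = 1
        \<or> m1 < 1 \<and> 2 \<le> m2 \<and> 2 \<le> m4 \<and> p2 < 1 \<and> 2 \<le> p3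
        \<or> m1 < 1 \<and> 2 \<le> m2 \<and> m4 < 1 \<and> p2 < 1 \<and> p3 < 1 \<and> 1 \<le> p4
        \<or> m1 < 1 \<and> 2 \<le> m2 \<and> m4 = 1 \<and> p2 < 1 \<and> p3 = 1
        \<or> m1 < 1 \<and> m2 < 1 \<and> 1 \<le> m3 \<and> p2 < 1 \<and> p3 < 1 \<and> 1 \<le> p4
        \<or> m1 < 1 \<and> m2 < 1 \<and> m3 < 1 \<and> p2 < 1 \<and> p3 < 1 \<and> p4 < 1
        \<or> m1 < 1 \<and> m2 = 1 \<and> 1 \<le> m4 \<and> p2 < 1 \<and> p3 = 1
        \<or> m1 < 1 \<and> m2 = 1 \<and> m4 < 1 \<and> p2 < 1 \<and> p3 < 1 \<and> 1 \<le> p4"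
      using f by (smt (z3))
    then show ?thesis unfolding d using i
      apply (elim disjE conjE)
      apply (simp_all add: s p nn 5)
      using f by (smt (z3))+
  next
    case 6
    show ?thesis unfolding d using i by (simp add: s p nn 6) (use f in \<open>smt (z3)\<close>)
  qed
qed

lemma pit_RA:
  assumes ij: "1 \<le> i" "j = Suc i" "j < n"
  shows "RA l1 l2 a b c A B C m1 m2 m3 p1 p2 p3 \<Longrightarrow>
    pit n i m3 (pit n j m2 (pit n i m1 w)) = pit n j p3 (pit n i p2 (pit n j p1 w))"
proof (induction w arbitrary: l1 l2 a b c A B C m1 m2 m3 p1 p2 p3)
  case (Cons x w)
  from RA_step[OF ij Cons.prems, of x] Cons.IH show ?case
    unfolding pit.simps by blast
qed simp

lemma pit_RB:
  assumes ij: "1 \<le> i" "n = Suc i"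
  shows "RB l1 l2 a b c d A B C D m1 m2 m3 m4 p1 p2 p3 p4 \<Longrightarrow>
    pit n n m4 (pit n i m3 (pit n n m2 (pit n i m1 w))) = pit n i p4 (pit n n p3 (pit n i p2 (pit n n p1 w)))"
proof (induction w arbitrary: l1 l2 a b c d A B C D m1 m2 m3 m4 p1 p2 p3 p4)
  case (Cons x w)
  from RB_step[OF ij Cons.prems, of x] Cons.IH show ?case
    unfolding pit.simps by blast
qed simp

text \<open>For indices at distance at least two, neither transducer creates, destroys or changes a
  letter to which the other one reacts.\<close>

lemma pit_commute:
  assumes "1 \<le> i" "Suc i < j" "j \<le> n" "0 \<le> m" "0 \<le> k"
  shows "pit n i m (pit n j k w) = pit n j k (pit n i m w)"
  using assms(4,5)
proof (induction w arbitrary: m k)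
  case (Cons x w)
  have p: "pout n i m x = (if (x = int i + 1 \<or> x = - int i) \<and> m < 1 then if x = int i + 1 then int i else - (int i + 1) else x)"
    for m x using assms by (auto simp: pout_def el_def)
  have s: "el n i x = (if x = int i + 1 \<or> x = - int i then 1 else 0)"
    "pl n i x = (if x = int i \<or> x = - (int i + 1) then 1 else 0)" for x
    using assms by (auto simp: el_def pl_alt)
  have q: "pout n j k x = int i \<longleftrightarrow> x = int i" "pout n j k x = int i + 1 \<longleftrightarrow> x = int i + 1"
    "pout n j k x = - int i \<longleftrightarrow> x = - int i" "pout n j k x = - (int i + 1) \<longleftrightarrow> x = - (int i + 1)" for k x
    using assms(1-3) by (auto simp: pout_def el_def split: if_splits)
  have r: "el n j (pout n i m x) = el n j x" "pl n j (pout n i m x) = pl n j x" for m x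
    using assms(1-3) by (auto simp: p el_def pl_alt)
  have "pst n i m (pout n j k x) = pst n i m x" "pst n j k (pout n i m x) = pst n j k x"
    unfolding pst_def s q r by simp_all
  moreover have "pout n i m (pout n j k x) = pout n j k (pout n i m x)"
  proof (cases "x \<in> {int i, int i + 1, - int i, - (int i + 1)}")
    case True
    have "pout n j k y = y" if "y \<in> {int i, int i + 1, - int i, - (int i + 1)}" for y
      using q that by auto
    moreover have "pout n i m x \<in> {int i, int i + 1, - int i, - (int i + 1)}"
      using True by (auto simp: p)
    ultimately show ?thesis using True by simp
  next
    case False
    then show ?thesis using q[of k x] unfolding p[of m "pout n j k x"] p[of m x] by auto
  qed
  moreover have "0 \<le> pst n i m x" "0 \<le> pst n j k x" using Cons.prems by (auto simp: pst_def)
  ultimately show ?case using Cons.IH by simp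
qed simp

lemma pit_id: "int (eps n i w) \<le> m \<Longrightarrow> pit n i m w = w"
  by (induction w arbitrary: m) (auto simp: pout_def pst_def)

lemma pout_eL:
  assumes "0 < n" "eL n i x = Some y" "0 \<le> m" "m < int (el n i x)"
  shows "pout n i m x = pout n i m y"
  using assms by (auto simp: pout_def eL_def el_def split: if_splits)

text \<open>A start state below \<open>eps n i w\<close> leaves \<open>eps n i w - m\<close>
  raisings to be made, and one of them may as well be made beforehand. For \<open>m = 0\<close> this
  says that all words of a string have the same image, namely its top.\<close>

lemma pit_en:
  assumes "0 < n"
  shows "en n i w = Some w' \<Longrightarrow> 0 \<le> m \<Longrightarrow> m < int (eps n i w) \<Longrightarrow> pit n i m w = pit n i m w'"
proof (induction w arbitrary: w' m)
  case (Cons x w)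
  show ?case
  proof (cases "pl n i x < eps n i w")
    case True
    then obtain v where v: "en n i w = Some v" "w' = x # v" using Cons.prems by auto
    have "0 \<le> pst n i m x" "pst n i m x < int (eps n i w)"
      using True Cons.prems by (auto simp: pst_def)
    then show ?thesis using Cons.IH v by simp
  next
    case False
    then obtain y where y: "eL n i x = Some y" "w' = y # w" using Cons.prems by auto
    have m: "m < int (el n i x)" using False Cons.prems by simp
    have "pit n i (pst n i m x) w = w" "pit n i (pst n i m y) w = w"
      using False eL_Some[OF assms y(1)] by (auto intro!: pit_id simp: pst_def)
    then show ?thesis using pout_eL[OF assms y(1) Cons.prems(2) m] y by simp
  qed
qed simp

section \<open>Raising as a terminating and locally confluent reduction\<close>

definition up :: "nat \<Rightarrow> int list \<Rightarrow> int list \<Rightarrow> bool" where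
  "up n u v \<longleftrightarrow> (\<exists>i\<in>{1..n}. en n i u = Some v)"

lemma pit0_en: "0 < n \<Longrightarrow> en n i w = Some w' \<Longrightarrow> pit n i 0 w = pit n i 0 w'"
  using pit_en[of n i w w' 0] en_None[of n i w] by simp

lemma up_pit0: assumes "0 < n" "i \<in> {1..n}" shows "(up n)\<^sup>*\<^sup>* w (pit n i 0 w)"
proof (induction "eps n i w" arbitrary: w)
  case 0
  then show ?case by (simp add: pit_id)
next
  case (Suc k)
  then obtain w' where w': "en n i w = Some w'" using en_None[OF assms(1), of i w] by fastforce
  then have "k = eps n i w'" using Suc.hyps(2) en_Some[OF assms(1) w'] by simp
  then have "(up n)\<^sup>*\<^sup>* w' (pit n i 0 w')" using Suc.hyps(1) by blast
  then show ?case using w' assms(2) pit0_en[OF assms(1) w']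
    by (metis up_def converse_rtranclp_into_rtranclp)
qed

text \<open>The join is the common value of the two braid products at \<open>x\<close>: the first
  factor of one does not distinguish \<open>x\<close> from \<open>y\<close>, and that of the other
  does not distinguish \<open>x\<close> from \<open>z\<close>.\<close>

lemma local_confluence:
  assumes "0 < n" "up n x y" "up n x z"
  shows "\<exists>u. (up n)\<^sup>*\<^sup>* y u \<and> (up n)\<^sup>*\<^sup>* z u"
proof -
  let ?P = "\<lambda>i. pit n i 0"
  have r: "(up n)\<^sup>*\<^sup>* v (?P i w)" if "(up n)\<^sup>*\<^sup>* v w" "i \<in> {1..n}" for v w i
    using up_pit0[OF assms(1) that(2)] that(1) by (meson rtranclp_trans)
  have main: "\<exists>u. (up n)\<^sup>*\<^sup>* y u \<and> (up n)\<^sup>*\<^sup>* z u"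
    if ij: "1 \<le> i" "i < j" "j \<le> n" and y: "en n i x = Some y" and z: "en n j x = Some z" for i j y z
  proof -
    have i: "i \<in> {1..n}" "j \<in> {1..n}" using ij by auto
    note Py = pit0_en[OF assms(1) y] and Pz = pit0_en[OF assms(1) z]
    consider "Suc i < j" | "j = Suc i" "j < n" | "j = Suc i" "n = j" using ij by linarith
    then show ?thesis
    proof cases
      case 1
      then have "?P j (?P i y) = ?P i (?P j z)"
        using pit_commute[of i j n 0 0 x] ij Py Pz by simp
      then show ?thesis using r i by (metis rtranclp.rtrancl_refl)
    next
      case 2
      have "RA 0 0 0 0 0 0 0 0 0 0 0 0 0 0" by (simp add: RA_def)
      from pit_RA[OF ij(1) 2 this, of x]
      have "?P i (?P j (?P i y)) = ?P j (?P i (?P j z))" using Py Pz by simp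
      moreover have "(up n)\<^sup>*\<^sup>* y (?P i (?P j (?P i y)))" "(up n)\<^sup>*\<^sup>* z (?P j (?P i (?P j z)))"
        by (intro r i rtranclp.rtrancl_refl)+
      ultimately show ?thesis by metis
    next
      case 3
      have "RB 0 0 0 0 0 0 0 0 0 0 0 0 0 0 0 0 0 0" by (simp add: RB_def)
      moreover have "n = Suc i" using 3 by simp
      ultimately have "?P n (?P i (?P n (?P i x))) = ?P i (?P n (?P i (?P n x)))"
        using pit_RB[OF ij(1)] by blast
      then have "?P j (?P i (?P j (?P i y))) = ?P i (?P j (?P i (?P j z)))" using Py Pz 3(2) by simp
      moreover have "(up n)\<^sup>*\<^sup>* y (?P j (?P i (?P j (?P i y))))" "(up n)\<^sup>*\<^sup>* z (?P i (?P j (?P i (?P j z))))"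
        by (intro r i rtranclp.rtrancl_refl)+
      ultimately show ?thesis by metis
    qed
  qed
  obtain i j where ij: "i \<in> {1..n}" "j \<in> {1..n}" "en n i x = Some y" "en n j x = Some z"
    using assms by (auto simp: up_def)
  consider "i = j" | "i < j" | "j < i" by linarith
  then show ?thesis
  proof cases
    case 1
    then show ?thesis using ij by auto
  next
    case 2
    then show ?thesis using main[of i j y z] ij by auto
  next
    case 3
    then show ?thesis using main[of j i z y] ij by auto
  qed
qed

lemma up_mu: "0 < n \<Longrightarrow> up n x y \<Longrightarrow> mu n y < mu n x"
  by (auto simp: up_def en_mu)

lemma highest_iff: "0 < n \<Longrightarrow> highest n w \<longleftrightarrow> (\<forall>v. \<not> up n w v)"
  unfolding highest_def up_def by (simp add: ew_eq) (metis not_None_eq)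

lemma highest_exists: assumes "0 < n" shows "\<exists>h. (up n)\<^sup>*\<^sup>* w h \<and> highest n h"
proof (induction "mu n w" arbitrary: w rule: less_induct)
  case less
  then show ?case using up_mu[OF assms] highest_iff[OF assms]
    by (metis converse_rtranclp_into_rtranclp rtranclp.rtrancl_refl)
qed

text \<open>Newman's lemma; raising decreases the sum of the ranks of the letters.\<close>

lemma up_highest_unique:
  assumes "0 < n"
  shows "(up n)\<^sup>*\<^sup>* x h1 \<Longrightarrow> highest n h1 \<Longrightarrow> (up n)\<^sup>*\<^sup>* x h2 \<Longrightarrow> highest n h2 \<Longrightarrow> h1 = h2"
proof (induction "mu n x" arbitrary: x h1 h2 rule: less_induct)
  case less
  show ?case
  proof (cases "highest n x")
    case True
    then show ?thesis using less.prems highest_iff[OF assms] by (metis converse_rtranclpE)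
  next
    case False
    obtain y where y: "up n x y" "(up n)\<^sup>*\<^sup>* y h1" using less.prems False by (metis converse_rtranclpE)
    obtain z where z: "up n x z" "(up n)\<^sup>*\<^sup>* z h2" using less.prems False by (metis converse_rtranclpE)
    obtain u where u: "(up n)\<^sup>*\<^sup>* y u" "(up n)\<^sup>*\<^sup>* z u" using local_confluence[OF assms y(1) z(1)] by blast
    obtain h where h: "(up n)\<^sup>*\<^sup>* u h" "highest n h" using highest_exists[OF assms] by blast
    have "h1 = h" using less.hyps[OF up_mu[OF assms y(1)] y(2)] less.prems h u(1) by (meson rtranclp_trans)
    moreover have "h2 = h" using less.hyps[OF up_mu[OF assms z(1)] z(2)] less.prems h u(2) by (meson rtranclp_trans)
    ultimately show ?thesis by simp
  qed
qed

section \<open>The highest weight word of a component\<close>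

lemma edge_up: assumes "0 < n" "edge n u v" shows "up n v u"
  using assms by (auto simp: edge_def up_def fw_eq en_fn)

text \<open>A step down from \<open>u\<close> to \<open>v\<close> merely prolongs the raising path.
  For a step up, \<open>v\<close> reaches some highest weight word, which \<open>u\<close> then
  reaches as well, so uniqueness identifies it with \<open>h\<close>.\<close>

lemma comp_highest:
  assumes "0 < n" "v \<in> comp n w" "(up n)\<^sup>*\<^sup>* w h" "highest n h"
  shows "(up n)\<^sup>*\<^sup>* v h"
proof -
  have "(\<lambda>x y. edge n x y \<or> edge n y x)\<^sup>*\<^sup>* w v" using assms(2) by (simp add: comp_def)
  then show ?thesis
  proof (induction rule: rtranclp_induct)
    case base
    show ?case by (rule assms(3))
  next
    case (step u v)
    from step(2) show ?case
    proof
      assume "edge n u v"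
      then show ?thesis using edge_up[OF assms(1)] step(3) by (meson converse_rtranclp_into_rtranclp)
    next
      assume "edge n v u"
      then have uv: "up n u v" by (rule edge_up[OF assms(1)])
      obtain h' where h': "(up n)\<^sup>*\<^sup>* v h'" "highest n h'" using highest_exists[OF assms(1)] by blast
      then have "(up n)\<^sup>*\<^sup>* u h'" using uv by (meson converse_rtranclp_into_rtranclp)
      then have "h' = h" using up_highest_unique[OF assms(1)] step(3) assms(4) h'(2) by blast
      then show ?thesis using h' by simp
    qed
  qed
qed

lemma highest_unique:
  assumes "0 < n" "u \<in> comp n w" "v \<in> comp n w" "highest n u" "highest n v"
  shows "u = v"
proof -
  obtain h where h: "(up n)\<^sup>*\<^sup>* w h" "highest n h" using highest_exists[OF assms(1)] by blast
  have "(up n)\<^sup>*\<^sup>* u h" "(up n)\<^sup>*\<^sup>* v h" using comp_highest[OF assms(1)] assms h by blast+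
  then show ?thesis using up_highest_unique[OF assms(1)] assms(4,5) h(2) by (metis rtranclp.rtrancl_refl)
qed

subsection \<open>Compatibility of the relations of length three\<close>

text \<open>The order on letters, without reference to \<open>n\<close>.\<close>

definition ltl :: "int \<Rightarrow> int \<Rightarrow> bool" where
  "ltl x y \<longleftrightarrow> (0 < x \<and> (y \<le> 0 \<or> x < y)) \<or> (x \<le> 0 \<and> y < 0 \<and> (x = 0 \<or> x < y))"

lemma lt_ltl: "is_letter n x \<Longrightarrow> is_letter n y \<Longrightarrow> lt n x y \<longleftrightarrow> ltl x y"
  by (auto simp: lt_def rk_def ltl_def is_letter_def)

lemma le_ltl: "is_letter n x \<Longrightarrow> is_letter n y \<Longrightarrow> le n x y \<longleftrightarrow> x = y \<or> ltl x y"
  by (auto simp: le_def rk_def ltl_def is_letter_def)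

text \<open>Generators of length three in terms of six single letters, so that membership is decided
  by order facts alone. Raising can turn one kind into another, as R1 becomes R2 when two letters
  become equal, hence the union of all kinds. Bounds by \<open>n\<close> that hold for the letters
  of any word are left out and recovered in \<open>r3_rel\<close>.\<close>

definition r3 :: "nat \<Rightarrow> int \<Rightarrow> int \<Rightarrow> int \<Rightarrow> int \<Rightarrow> int \<Rightarrow> int \<Rightarrow> bool" where
  "r3 n a b c a' b' c' \<longleftrightarrow>
    (a' = a \<and> b' = c \<and> c' = b \<and> ltl c a \<and> ltl a b \<and> c \<noteq> - b) \<or>
    (a' = b \<and> b' = a \<and> c' = c \<and> ltl a c \<and> ltl c b \<and> a \<noteq> - b) \<or>
    (c = a \<and> a' = a \<and> b' = a \<and> c' = b \<and> ltl a b \<and> a \<noteq> - b \<and> a \<noteq> 0) \<or>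
    (c = b \<and> a' = b \<and> b' = a \<and> c' = b \<and> ltl a b \<and> a \<noteq> - b \<and> b \<noteq> 0) \<or>
    (1 \<le> c \<and> c < int n \<and> b = - c \<and> a' = a \<and> b' = c + 1 \<and> c' = - (c + 1) \<and> (a = c + 1 \<or> ltl (c + 1) a) \<and> (a = - (c + 1) \<or> ltl a (- (c + 1)))) \<or>
    (2 \<le> a \<and> b = - a \<and> a' = - (a - 1) \<and> b' = a - 1 \<and> c' = c \<and> (c = a \<or> ltl a c) \<and> (c = - a \<or> ltl c (- a))) \<or>
    (a = 0 \<and> b = - int n \<and> c = int n \<and> a' = - int n \<and> b' = int n \<and> c' = 0) \<or>
    (a = 0 \<and> b = 0 \<and> 1 \<le> c \<and> a' = 0 \<and> b' = c \<and> c' = 0) \<or>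
    (a = 0 \<and> b \<le> - 1 \<and> c = 0 \<and> a' = b \<and> b' = 0 \<and> c' = 0)"

definition G3 :: "nat \<Rightarrow> nat \<Rightarrow> int \<Rightarrow> int \<Rightarrow> int \<Rightarrow> int \<Rightarrow> int \<Rightarrow> int \<Rightarrow> bool" where
  "G3 n i a b c a' b' c' \<longleftrightarrow> eps n i [a, b, c] = eps n i [a', b', c'] \<and> phi n i [a, b, c] = phi n i [a', b', c'] \<and>
    (case en n i [a, b, c] of None \<Rightarrow> True | Some u \<Rightarrow> (case en n i [a', b', c'] of None \<Rightarrow> False | Some v \<Rightarrow>
      r3 n (u ! 0) (u ! 1) (u ! 2) (v ! 0) (v ! 1) (v ! 2)))"

lemma el_small: "1 \<le> i \<Longrightarrow> i < n \<Longrightarrow> el n i x = (if x = int i + 1 \<or> x = - int i then 1 else 0)"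
  "1 \<le> i \<Longrightarrow> i < n \<Longrightarrow> pl n i x = (if x = int i \<or> x = - int i - 1 then 1 else 0)"
  "1 \<le> i \<Longrightarrow> i < n \<Longrightarrow> eL n i x = (if x = int i + 1 then Some (int i) else if x = - int i then Some (- int i - 1) else None)"
  by (auto simp: el_def pl_alt eL_def)

lemma el_big: "1 \<le> n \<Longrightarrow> el n n x = (if x = 0 then 1 else if x = - int n then 2 else 0)"
  "1 \<le> n \<Longrightarrow> pl n n x = (if x = 0 then 1 else if x = int n then 2 else 0)"
  "1 \<le> n \<Longrightarrow> eL n n x = (if x = 0 then Some (int n) else if x = - int n then Some 0 else None)"
  by (auto simp: el_def pl_alt eL_def)

text \<open>No letter lies strictly between \<open>i\<close> and \<open>i + 1\<close> or between
  their bars, so raising one of these does not disturb its comparison with other letters.\<close>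

lemma ltl_facts:
  assumes "1 \<le> i"
  shows "y \<noteq> int i \<Longrightarrow> y \<noteq> int i + 1 \<Longrightarrow> ltl y (int i + 1) = ltl y (int i)"
    "y \<noteq> int i \<Longrightarrow> y \<noteq> int i + 1 \<Longrightarrow> ltl (int i + 1) y = ltl (int i) y"
    "y \<noteq> - int i \<Longrightarrow> y \<noteq> - int i - 1 \<Longrightarrow> ltl y (- int i - 1) = ltl y (- int i)"
    "y \<noteq> - int i \<Longrightarrow> y \<noteq> - int i - 1 \<Longrightarrow> ltl (- int i - 1) y = ltl (- int i) y"
    "ltl (int i) (int i + 1)" "ltl (int i) (- int i)" "ltl (int i) (- int i - 1)"
    "ltl (int i + 1) (- int i)" "ltl (int i + 1) (- int i - 1)" "ltl (- int i - 1) (- int i)"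
    "\<not> ltl (int i + 1) (int i)" "\<not> ltl (- int i) (int i)" "\<not> ltl (- int i - 1) (int i)"
    "\<not> ltl (- int i) (int i + 1)" "\<not> ltl (- int i - 1) (int i + 1)" "\<not> ltl (- int i) (- int i - 1)"
    "\<not> ltl x x"
  using assms by (auto simp: ltl_def)

text \<open>The generic case repeats some disequalities in other orientations, so that rewriting can
  use them in place of arithmetic.\<close>

lemma letter_cases:
  "(y::int) = int i \<or> y = int i + 1 \<or> y = - int i \<or> y = - int i - 1 \<or> (y \<noteq> int i \<and> y \<noteq> int i + 1 \<and> y \<noteq> - int i \<and> y \<noteq> - int i - 1 \<and> int i \<noteq> - y \<and> int i + 1 \<noteq> - y
    \<and> y \<noteq> 1 + int i \<and> - int i - 1 \<noteq> - y)"
  by auto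

lemma letter_cases_n:
  "(y::int) = int n \<or> y = 0 \<or> y = - int n \<or> (y \<noteq> int n \<and> y \<noteq> 0 \<and> y \<noteq> - int n \<and> int n \<noteq> - y)"
  by auto

text \<open>R3 involves the letters \<open>x\<close> and \<open>x - 1\<close>, which meet
  \<open>i\<close> and \<open>i + 1\<close> exactly for the first three values.\<close>

lemma R3_cases: "(x::int) = int i \<or> x = int i + 1 \<or> x = int i + 2 \<or> x < int i \<or> int i + 2 < x"
  by linarith

lemma R3_cases_n: "(x::int) = int n \<or> x \<noteq> int n"
  by blast

lemma ltl_facts_n:
  assumes "1 \<le> n"
  shows "y \<noteq> int n \<Longrightarrow> y \<noteq> 0 \<Longrightarrow> y \<noteq> - int n \<Longrightarrow> - int n \<le> y \<Longrightarrow> y \<le> int n \<Longrightarrow> ltl y (int n) = (0 < y)"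
    "ltl y 0 = (0 < y)"
    "y \<noteq> int n \<Longrightarrow> y \<noteq> 0 \<Longrightarrow> y \<noteq> - int n \<Longrightarrow> - int n \<le> y \<Longrightarrow> y \<le> int n \<Longrightarrow> ltl y (- int n) = (0 < y)"
    "y \<noteq> int n \<Longrightarrow> y \<noteq> 0 \<Longrightarrow> y \<noteq> - int n \<Longrightarrow> - int n \<le> y \<Longrightarrow> y \<le> int n \<Longrightarrow> ltl (int n) y = (y < 0)"
    "ltl 0 y = (y < 0)"
    "y \<noteq> int n \<Longrightarrow> y \<noteq> 0 \<Longrightarrow> y \<noteq> - int n \<Longrightarrow> - int n \<le> y \<Longrightarrow> y \<le> int n \<Longrightarrow> ltl (- int n) y = (y < 0)"
    "ltl (int n) (- int n)" "\<not> ltl (- int n) (int n)" "\<not> ltl x x"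
  using assms by (auto simp: ltl_def)

lemma ltl_trans3:
  assumes "ltl x y" "ltl y z"
  shows "ltl x z" "\<not> ltl y x" "\<not> ltl z y"
  using assms by (auto simp: ltl_def)

text \<open>The many disequalities between letters below would make linear arithmetic explode.\<close>

declare [[linarith_neq_limit = 0]]

section \<open>The generators of length three under raising, for indices below n and for n\<close>

lemma G3_R1a_small:
  assumes i: "1 \<le> i" "i < n"
    and lt: "ltl x y" "ltl y z" "x \<noteq> - z"
  shows "G3 n i y z x y x z"
  using letter_cases[of x i] letter_cases[of y i] letter_cases[of z i]
  \<comment> \<open>Cases that contradict the order are discarded first; the remaining ones are
    evaluated by rewriting.\<close>
  apply (elim disjE conjE; insert lt ltl_trans3[OF lt(1,2)] i; (simp only: ltl_facts[OF i(1)] simp_thms; fail)?)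
  apply (simp_all add: G3_def el_small[OF i] ltl_facts[OF i(1)] r3_def)
  done

lemma G3_R1a_n:
  assumes i: "1 \<le> n"
    and lt: "ltl x y" "ltl y z" "x \<noteq> - z"
    and b: "- int n \<le> x" "x \<le> int n" "- int n \<le> y" "y \<le> int n" "- int n \<le> z" "z \<le> int n"
  shows "G3 n n y z x y x z"
  using letter_cases_n[of x n] letter_cases_n[of y n] letter_cases_n[of z n]
  apply (elim disjE conjE; insert lt ltl_trans3[OF lt(1,2)] b i; (simp only: ltl_facts_n[OF i] simp_thms; fail)?)
  apply (simp_all add: G3_def el_big[OF i] ltl_facts_n[OF i] r3_def)
  done

lemma G3_R1b_small:
  assumes i: "1 \<le> i" "i < n"
    and lt: "ltl x y" "ltl y z" "x \<noteq> - z"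
  shows "G3 n i x z y z x y"
  using letter_cases[of x i] letter_cases[of y i] letter_cases[of z i]
  apply (elim disjE conjE; insert lt ltl_trans3[OF lt(1,2)] i; (simp only: ltl_facts[OF i(1)] simp_thms; fail)?)
  apply (simp_all add: G3_def el_small[OF i] ltl_facts[OF i(1)] r3_def)
  done

lemma G3_R1b_n:
  assumes i: "1 \<le> n"
    and lt: "ltl x y" "ltl y z" "x \<noteq> - z"
    and b: "- int n \<le> x" "x \<le> int n" "- int n \<le> y" "y \<le> int n" "- int n \<le> z" "z \<le> int n"
  shows "G3 n n x z y z x y"
  using letter_cases_n[of x n] letter_cases_n[of y n] letter_cases_n[of z n]
  apply (elim disjE conjE; insert lt ltl_trans3[OF lt(1,2)] b i; (simp only: ltl_facts_n[OF i] simp_thms; fail)?)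
  apply (simp_all add: G3_def el_big[OF i] ltl_facts_n[OF i] r3_def)
  done

lemma G3_R2a_small:
  assumes i: "1 \<le> i" "i < n"
    and lt: "ltl x y" "x \<noteq> - y" "x \<noteq> 0"
  shows "G3 n i x y x x x y"
  using letter_cases[of x i] letter_cases[of y i]
  apply (elim disjE conjE; insert lt i; (simp only: ltl_facts[OF i(1)] simp_thms; fail)?)
  apply (simp_all add: G3_def el_small[OF i] ltl_facts[OF i(1)] r3_def)
  done

lemma G3_R2a_n:
  assumes i: "1 \<le> n"
    and lt: "ltl x y" "x \<noteq> - y" "x \<noteq> 0"
    and b: "- int n \<le> x" "x \<le> int n" "- int n \<le> y" "y \<le> int n"
  shows "G3 n n x y x x x y"
  using letter_cases_n[of x n] letter_cases_n[of y n]
  apply (elim disjE conjE; insert lt b i; (simp only: ltl_facts_n[OF i] simp_thms; fail)?)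
  apply (simp_all add: G3_def el_big[OF i] ltl_facts_n[OF i] r3_def)
  done

lemma G3_R2b_small:
  assumes i: "1 \<le> i" "i < n"
    and lt: "ltl x y" "x \<noteq> - y" "y \<noteq> 0"
  shows "G3 n i x y y y x y"
  using letter_cases[of x i] letter_cases[of y i]
  apply (elim disjE conjE; insert lt i; (simp only: ltl_facts[OF i(1)] simp_thms; fail)?)
  apply (simp_all add: G3_def el_small[OF i] ltl_facts[OF i(1)] r3_def)
  done

lemma G3_R2b_n:
  assumes i: "1 \<le> n"
    and lt: "ltl x y" "x \<noteq> - y" "y \<noteq> 0"
    and b: "- int n \<le> x" "x \<le> int n" "- int n \<le> y" "y \<le> int n"
  shows "G3 n n x y y y x y"
  using letter_cases_n[of x n] letter_cases_n[of y n]
  apply (elim disjE conjE; insert lt b i; (simp only: ltl_facts_n[OF i] simp_thms; fail)?)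
  apply (simp_all add: G3_def el_big[OF i] ltl_facts_n[OF i] r3_def)
  done

lemma G3_R3a_small:
  assumes i: "1 \<le> i" "i < n"
    and lt: "2 \<le> x" "x \<le> int n" "y = x \<or> ltl x y" "y = - x \<or> ltl y (- x)"
  shows "G3 n i y (- (x - 1)) (x - 1) y x (- x)"
  using letter_cases[of y i] R3_cases[of x i]
  apply (elim disjE conjE; insert lt i; (simp only: ltl_facts[OF i(1)] simp_thms; fail)?)
  apply (simp_all add: G3_def el_small[OF i] ltl_facts[OF i(1)] r3_def)
  by (auto simp: ltl_def)

lemma G3_R3a_n:
  assumes i: "1 \<le> n"
    and lt: "2 \<le> x" "x \<le> int n" "y = x \<or> ltl x y" "y = - x \<or> ltl y (- x)"
    and b: "- int n \<le> y" "y \<le> int n"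
  shows "G3 n n y (- (x - 1)) (x - 1) y x (- x)"
  using letter_cases_n[of y n] R3_cases_n[of x n]
  apply (elim disjE conjE; insert lt b i; (simp only: ltl_facts_n[OF i] simp_thms; fail)?)
  apply (simp_all add: G3_def el_big[OF i] ltl_facts_n[OF i] r3_def)
  done

lemma G3_R3b_small:
  assumes i: "1 \<le> i" "i < n"
    and lt: "2 \<le> x" "x \<le> int n" "y = x \<or> ltl x y" "y = - x \<or> ltl y (- x)"
  shows "G3 n i x (- x) y (- (x - 1)) (x - 1) y"
  using letter_cases[of y i] R3_cases[of x i]
  apply (elim disjE conjE; insert lt i; (simp only: ltl_facts[OF i(1)] simp_thms; fail)?)
  apply (simp_all add: G3_def el_small[OF i] ltl_facts[OF i(1)] r3_def)
  done

lemma G3_R3b_n: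
  assumes i: "1 \<le> n"
    and lt: "2 \<le> x" "x \<le> int n" "y = x \<or> ltl x y" "y = - x \<or> ltl y (- x)"
    and b: "- int n \<le> y" "y \<le> int n"
  shows "G3 n n x (- x) y (- (x - 1)) (x - 1) y"
  using letter_cases_n[of y n] R3_cases_n[of x n]
  apply (elim disjE conjE; insert lt b i; (simp only: ltl_facts_n[OF i] simp_thms; fail)?)
  apply (simp_all add: G3_def el_big[OF i] ltl_facts_n[OF i] r3_def)
  done

lemma G3_R3c_small:
  assumes i: "1 \<le> i" "i < n"
  shows "G3 n i 0 (- int n) (int n) (- int n) (int n) 0"
  using i by (simp add: G3_def el_small[OF i] ltl_facts[OF i(1)] r3_def)

lemma G3_R3c_n:
  assumes i: "1 \<le> n"
  shows "G3 n n 0 (- int n) (int n) (- int n) (int n) 0"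
  using i by (simp add: G3_def el_big[OF i] ltl_facts_n[OF i] r3_def)

lemma G3_R4a_small:
  assumes i: "1 \<le> i" "i < n"
    and lt: "1 \<le> x" "x \<le> int n"
  shows "G3 n i 0 0 x 0 x 0"
  using letter_cases[of x i]
  apply (elim disjE conjE; insert lt i; (simp only: ltl_facts[OF i(1)] simp_thms; fail)?)
  apply (simp_all add: G3_def el_small[OF i] ltl_facts[OF i(1)] r3_def)
  done

lemma G3_R4a_n:
  assumes i: "1 \<le> n"
    and lt: "1 \<le> x" "x \<le> int n"
    and b: "- int n \<le> x" "x \<le> int n"
  shows "G3 n n 0 0 x 0 x 0"
  using letter_cases_n[of x n]
  apply (elim disjE conjE; insert lt b i; (simp only: ltl_facts_n[OF i] simp_thms; fail)?)
  apply (simp_all add: G3_def el_big[OF i] ltl_facts_n[OF i] r3_def)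
  done

lemma G3_R4b_small:
  assumes i: "1 \<le> i" "i < n"
    and lt: "1 \<le> x" "x \<le> int n"
  shows "G3 n i 0 (- x) 0 (- x) 0 0"
  using letter_cases[of x i]
  apply (elim disjE conjE; insert lt i; (simp only: ltl_facts[OF i(1)] simp_thms; fail)?)
  apply (simp_all add: G3_def el_small[OF i] ltl_facts[OF i(1)] r3_def)
  done

lemma G3_R4b_n:
  assumes i: "1 \<le> n"
    and lt: "1 \<le> x" "x \<le> int n"
    and b: "- int n \<le> x" "x \<le> int n"
  shows "G3 n n 0 (- x) 0 (- x) 0 0"
  using letter_cases_n[of x n]
  apply (elim disjE conjE; insert lt b i; (simp only: ltl_facts_n[OF i] simp_thms; fail)?)
  apply (simp_all add: G3_def el_big[OF i] ltl_facts_n[OF i] r3_def)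
  done

declare [[linarith_neq_limit = 9]]

section \<open>From letters back to generators\<close>

lemma r3_rel:
  assumes w: "is_word n [a, b, c]" and r: "r3 n a b c a' b' c'"
  shows "rel n [a, b, c] [a', b', c']"
proof -
  have l: "is_letter n a" "is_letter n b" "is_letter n c" using w by auto
  then have b: "- int n \<le> a" "a \<le> int n" "- int n \<le> b" "b \<le> int n" "- int n \<le> c" "c \<le> int n"
    by (auto simp: is_letter_def)
  from r[unfolded r3_def] show ?thesis
  proof (elim disjE, goal_cases)
    case 1 then show ?thesis using rel.R1a[of n c a b] l by (auto simp: lt_ltl)
  next
    case 2 then show ?thesis using rel.R1b[of n a c b] l by (auto simp: lt_ltl)
  next
    case 3 then show ?thesis using rel.R2a[of n a b] l by (auto simp: lt_ltl)
  next
    case 4 then show ?thesis using rel.R2b[of n a b] l by (auto simp: lt_ltl)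
  next
    case 5
    moreover have "is_letter n (c + 1)" "is_letter n (- (c + 1))" using 5 by (auto simp: is_letter_def)
    ultimately show ?thesis using rel.R3a[where n = n and y = a and x = "c + 1"] l by (auto simp: le_ltl)
  next
    case 6 then show ?thesis using rel.R3b[of n c a] l b by (auto simp: le_ltl)
  next
    case 7 then show ?thesis using rel.R3c[of n] by simp
  next
    case 8 then show ?thesis using rel.R4a[of c n] b by simp
  next
    case 9 then show ?thesis using rel.R4b[of "- b" n] b by simp
  qed
qed

definition ecompat :: "nat \<Rightarrow> nat \<Rightarrow> int list \<Rightarrow> int list \<Rightarrow> bool" where
  "ecompat n i u v \<longleftrightarrow> eps n i u = eps n i v \<and> phi n i u = phi n i v \<and>
     (\<forall>u'. en n i u = Some u' \<longrightarrow> (\<exists>v'. en n i v = Some v' \<and> rel n u' v'))"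

lemma G3_ecompat:
  assumes n: "0 < n" and w: "is_word n [a, b, c]" and G: "G3 n i a b c a' b' c'"
  shows "ecompat n i [a, b, c] [a', b', c']"
proof -
  have "\<exists>v'. en n i [a', b', c'] = Some v' \<and> rel n u v'" if u: "en n i [a, b, c] = Some u" for u
  proof -
    obtain v where v: "en n i [a', b', c'] = Some v" "r3 n (u ! 0) (u ! 1) (u ! 2) (v ! 0) (v ! 1) (v ! 2)"
      using G u by (auto simp: G3_def split: option.splits)
    have ex: "xs = [xs ! 0, xs ! 1, xs ! 2]" if "length xs = 3" for xs :: "int list"
      using that by (auto simp: numeral_3_eq_3 length_Suc_conv)
    have "u = [u ! 0, u ! 1, u ! 2]" "v = [v ! 0, v ! 1, v ! 2]"
      by (rule ex, use en_length[OF u] en_length[OF v(1)] in simp)+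
    moreover have "is_word n u" using en_word[OF n u w] .
    ultimately show ?thesis using r3_rel v by metis
  qed
  then show ?thesis using G by (auto simp: ecompat_def G3_def)
qed

lemma ltl_le_cases:
  assumes "is_letter n x" "is_letter n y" "le n x y" "le n y (- x)"
  shows "y = x \<or> ltl x y" "y = - x \<or> ltl y (- x)"
  using assms by (auto simp: le_ltl)

lemma rel_word:
  assumes "0 < n" "rel n u v" shows "is_word n u \<and> is_word n v"
  using assms(2)
proof cases
  case (R5 )
  have r: "y \<in> set (remove1 z xs) \<Longrightarrow> y \<in> set xs" for y z :: int and xs
    by (meson in_mono set_remove1_subset)
  have "set (R5_tilde n u) \<subseteq> set u"
    by (auto simp: R5_tilde_def Let_def dest!: r)
  with R5 show ?thesis by (auto simp: R5_word_def is_col_def is_word_def)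
qed (auto simp: is_letter_def)

lemma rel3_ecompat:
  assumes n: "0 < n" and i: "i \<in> {1..n}" and r: "rel n u v" and R5: "\<not> (R5_word n u \<and> v = R5_tilde n u)"
  shows "ecompat n i u v"
proof -
  have b: "- int n \<le> x \<and> x \<le> int n" if "is_letter n x" for x using that by (simp add: is_letter_def)
  have wu: "is_word n u" using rel_word[OF n r] by simp
  consider "1 \<le> i" "i < n" | "i = n" "1 \<le> n" using i by fastforce
  note ic = this
  from r show ?thesis
  proof cases
    case (R1a x y z)
    from R1a have "ltl x y" "ltl y z" by (auto simp: lt_ltl)
    then have "G3 n i y z x y x z" using G3_R1a_small[of i n x y z] G3_R1a_n[of n x y z] R1a b ic by auto
    then show ?thesis using G3_ecompat n wu R1a by metis
  next
    case (R1b x y z)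
    from R1b have "ltl x y" "ltl y z" by (auto simp: lt_ltl)
    then have "G3 n i x z y z x y" using G3_R1b_small[of i n x y z] G3_R1b_n[of n x y z] R1b b ic by auto
    then show ?thesis using G3_ecompat n wu R1b by metis
  next
    case (R2a x y)
    from R2a have "ltl x y" by (auto simp: lt_ltl)
    then have "G3 n i x y x x x y" using G3_R2a_small[of i n x y] G3_R2a_n[of n x y] R2a b ic by auto
    then show ?thesis using G3_ecompat n wu R2a by metis
  next
    case (R2b x y)
    from R2b have "ltl x y" by (auto simp: lt_ltl)
    then have "G3 n i x y y y x y" using G3_R2b_small[of i n x y] G3_R2b_n[of n x y] R2b b ic by auto
    then show ?thesis using G3_ecompat n wu R2b by metis
  next
    case (R3a y x)
    have "is_letter n x" using R3a by (simp add: is_letter_def)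
    then have "y = x \<or> ltl x y" "y = - x \<or> ltl y (- x)" using ltl_le_cases[of n x y] R3a by auto
    then have "G3 n i y (- (x - 1)) (x - 1) y x (- x)"
      using G3_R3a_small[of i n x y] G3_R3a_n[of n x y] R3a b[of y] ic by auto
    then show ?thesis using G3_ecompat n wu R3a by metis
  next
    case (R3b y x)
    have "is_letter n x" using R3b by (simp add: is_letter_def)
    then have "y = x \<or> ltl x y" "y = - x \<or> ltl y (- x)" using ltl_le_cases[of n x y] R3b by auto
    then have "G3 n i x (- x) y (- (x - 1)) (x - 1) y"
      using G3_R3b_small[of i n x y] G3_R3b_n[of n x y] R3b b[of y] ic by auto
    then show ?thesis using G3_ecompat n wu R3b by metis
  next
    case R3c
    then have "G3 n i 0 (- int n) (int n) (- int n) (int n) 0"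
      using G3_R3c_small[of i n] G3_R3c_n[of n] ic by auto
    then show ?thesis using G3_ecompat n wu R3c by metis
  next
    case (R4a x)
    then have "G3 n i 0 0 x 0 x 0" using G3_R4a_small[of i n x] G3_R4a_n[of n x] ic by auto
    then show ?thesis using G3_ecompat n wu R4a by metis
  next
    case (R4b x)
    then have "G3 n i 0 (- x) 0 (- x) 0 0" using G3_R4b_small[of i n x] G3_R4b_n[of n x] ic by auto
    then show ?thesis using G3_ecompat n wu R4b by metis
  next
    case R5
    then show ?thesis using assms(4) by blast
  qed
qed

subsection \<open>Compatibility of the column relation\<close>

text \<open>A column is determined by its nonzero letters and its number of zeros. Filtering the two
  integer intervals produces increasing order and ignores everything else in \<open>S\<close>, so
  \<open>S\<close> may also be the letter set of a column containing 0.\<close>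

definition colw :: "nat \<Rightarrow> int set \<Rightarrow> nat \<Rightarrow> int list" where
  "colw n S m = filter (\<lambda>x. x \<in> S) [1..int n] @ replicate m 0 @ filter (\<lambda>x. x \<in> S) [- int n..-1]"

primrec Ncnt :: "int set \<Rightarrow> nat \<Rightarrow> nat" where
  "Ncnt S 0 = 0"
| "Ncnt S (Suc k) = Ncnt S k + of_bool (int (Suc k) \<in> S) + of_bool (- int (Suc k) \<in> S)"

lemma Ncnt_filter: "Ncnt S k = length (filter (\<lambda>x. x \<in> S) [1..int k]) + length (filter (\<lambda>x. x \<in> S) [- int k..-1])"
proof (induction k)
  case (Suc k)
  have "[1..int (Suc k)] = [1..int k] @ [int (Suc k)]" using upto_rec2[of 1 "int (Suc k)"] by simp
  moreover have "[- int (Suc k)..-1] = (- int (Suc k)) # [- int k..-1]"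
    using upto_rec1[of "- int (Suc k)" "-1"] by simp
  ultimately show ?case using Suc by (simp del: of_nat_Suc)
qed simp

lemma length_colw: "length (colw n S m) = m + Ncnt S n"
  by (simp add: colw_def Ncnt_filter)

lemma set_colw: "set (colw n S m) = {x \<in> S. (1 \<le> x \<and> x \<le> int n) \<or> (- int n \<le> x \<and> x \<le> -1)} \<union> (if m = 0 then {} else {0})"
  by (auto simp: colw_def)

lemma Ncount_colw:
  assumes "1 \<le> k" "k \<le> n"
  shows "Ncount n (colw n S m) (int k) = Ncnt S k"
proof -
  have u: "[1..int n] = [1..int k] @ [int k + 1..int n]" using assms by (intro upto_split2) auto
  have l: "[- int n..-1] = [- int n..- int k - 1] @ [- int k..-1]"
    using assms upto_split2[of "- int n" "- int k - 1" "-1"] by (cases "k = n") auto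
  have lec: "le n x (int k) \<or> le n (- int k) x \<longleftrightarrow> (1 \<le> x \<and> x \<le> int k) \<or> (- int k \<le> x \<and> x \<le> - 1)" if "- int n \<le> x" "x \<le> int n" for x
    using that assms by (auto simp: le_def rk_def)
  have f: "filter (\<lambda>x. le n x (int k) \<or> le n (- int k) x) (filter (\<lambda>x. x \<in> S) xs) = filter (\<lambda>x. x \<in> S) xs"
    if "\<forall>x\<in>set xs. (1 \<le> x \<and> x \<le> int k) \<or> (- int k \<le> x \<and> x \<le> -1)" for xs
  proof -
    have "\<forall>x\<in>set xs. le n x (int k) \<or> le n (- int k) x"
    proof
      fix x assume "x \<in> set xs"
      then show "le n x (int k) \<or> le n (- int k) x" using lec[of x] that assms by fastforce
    qed
    note le = this
    show ?thesis unfolding filter_filter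
    proof (rule filter_cong[OF HOL.refl])
      fix x assume "x \<in> set xs"
      with le show "(x \<in> S \<and> (le n x (int k) \<or> le n (- int k) x)) = (x \<in> S)" by blast
    qed
  qed
  have g: "filter (\<lambda>x. le n x (int k) \<or> le n (- int k) x) (filter (\<lambda>x. x \<in> S) xs) = []"
    if "\<forall>x\<in>set xs. - int n \<le> x \<and> x \<le> int n \<and> \<not> ((1 \<le> x \<and> x \<le> int k) \<or> (- int k \<le> x \<and> x \<le> -1))" for xs
    using that by (auto simp: filter_empty_conv lec)
  have z: "filter (\<lambda>x. le n x (int k) \<or> le n (- int k) x) (replicate m 0) = []"
    using assms by (auto simp: filter_empty_conv le_def rk_def)
  let ?N = "\<lambda>xs. filter (\<lambda>x. le n x (int k) \<or> le n (- int k) x) (filter (\<lambda>x. x \<in> S) xs)"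
  have "?N [1..int k] = filter (\<lambda>x. x \<in> S) [1..int k]" "?N [- int k..-1] = filter (\<lambda>x. x \<in> S) [- int k..-1]"
    by (rule f; simp)+
  moreover have "?N [int k + 1..int n] = []" "?N [- int n..- int k - 1] = []"
    by (rule g; use assms in auto)+
  ultimately show ?thesis
    unfolding Ncount_def colw_def u l filter_append length_append Ncnt_filter z by simp
qed

section \<open>Columns as letter sets with a number of zeros\<close>

definition colrel :: "nat \<Rightarrow> int \<Rightarrow> int \<Rightarrow> bool" where
  "colrel n x y \<longleftrightarrow> lt n x y \<or> (x = 0 \<and> y = 0)"

lemma is_col_sorted: "is_col n w \<longleftrightarrow> is_word n w \<and> sorted_wrt (colrel n) w"
proof -
  have "transp (colrel n)" by (auto simp: transp_def colrel_def lt_def)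
  then show ?thesis
    by (auto simp: is_col_def colrel_def sorted_wrt_iff_nth_Suc_transp)
qed

lemma is_col_colw: "is_col n (colw n S m)"
proof -
  have 1: "sorted_wrt (colrel n) (filter P xs)" if "sorted_wrt (<) xs" "\<forall>x\<in>set xs. \<forall>y\<in>set xs. x < y \<longrightarrow> colrel n x y" for P and xs :: "int list"
    using that sorted_wrt_filter[of "(<)" xs P]
    by (auto intro: sorted_wrt_mono_rel[of "filter P xs" "(<)"])
  have "sorted_wrt (colrel n) (filter (\<lambda>x. x \<in> S) [1..int n])"
    by (rule 1) (auto simp: colrel_def lt_def rk_def)
  moreover have "sorted_wrt (colrel n) (filter (\<lambda>x. x \<in> S) [- int n..-1])"
    by (rule 1) (auto simp: colrel_def lt_def rk_def)
  moreover have "sorted_wrt (colrel n) (replicate m 0)"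
    by (auto simp: sorted_wrt_iff_nth_less colrel_def)
  ultimately have "sorted_wrt (colrel n) (colw n S m)"
    unfolding colw_def sorted_wrt_append by (auto simp: colrel_def lt_def rk_def)
  moreover have "is_word n (colw n S m)"
    by (auto simp: is_word_def set_colw is_letter_def split: if_splits)
  ultimately show ?thesis by (simp add: is_col_sorted)
qed

lemma is_col_eq_colw:
  assumes "is_col n w"
  shows "w = colw n (set w) (count_list w 0)"
proof -
  have w: "is_word n w" "sorted_wrt (colrel n) w" using assms by (auto simp: is_col_sorted)
  then show ?thesis
  proof (induction w)
    case (Cons x w)
    then have IH: "w = colw n (set w) (count_list w 0)" and x: "- int n \<le> x" "x \<le> int n"
      and gr: "\<forall>y\<in>set w. colrel n x y" and wl: "\<forall>y\<in>set w. - int n \<le> y \<and> y \<le> int n"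
      by (auto simp: is_letter_def is_word_def)
    have nx: "y \<in> set w \<Longrightarrow> x \<noteq> 0 \<Longrightarrow> y \<noteq> x" for y using gr by (auto simp: colrel_def lt_def)
    consider "x > 0" | "x = 0" | "x < 0" by linarith
    then show ?case
    proof cases
      case 1
      then have y: "y \<in> set w \<Longrightarrow> y \<le> 0 \<or> x < y" for y using gr x wl by (force simp: colrel_def lt_def rk_def split: if_splits)
      have u: "[1..int n] = [1..x - 1] @ x # [x + 1..int n]" using 1 x by (intro upto_split3) auto
      have e1: "filter (\<lambda>y. y = x \<or> y \<in> set w) [1..x - 1] = []" "filter (\<lambda>y. y \<in> set w) [1..x - 1] = []"
        using y by (force simp: filter_empty_conv)+
      have e0: "x \<notin> set w" using nx 1 by blast
      have e2: "filter (\<lambda>y. y = x \<or> y \<in> set w) [x + 1..int n] = filter (\<lambda>y. y \<in> set w) [x + 1..int n]"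
        "filter (\<lambda>y. y = x \<or> y \<in> set w) [- int n..-1] = filter (\<lambda>y. y \<in> set w) [- int n..-1]"
        using 1 by (auto intro!: filter_cong)
      show ?thesis using IH 1 unfolding colw_def u by (simp add: e0 e1 e2)
    next
      case 2
      then have y: "y \<in> set w \<Longrightarrow> y \<le> 0" for y using gr x wl by (force simp: colrel_def lt_def rk_def split: if_splits)
      have e1: "filter (\<lambda>y. y = 0 \<or> y \<in> set w) [1..int n] = []" "filter (\<lambda>y. y \<in> set w) [1..int n] = []"
        using y by (force simp: filter_empty_conv)+
      have e2: "filter (\<lambda>y. y = 0 \<or> y \<in> set w) [- int n..-1] = filter (\<lambda>y. y \<in> set w) [- int n..-1]"
        by (auto intro!: filter_cong)
      show ?thesis using IH 2 unfolding colw_def by (simp add: e1 e2)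
    next
      case 3
      then have y: "y \<in> set w \<Longrightarrow> x < y \<and> y < 0" for y using gr x wl by (force simp: colrel_def lt_def rk_def split: if_splits)
      have u: "[- int n..-1] = [- int n..x - 1] @ x # [x + 1..-1]" using 3 x by (intro upto_split3) auto
      have e1: "filter (\<lambda>y. y = x \<or> y \<in> set w) [1..int n] = []" "filter (\<lambda>y. y \<in> set w) [1..int n] = []"
        "filter (\<lambda>y. y = x \<or> y \<in> set w) [- int n..x - 1] = []" "filter (\<lambda>y. y \<in> set w) [- int n..x - 1] = []" "x \<notin> set w" "0 \<notin> set w"
        using y 3 by (force simp: filter_empty_conv)+
      have e2: "filter (\<lambda>y. y = x \<or> y \<in> set w) [x + 1..-1] = filter (\<lambda>y. y \<in> set w) [x + 1..-1]"
        using 3 by (auto intro!: filter_cong)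
      have c0: "count_list w 0 = 0" using e1 by (simp add: count_list_0_iff)
      show ?thesis using IH 3 unfolding colw_def u by (simp add: e1 e2 c0)
    qed
  qed (simp add: colw_def)
qed

lemma remove1_filter_distinct:
  "distinct xs \<Longrightarrow> remove1 z (filter P xs) = filter (\<lambda>x. P x \<and> x \<noteq> z) xs"
  by (induction xs) (auto intro!: filter_cong)

lemma colw_remove_pair:
  assumes "1 \<le> z" "z \<le> int n" "z \<in> S" "- z \<in> S"
  shows "remove1 z (remove1 (- z) (colw n S m)) = colw n (S - {z, - z}) m"
proof -
  have a: "remove1 (- z) (colw n S m) = filter (\<lambda>x. x \<in> S) [1..int n] @ replicate m 0 @ filter (\<lambda>x. x \<in> S \<and> x \<noteq> - z) [- int n..-1]"
    using assms by (auto simp: colw_def remove1_append remove1_filter_distinct)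
  have b: "remove1 z (remove1 (- z) (colw n S m)) = filter (\<lambda>x. x \<in> S \<and> x \<noteq> z) [1..int n] @ replicate m 0 @ filter (\<lambda>x. x \<in> S \<and> x \<noteq> - z) [- int n..-1]"
    unfolding a using assms by (auto simp: remove1_append remove1_filter_distinct)
  have "filter (\<lambda>x. x \<in> S \<and> x \<noteq> z) [1..int n] = filter (\<lambda>x. x \<in> S - {z, - z}) [1..int n]"
    "filter (\<lambda>x. x \<in> S \<and> x \<noteq> - z) [- int n..-1] = filter (\<lambda>x. x \<in> S - {z, - z}) [- int n..-1]"
    using assms by (auto intro!: filter_cong)
  then show ?thesis unfolding b unfolding colw_def by simp
qed

lemma colw_remove_zero: "remove1 0 (colw n S (Suc m)) = colw n S m"
  by (simp add: colw_def remove1_append)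

text \<open>In a column containing \<open>z\<close> and its bar at positions \<open>p\<close> and \<open>q\<close>, the letters counted by
  \<open>N(z)\<close> are those up to position \<open>p\<close> and those from position \<open>q\<close> on.\<close>

lemma Ncount_positions:
  assumes col: "is_col n w" and z: "1 \<le> z" "z \<le> int n"
    and p: "p < length w" "w ! p = z" and q: "q < length w" "w ! q = - z"
  shows "p < q" "Ncount n w z = p + 1 + (length w - q)"
proof -
  have s: "i < j \<Longrightarrow> j < length w \<Longrightarrow> colrel n (w ! i) (w ! j)" for i j
    using col by (auto simp: is_col_sorted sorted_wrt_iff_nth_less)
  show pq: "p < q"
  proof (rule ccontr)
    assume "\<not> p < q"
    moreover have "p \<noteq> q" using p q z by auto
    ultimately have "colrel n (- z) z" using s[of q p] p q by auto
    then show False using z by (auto simp: colrel_def lt_def rk_def)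
  qed
  have 1: "le n (w ! k) z \<longleftrightarrow> k \<le> p" if "k < length w" for k
    using s[of k p] s[of p k] that p z by (cases k p rule: linorder_cases) (auto simp: colrel_def lt_def le_def)
  have 2: "le n (- z) (w ! k) \<longleftrightarrow> q \<le> k" if "k < length w" for k
    using s[of k q] s[of q k] that q z by (cases k q rule: linorder_cases) (auto simp: colrel_def lt_def le_def)
  have "Ncount n w z = card {k. k < length w \<and> (k \<le> p \<or> q \<le> k)}"
    unfolding Ncount_def length_filter_conv_card by (rule arg_cong[where f = card]) (auto simp: 1 2)
  also have "{k. k < length w \<and> (k \<le> p \<or> q \<le> k)} = {0..<p + 1} \<union> {q..<length w}"
    using pq q by auto
  also have "card \<dots> = p + 1 + (length w - q)"
    using pq by (subst card_Un_disjoint) auto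
  finally show "Ncount n w z = p + 1 + (length w - q)" .
qed

section \<open>Minimal non-admissible columns\<close>

definition R5c :: "nat \<Rightarrow> int set \<Rightarrow> nat \<Rightarrow> bool" where
  "R5c n S m \<longleftrightarrow> (\<forall>k\<le>n. Ncnt S k \<le> k + 1) \<and> m + Ncnt S n \<le> n + 1 \<and>
     (m + Ncnt S n = n + 1 \<or> (\<exists>k\<le>n. Ncnt S k = k + 1))"

definition lowest :: "int set \<Rightarrow> nat \<Rightarrow> bool" where
  "lowest S z \<longleftrightarrow> 1 \<le> z \<and> Ncnt S z = z + 1 \<and> (\<forall>k<z. Ncnt S k \<le> k)"

text \<open>From \<open>z - 1\<close> to \<open>z\<close> the count climbs from at most
  \<open>z - 1\<close> to \<open>z + 1\<close>, and a single index contributes at most two.\<close>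

lemma lowest_pair: assumes "lowest S z" shows "int z \<in> S" "- int z \<in> S" "Ncnt S (z - 1) = z - 1"
proof -
  obtain y where y: "z = Suc y" using assms by (cases z) (auto simp: lowest_def)
  have "Ncnt S y \<le> y" "Ncnt S (Suc y) = Suc y + 1" using assms y by (auto simp: lowest_def)
  then have "int (Suc y) \<in> S \<and> - int (Suc y) \<in> S \<and> Ncnt S y = y"
    by (cases "int (Suc y) \<in> S"; cases "- int (Suc y) \<in> S") (auto simp del: of_nat_Suc)
  then show "int z \<in> S" "- int z \<in> S" "Ncnt S (z - 1) = z - 1" using y by auto
qed

lemma exists_lowest:
  assumes "\<forall>k\<le>n. Ncnt S k \<le> k + 1" "k \<le> n" "Ncnt S k > k"
  shows "\<exists>z\<le>n. lowest S z"
proof -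
  let ?P = "\<lambda>k. k \<le> n \<and> Ncnt S k > k"
  let ?z = "LEAST k. ?P k"
  have P: "?P ?z" by (rule LeastI[of ?P k]) (use assms in auto)
  have "Ncnt S j \<le> j" if "j < ?z" for j using not_less_Least[OF that] P that by auto
  moreover have "?z \<noteq> 0" using P by (metis Ncnt.simps(1) less_irrefl)
  ultimately have "lowest S ?z" using P assms(1) by (auto simp: lowest_def Suc_le_eq intro: le_antisym)
  then show ?thesis using P by blast
qed

text \<open>The column relation freed from positions in a word: either a pair leaves
  \<open>S\<close> or a zero leaves the multiplicity \<open>m\<close>. The two alternatives exclude
  each other, as in \<open>R5_tilde\<close>.\<close>

definition colpair :: "nat \<Rightarrow> int list \<Rightarrow> int list \<Rightarrow> bool" where
  "colpair n u v \<longleftrightarrow> (\<exists>S m. R5c n S m \<and> u = colw n S m \<and>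
     ((\<exists>z\<le>n. lowest S z \<and> v = colw n (S - {int z, - int z}) m) \<or>
      ((\<forall>k\<le>n. Ncnt S k \<le> k) \<and> m > 0 \<and> v = colw n S (m - 1))))"


lemma colw_positions:
  assumes "1 \<le> k" "k \<le> n" "int k \<in> S" "- int k \<in> S"
  obtains p q where "p < length (colw n S m)" "colw n S m ! p = int k"
    "q < length (colw n S m)" "colw n S m ! q = - int k"
proof -
  have "int k \<in> set (colw n S m)" "- int k \<in> set (colw n S m)" using assms by (auto simp: set_colw)
  then show thesis using that by (metis in_set_conv_nth)
qed

lemma admissible_pairD:
  assumes "admissible n C" "1 \<le> z" "z \<le> int n" "p < length C" "q < length C" "C ! p = z" "C ! q = - z"
  shows "\<bar>int q - int p\<bar> \<ge> int (length C) - z + 1"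
  using assms unfolding admissible_def by blast

lemma R5_word_imp_R5c:
  assumes R: "R5_word n (colw n S m)"
  shows "R5c n S m"
proof -
  let ?w = "colw n S m"
  let ?l = "length ?w"
  have f: "i \<le> j \<Longrightarrow> j \<le> ?l \<Longrightarrow> (i, j) \<noteq> (0, ?l) \<Longrightarrow> admissible n (take (j - i) (drop i ?w))" for i j
    using R by (auto simp: R5_word_def)
  have na: "\<not> admissible n ?w" using R by (simp add: R5_word_def)
  have "?l \<noteq> 0" using na by (auto simp: admissible_def is_col_def)
  then have l: "1 \<le> ?l" by linarith
  have a1: "admissible n (drop 1 ?w)" using f[of 1 ?l] l by simp
  have a2: "admissible n (take (?l - 1) ?w)" using f[of 0 "?l - 1"] l by simp
  have "length (drop 1 ?w) \<le> n" using a1 by (simp only: admissible_def)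
  then have len: "?l \<le> n + 1" by simp
  have pair: "Ncnt S k \<le> k + 1" if k: "1 \<le> k" "k \<le> n" "int k \<in> S" "- int k \<in> S" for k
  proof -
    obtain p q where p: "p < ?l" "?w ! p = int k" and q: "q < ?l" "?w ! q = - int k"
      using colw_positions[OF k] by blast
    have pq: "p < q" "Ncnt S k = p + 1 + (?l - q)"
      using Ncount_positions[OF is_col_colw _ _ p q] k Ncount_colw[OF k(1,2)] by auto
    \<comment> \<open>If a letter outside the pair is dropped at one end, it was counted by N(k), so
      admissibility of the rest gives N(k) - 1 \<le> k. If the pair occupies both ends, then N(k) =
      2.\<close>
    consider "p > 0" | "q < ?l - 1" | "p = 0" "q = ?l - 1" using q by linarith
    then show ?thesis
    proof cases
      case 1
      have "\<bar>int (q - 1) - int (p - 1)\<bar> \<ge> int (length (drop 1 ?w)) - int k + 1"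
        by (rule admissible_pairD[OF a1]) (use 1 p q pq(1) k in auto)
      then show ?thesis using pq 1 q(1) by simp
    next
      case 2
      have "\<bar>int q - int p\<bar> \<ge> int (length (take (?l - 1) ?w)) - int k + 1"
        by (rule admissible_pairD[OF a2]) (use 2 p q pq(1) k in auto)
      then show ?thesis using pq 2 q(1) by simp
    next
      case 3
      then show ?thesis using pq k l by simp
    qed
  qed
  \<comment> \<open>An index without its pair adds at most one to the count, so the bound carries
    over from its predecessor.\<close>
  have all: "k \<le> n \<Longrightarrow> Ncnt S k \<le> k + 1" for k
  proof (induction k)
    case (Suc k)
    then show ?case using pair[of "Suc k"]
      by (cases "int (Suc k) \<in> S"; cases "- int (Suc k) \<in> S") (auto simp del: of_nat_Suc)
  qed simp
  have "m + Ncnt S n = n + 1 \<or> (\<exists>k\<le>n. Ncnt S k = k + 1)"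
  proof (cases "?l \<le> n")
    case True
    then obtain z p q where z: "1 \<le> z" "z \<le> int n" "p < ?l" "q < ?l" "?w ! p = z" "?w ! q = - z"
        "\<bar>int q - int p\<bar> < int ?l - z + 1"
      using na is_col_colw[of n S m] by (auto simp: admissible_def not_le)
    have pq: "p < q" "Ncount n ?w z = p + 1 + (?l - q)"
      using Ncount_positions[OF is_col_colw z(1,2,3,5,4,6)] by auto
    have k: "z = int (nat z)" "1 \<le> nat z" "nat z \<le> n" using z by auto
    then have "Ncnt S (nat z) = p + 1 + (?l - q)" using pq Ncount_colw by metis
    then have "Ncnt S (nat z) \<ge> nat z + 1" using z pq by simp
    then show ?thesis using all[of "nat z"] k by (metis le_antisym)
  next
    case False
    then show ?thesis using len by (simp add: length_colw)
  qed
  then show ?thesis using all len by (auto simp: R5c_def length_colw)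
qed

text \<open>A proper factor containing \<open>z\<close> and its bar loses only letters outside the
  segment between them. All of these are counted by N(z), so the count drops by at least one, from
  \<open>z + 1\<close> to at most \<open>z\<close>.\<close>

lemma R5c_imp_R5_word:
  assumes R: "R5c n S m"
  shows "R5_word n (colw n S m)"
proof -
  let ?w = "colw n S m"
  let ?l = "length ?w"
  have l: "?l \<le> n + 1" using R by (simp add: R5c_def length_colw)
  have col: "sorted_wrt (colrel n) ?w" "is_word n ?w" using is_col_colw[of n S m] by (auto simp: is_col_sorted)
  have "admissible n (take (j - i) (drop i ?w))" if ij: "i \<le> j" "j \<le> ?l" "(i, j) \<noteq> (0, ?l)" for i j
  proof -
    let ?f = "take (j - i) (drop i ?w)"
    have lf: "length ?f = j - i" using ij by simp
    have "is_col n ?f" unfolding is_col_sorted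
      using col by (auto intro: sorted_wrt_take sorted_wrt_drop simp: is_word_def dest: in_set_takeD in_set_dropD)
    moreover have "length ?f \<le> n" using lf ij l by auto
    moreover have "\<bar>int q - int p\<bar> \<ge> int (length ?f) - z + 1"
      if z: "1 \<le> z" "z \<le> int n" "p < length ?f" "q < length ?f" "?f ! p = z" "?f ! q = - z" for z p q
    proof -
      have p: "i + p < ?l" "?w ! (i + p) = z" and q: "i + q < ?l" "?w ! (i + q) = - z" using z ij by auto
      have pq: "i + p < i + q" "Ncount n ?w z = i + p + 1 + (?l - (i + q))"
        using Ncount_positions[OF is_col_colw z(1,2) p q] by auto
      have k: "z = int (nat z)" "1 \<le> nat z" "nat z \<le> n" using z by auto
      then have "Ncount n ?w z = Ncnt S (nat z)" using Ncount_colw by metis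
      then have "i + p + 1 + (?l - (i + q)) \<le> nat z + 1" using R pq k by (auto simp: R5c_def)
      then show ?thesis using lf pq q ij z(1) by auto
    qed
    ultimately show ?thesis by (auto simp: admissible_def)
  qed
  moreover have "\<not> admissible n ?w"
  proof (cases "\<exists>k\<le>n. Ncnt S k = k + 1")
    case True
    then obtain k where k: "k \<le> n" "Ncnt S k > k" by auto
    obtain z where z: "z \<le> n" "lowest S z" using exists_lowest[OF _ k] R by (auto simp: R5c_def)
    then have z1: "1 \<le> z" "Ncnt S z = z + 1" by (auto simp: lowest_def)
    obtain p q where p: "p < ?l" "?w ! p = int z" and q: "q < ?l" "?w ! q = - int z"
      using colw_positions[OF z1(1) z(1) lowest_pair(1,2)[OF z(2)]] by blast
    have "p < q" "Ncnt S z = p + 1 + (?l - q)"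
      using Ncount_positions[OF is_col_colw _ _ p q] z z1 Ncount_colw[OF z1(1) z(1)] by auto
    then have "\<not> int ?l - int z + 1 \<le> \<bar>int q - int p\<bar>" using z1 q by auto
    then show ?thesis using p q z z1 unfolding admissible_def
      by (metis of_nat_1 of_nat_le_iff)
  next
    case False
    then have "n < ?l" using R by (auto simp: R5c_def length_colw)
    then show ?thesis by (simp add: admissible_def)
  qed
  ultimately show ?thesis using is_col_colw by (auto simp: R5_word_def)
qed

lemma R5_tilde_colw:
  assumes "colpair n u v"
  shows "R5_word n u" "v = R5_tilde n u"
proof -
  obtain S m where S: "R5c n S m" "u = colw n S m" and
     v: "(\<exists>z\<le>n. lowest S z \<and> v = colw n (S - {int z, - int z}) m) \<or>
      ((\<forall>k\<le>n. Ncnt S k \<le> k) \<and> m > 0 \<and> v = colw n S (m - 1))"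
    using assms by (auto simp: colpair_def)
  show "R5_word n u" using R5c_imp_R5_word S by simp
  let ?P = "\<lambda>z. 1 \<le> z \<and> z \<le> int n \<and> z \<in> set u \<and> - z \<in> set u \<and> int (Ncount n u z) > z"
  have P: "Ncnt S (nat y) > nat y \<and> nat y \<le> n" if "?P y" for y
  proof -
    have "Ncount n u (int (nat y)) = Ncnt S (nat y)" using Ncount_colw[of "nat y" n S m] that S by auto
    then show ?thesis using that by auto
  qed
  from v show "v = R5_tilde n u"
  proof
    assume "\<exists>z\<le>n. lowest S z \<and> v = colw n (S - {int z, - int z}) m"
    then obtain z where z: "z \<le> n" "lowest S z" "v = colw n (S - {int z, - int z}) m" by blast
    have z1: "1 \<le> z" "Ncnt S z = z + 1" "\<forall>k<z. Ncnt S k \<le> k" using z by (auto simp: lowest_def)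
    have zz: "?P (int z)"
      using lowest_pair[OF z(2)] z1 z(1) Ncount_colw[OF z1(1) z(1), of S m] S by (auto simp: set_colw)
    moreover have "(LEAST y. ?P y) = int z"
    proof (rule Least_equality)
      show "?P (int z)" by (rule zz)
      fix y assume y: "?P y"
      then have "\<not> nat y < z" using P[OF y] z1(3) by fastforce
      then show "int z \<le> y" using y by linarith
    qed
    ultimately have "R5_tilde n u = remove1 (int z) (remove1 (- int z) u)"
      unfolding R5_tilde_def Let_def by (metis (mono_tags, lifting))
    then show ?thesis using colw_remove_pair[of "int z" n S m] lowest_pair[OF z(2)] z z1 S by simp
  next
    assume a: "(\<forall>k\<le>n. Ncnt S k \<le> k) \<and> m > 0 \<and> v = colw n S (m - 1)"
    then have nP: "\<not> (\<exists>y. ?P y)" using P by (meson not_le)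
    have "R5_tilde n u = remove1 0 u" unfolding R5_tilde_def by (rule if_not_P[OF nP])
    then show ?thesis using colw_remove_zero[of n S "m - 1"] a S by simp
  qed
qed

text \<open>If no count exceeds its index, the length is \<open>n + 1\<close> while at most
  \<open>n\<close> letters are nonzero, so there is a zero to erase.\<close>

lemma R5_word_colpair:
  assumes "R5_word n u"
  shows "colpair n u (R5_tilde n u)"
proof -
  obtain S m where u: "u = colw n S m" using assms is_col_eq_colw by (auto simp: R5_word_def)
  have R: "R5c n S m" using R5_word_imp_R5c assms u by simp
  have "\<exists>v. colpair n u v"
  proof (cases "\<exists>k\<le>n. Ncnt S k > k")
    case True
    then obtain z where "z \<le> n" "lowest S z" using exists_lowest R by (metis R5c_def)
    then show ?thesis using R u by (auto simp: colpair_def)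
  next
    case False
    then have "m + Ncnt S n = n + 1" "Ncnt S n \<le> n" using R by (auto simp: R5c_def not_less)
    then have "m > 0" by linarith
    then show ?thesis using R u False by (auto simp: colpair_def not_less)
  qed
  then show ?thesis using R5_tilde_colw(2) by metis
qed


section \<open>Raising operators on a column\<close>

lemma eps_trivial:
  assumes "\<forall>x\<in>set A. el n i x = 0 \<and> pl n i x = 0"
  shows "eps n i A = 0" "phi n i A = 0"
  using assms by (induction A) auto

lemma action_middle:
  assumes n: "0 < n" and A: "\<forall>x\<in>set A. el n i x = 0 \<and> pl n i x = 0" and C: "\<forall>x\<in>set C. el n i x = 0 \<and> pl n i x = 0"
  shows "eps n i (A @ w @ C) = eps n i w" "phi n i (A @ w @ C) = phi n i w"
    "en n i (A @ w @ C) = map_option (\<lambda>w'. A @ w' @ C) (en n i w)"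
  using eps_trivial[OF A] eps_trivial[OF C] en_None[OF n, of i A] en_None[OF n, of i w]
  by (auto simp: eps_append phi_append en_append[OF n] option.map_comp o_def)

lemma colw_split_small:
  assumes "1 \<le> i" "i < n"
  defines "P \<equiv> \<lambda>S x. x \<in> S"
  shows "colw n S m = filter (P S) [1..int i - 1] @
     (filter (P S) [int i, int i + 1] @ (filter (P S) [int i + 2..int n] @ replicate m 0 @ filter (P S) [- int n..- int i - 2]) @
      filter (P S) [- int i - 1, - int i]) @ filter (P S) [- int i + 1..-1]"
proof -
  have two: "- int i - 1 - 1 = - int i - 2" by simp
  have "[1..int n] = [1..int i - 1] @ int i # [int i + 1..int n]" using assms by (intro upto_split3) auto
  moreover have "[int i + 1..int n] = (int i + 1) # [int i + 2..int n]" using assms upto_rec1[of "int i + 1" "int n"] by (simp add: add.commute)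
  moreover have "[- int n..-1] = [- int n..- int i - 1] @ - int i # [- int i + 1..-1]" using assms by (intro upto_split3) auto
  moreover have "[- int n..- int i - 1] = [- int n..- int i - 2] @ [- int i - 1]" using assms upto_rec2[of "- int n" "- int i - 1", unfolded two] by simp
  ultimately show ?thesis unfolding colw_def P_def by simp
qed

lemma colw_split_n:
  assumes "1 \<le> n"
  defines "P \<equiv> \<lambda>S x. x \<in> S"
  shows "colw n S m = filter (P S) [1..int n - 1] @
     (filter (P S) [int n] @ replicate m 0 @ filter (P S) [- int n]) @ filter (P S) [- int n + 1..-1]"
proof -
  have "[1..int n] = [1..int n - 1] @ [int n]" using assms upto_rec2[of 1 "int n"] by simp
  moreover have "[- int n..-1] = - int n # [- int n + 1..-1]" using assms upto_rec1[of "- int n" "-1"] by simp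
  ultimately show ?thesis unfolding colw_def P_def by simp
qed

lemma trivial_middle:
  assumes "0 < n" and B: "\<forall>x\<in>set B. el n i x = 0 \<and> pl n i x = 0"
  shows "eps n i (u @ B @ v) = eps n i (u @ v)" "phi n i (u @ B @ v) = phi n i (u @ v)"
    "en n i (u @ B @ v) = (if phi n i u < eps n i v then map_option (\<lambda>v'. u @ B @ v') (en n i v) else map_option (\<lambda>u'. u' @ B @ v) (en n i u))"
proof -
  show "eps n i (u @ B @ v) = eps n i (u @ v)" "phi n i (u @ B @ v) = phi n i (u @ v)"
    using eps_trivial[OF B] by (auto simp: eps_append phi_append)
  have "en n i (B @ v) = map_option ((@) B) (en n i v)"
    using action_middle(3)[OF assms(1) B, of "[]" v] by (simp add: fun_eq_iff)
  moreover have "eps n i (B @ v) = eps n i v" using eps_trivial[OF B] by (simp add: eps_append)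
  ultimately show "en n i (u @ B @ v) = (if phi n i u < eps n i v then map_option (\<lambda>v'. u @ B @ v') (en n i v) else map_option (\<lambda>u'. u' @ B @ v) (en n i u))"
    by (auto simp: en_append[OF assms(1), of i u] option.map_comp o_def)
qed

text \<open>For \<open>i < n\<close> only the block of \<open>i\<close>, \<open>i + 1\<close> and
  the block of their bars carry a signature. A full or empty block is neutral, so the column behaves
  like a product of at most two letters.\<close>

lemma colw_small:
  fixes i n S
  assumes i: "1 \<le> i" "i < n"
  defines "a \<equiv> int i \<in> S" and "b \<equiv> int i + 1 \<in> S" and "c \<equiv> - int i - 1 \<in> S" and "d \<equiv> - int i \<in> S"
  shows "eps n i (colw n S m) = (if b \<and> \<not> a then 1 else 0) + (if d \<and> \<not> c \<and> \<not> (a \<and> \<not> b) then 1 else 0)" (is ?E)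
    and "phi n i (colw n S m) = (if c \<and> \<not> d then 1 else 0) + (if a \<and> \<not> b \<and> \<not> (d \<and> \<not> c) then 1 else 0)" (is ?F)
    and "en n i (colw n S m) = (if d \<and> \<not> c \<and> \<not> (a \<and> \<not> b) then Some (colw n (insert (- int i - 1) (S - {- int i})) m)
      else if b \<and> \<not> a then Some (colw n (insert (int i) (S - {int i + 1})) m) else None)" (is ?G)
proof -
  have n: "0 < n" using i by simp
  let ?P = "\<lambda>S x. x \<in> S"
  let ?A = "\<lambda>S. filter (?P S) [1..int i - 1]" and ?C = "\<lambda>S. filter (?P S) [- int i + 1..-1]"
  let ?B = "\<lambda>S. filter (?P S) [int i + 2..int n] @ replicate m 0 @ filter (?P S) [- int n..- int i - 2]"
  let ?u = "\<lambda>S. filter (?P S) [int i, int i + 1]" and ?v = "\<lambda>S. filter (?P S) [- int i - 1, - int i]"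
  have e: "el n i x = (if x = int i + 1 \<or> x = - int i then 1 else 0)"
    "pl n i x = (if x = int i \<or> x = - int i - 1 then 1 else 0)"
    "eL n i x = (if x = int i + 1 then Some (int i) else if x = - int i then Some (- int i - 1) else None)" for x
    using i by (auto simp: el_def pl_alt eL_def)
  have s: "colw n S m = ?A S @ (?u S @ ?B S @ ?v S) @ ?C S" for S
    using colw_split_small[OF i, of S m] by simp
  have t: "\<forall>x\<in>set (?A S). el n i x = 0 \<and> pl n i x = 0" "\<forall>x\<in>set (?B S). el n i x = 0 \<and> pl n i x = 0"
    "\<forall>x\<in>set (?C S). el n i x = 0 \<and> pl n i x = 0" for S
    using i by (auto simp: e)
  have u: "eps n i (?u S) = (if b \<and> \<not> a then 1 else 0)" "phi n i (?u S) = (if a \<and> \<not> b then 1 else 0)"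
    "en n i (?u S) = (if b \<and> \<not> a then Some [int i] else None)"
    "eps n i (?v S) = (if d \<and> \<not> c then 1 else 0)" "phi n i (?v S) = (if c \<and> \<not> d then 1 else 0)"
    "en n i (?v S) = (if d \<and> \<not> c then Some [- int i - 1] else None)"
    using i by (auto simp: e a_def b_def c_def d_def)
  show ?E ?F
    unfolding s unfolding action_middle(1,2)[OF n t(1) t(3)] trivial_middle(1,2)[OF n t(2)]
    unfolding eps_append phi_append u by auto
  let ?S1 = "insert (- int i - 1) (S - {- int i})" and ?S2 = "insert (int i) (S - {int i + 1})"
  have fc: "filter (?P T) xs = filter (?P S) xs" if "\<forall>x\<in>set xs. x \<in> T \<longleftrightarrow> x \<in> S" for T xs
    using that by (auto intro: filter_cong)
  have 1: "?A ?S1 = ?A S" "?B ?S1 = ?B S" "?C ?S1 = ?C S" "?A ?S2 = ?A S" "?B ?S2 = ?B S" "?C ?S2 = ?C S"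
    by (intro arg_cong2[where f = "(@)"] fc HOL.refl; use i in auto)+
  have 2: "?u ?S1 = ?u S" "?v ?S2 = ?v S" using i by auto
  have 3: "d \<Longrightarrow> \<not> c \<Longrightarrow> ?v ?S1 = [- int i - 1]" "b \<Longrightarrow> \<not> a \<Longrightarrow> ?u ?S2 = [int i]"
    using i by (auto simp: a_def b_def c_def d_def)
  have ex: "en n i (colw n S m) = map_option (\<lambda>w. ?A S @ w @ ?C S) (if phi n i (?u S) < eps n i (?v S) then map_option (\<lambda>v'. ?u S @ ?B S @ v') (en n i (?v S)) else map_option (\<lambda>u'. u' @ ?B S @ ?v S) (en n i (?u S)))"
    unfolding s action_middle(3)[OF n t(1) t(3)] trivial_middle(3)[OF n t(2)] ..
  have g1: "colw n ?S1 m = ?A S @ (?u S @ ?B S @ [- int i - 1]) @ ?C S" if "d" "\<not> c"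
    unfolding s[of ?S1] 1 2 3(1)[OF that] ..
  have g2: "colw n ?S2 m = ?A S @ ([int i] @ ?B S @ ?v S) @ ?C S" if "b" "\<not> a"
    unfolding s[of ?S2] 1 2 3(2)[OF that] ..
  show ?G
    unfolding ex u using g1 g2 by (cases a; cases b; cases c; cases d) simp_all
qed

text \<open>The lowering of each zero cancels against the raising of the next, so a run of zeros
  acts like a single zero, and the leftmost one is raised.\<close>

lemma replicate_zero_action:
  assumes "0 < n"
  shows "eps n n (replicate m 0) = of_bool (m > 0)" "phi n n (replicate m 0) = of_bool (m > 0)"
    "en n n (replicate m 0) = (if m > 0 then Some (int n # replicate (m - 1) 0) else None)"
proof -
  have e: "el n n 0 = 1" "pl n n 0 = 1" "eL n n 0 = Some (int n)" using assms by (auto simp: el_def pl_alt eL_def)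
  have ep: "eps n n (replicate m 0) = of_bool (m > 0) \<and> phi n n (replicate m 0) = of_bool (m > 0)" for m
    by (induction m) (auto simp: e)
  then show "eps n n (replicate m 0) = of_bool (m > 0)" "phi n n (replicate m 0) = of_bool (m > 0)" by auto
  show "en n n (replicate m 0) = (if m > 0 then Some (int n # replicate (m - 1) 0) else None)"
    using ep[of "m - 1"] by (cases m) (auto simp: e)
qed

text \<open>The letter \<open>n\<close> has two lowerings, which cancel all raisings of the zeros
  and of the barred letter. Without it, the bar of \<open>n\<close> has two raisings against at most
  one lowering of the zeros and turns into one more zero.\<close>

lemma colw_n:
  fixes n S
  assumes n: "1 \<le> n"
  defines "a \<equiv> int n \<in> S" and "d \<equiv> - int n \<in> S"
  shows "eps n n (colw n S m) = (if a then 0 else if d then 2 else of_bool (m > 0))" (is ?E)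
    and "phi n n (colw n S m) = (if d then 0 else if a then 2 else of_bool (m > 0))" (is ?F)
    and "en n n (colw n S m) = (if a then None else if d then Some (colw n (S - {- int n}) (Suc m))
      else if m > 0 then Some (colw n (insert (int n) S) (m - 1)) else None)" (is ?G)
proof -
  have n0: "0 < n" using n by simp
  let ?P = "\<lambda>S x. x \<in> S"
  let ?A = "\<lambda>S. filter (?P S) [1..int n - 1]" and ?C = "\<lambda>S. filter (?P S) [- int n + 1..-1]"
  let ?u = "\<lambda>S. filter (?P S) [int n]" and ?v = "\<lambda>S. filter (?P S) [- int n]"
  have e: "el n n x = (if x = 0 then 1 else if x = - int n then 2 else 0)"
    "pl n n x = (if x = 0 then 1 else if x = int n then 2 else 0)"
    "eL n n x = (if x = 0 then Some (int n) else if x = - int n then Some 0 else None)" for x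
    using n by (auto simp: el_def pl_alt eL_def)
  have s: "colw n S m = ?A S @ (?u S @ replicate m 0 @ ?v S) @ ?C S" for S m
    using colw_split_n[OF n, of S m] by simp
  have t: "\<forall>x\<in>set (?A S). el n n x = 0 \<and> pl n n x = 0" "\<forall>x\<in>set (?C S). el n n x = 0 \<and> pl n n x = 0" for S
    using n by (auto simp: e)
  have u: "eps n n (?u S) = 0" "phi n n (?u S) = (if a then 2 else 0)" "en n n (?u S) = None"
    "eps n n (?v S) = (if d then 2 else 0)" "phi n n (?v S) = 0"
    "en n n (?v S) = (if d then Some [0] else None)"
    using n by (auto simp: e a_def d_def)
  show ?E ?F
    unfolding s unfolding action_middle(1,2)[OF n0 t] unfolding eps_append phi_append u replicate_zero_action[OF n0]
    by auto
  let ?S1 = "S - {- int n}" and ?S2 = "insert (int n) S"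
  have 1: "?A ?S1 = ?A S" "?C ?S1 = ?C S" "?A ?S2 = ?A S" "?C ?S2 = ?C S"
    using n by (auto intro!: filter_cong)
  have 2: "?u ?S1 = ?u S" "?v ?S1 = []" "?v ?S2 = ?v S" "?u ?S2 = [int n]" using n by auto
  have uv: "?u S = (if a then [int n] else [])" "?v S = (if d then [- int n] else [])" by (auto simp: a_def d_def)
  have r: "replicate (Suc m) (0::int) = replicate m 0 @ [0]" by (simp add: replicate_append_same)
  have ex: "en n n (colw n S m) = map_option (\<lambda>w. ?A S @ w @ ?C S) (en n n (?u S @ replicate m 0 @ ?v S))"
    unfolding s action_middle(3)[OF n0 t] ..
  show ?G
    unfolding ex s[of ?S1] s[of ?S2] 1 2 r
    by (simp only: en_append[OF n0] eps_append phi_append u replicate_zero_action[OF n0] uv)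
      (insert n0, cases a; cases d; auto simp: e)
qed


section \<open>The counting function under raising, and pairs of columns\<close>

lemma Ncnt_cong: "(\<And>j. 1 \<le> j \<Longrightarrow> j \<le> k \<Longrightarrow> (int j \<in> S \<longleftrightarrow> int j \<in> T) \<and> (- int j \<in> S \<longleftrightarrow> - int j \<in> T)) \<Longrightarrow> Ncnt S k = Ncnt T k"
  by (induction k) (auto simp del: of_nat_Suc)

text \<open>Exchanging \<open>i\<close> and \<open>i + 1\<close>, barred or not, is invisible to
  every count except N(i). Raising the barred letter decreases that count, raising the unbarred one
  increases it.\<close>

lemma Ncnt_lower_bar:
  assumes "1 \<le> i" "- int i \<in> S" "- int i - 1 \<notin> S"
  shows "Ncnt S k = Ncnt (insert (- int i - 1) (S - {- int i})) k + of_bool (k = i)"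
proof (induction k)
  case 0
  then show ?case using assms by simp
next
  case (Suc k)
  have p: "int (Suc k) \<in> insert (- int i - 1) (S - {- int i}) \<longleftrightarrow> int (Suc k) \<in> S" by auto
  consider "Suc k = i" | "k = i" | "Suc k \<noteq> i" "k \<noteq> i" by blast
  then show ?case
  proof cases
    case 1
    then show ?thesis using Suc assms p by auto
  next
    case 2
    have "- int (Suc i) = - int i - 1" by simp
    then have "- int (Suc i) \<notin> S" using assms by metis
    then show ?thesis using Suc assms p 2 by (simp del: of_nat_Suc)
  next
    case 3
    then have "- int (Suc k) \<in> insert (- int i - 1) (S - {- int i}) \<longleftrightarrow> - int (Suc k) \<in> S" by auto
    then show ?thesis using Suc 3 p by (auto simp del: of_nat_Suc)
  qed
qed

lemma Ncnt_lower:
  assumes "1 \<le> i" "int i + 1 \<in> S" "int i \<notin> S"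
  shows "Ncnt (insert (int i) (S - {int i + 1})) k = Ncnt S k + of_bool (k = i)"
proof (induction k)
  case 0
  then show ?case using assms by simp
next
  case (Suc k)
  have p: "- int (Suc k) \<in> insert (int i) (S - {int i + 1}) \<longleftrightarrow> - int (Suc k) \<in> S" by auto
  consider "Suc k = i" | "k = i" | "Suc k \<noteq> i" "k \<noteq> i" by blast
  then show ?case
  proof cases
    case 1
    then show ?thesis using Suc assms p by auto
  next
    case 2
    then show ?thesis using Suc assms p by (auto simp: algebra_simps)
  next
    case 3
    then have "int (Suc k) \<in> insert (int i) (S - {int i + 1}) \<longleftrightarrow> int (Suc k) \<in> S" by auto
    then show ?thesis using Suc 3 p by (auto simp del: of_nat_Suc)
  qed
qed

lemma Ncnt_rec:
  assumes "1 \<le> i"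
  shows "Ncnt S i = Ncnt S (i - 1) + of_bool (int i \<in> S) + of_bool (- int i \<in> S)"
    "Ncnt S (i + 1) = Ncnt S i + of_bool (int i + 1 \<in> S) + of_bool (- int i - 1 \<in> S)"
  using assms by (cases i; simp add: algebra_simps)+

text \<open>The erased pair may move. For \<open>z = i\<close>, raising the bar of \<open>i\<close>
  makes \<open>i + 1\<close> the new least letter, while in the shortened column
  \<open>i + 1\<close> is raised to \<open>i\<close>. For \<open>z = i + 1\<close> the two raisings
  exchange their roles. Otherwise both columns undergo the same raising and \<open>z\<close>
  stays.\<close>

lemma colpair_ecompat_small:
  assumes i: "1 \<le> i" "i < n" and uv: "colpair n u v"
  shows "eps n i u = eps n i v \<and> phi n i u = phi n i v \<and>
     (\<forall>u'. en n i u = Some u' \<longrightarrow> (\<exists>v'. en n i v = Some v' \<and> colpair n u' v'))"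
proof -
  obtain S m where R: "R5c n S m" and u: "u = colw n S m" and
     v: "(\<exists>z\<le>n. lowest S z \<and> v = colw n (S - {int z, - int z}) m) \<or>
      ((\<forall>k\<le>n. Ncnt S k \<le> k) \<and> m > 0 \<and> v = colw n S (m - 1))"
    using uv by (auto simp: colpair_def)
  define a b c d where "a = (int i \<in> S)" and "b = (int i + 1 \<in> S)" and "c = (- int i - 1 \<in> S)" and "d = (- int i \<in> S)"
  note abcd = a_def b_def c_def d_def
  let ?S1 = "insert (- int i - 1) (S - {- int i})" and ?S2 = "insert (int i) (S - {int i + 1})"
  let ?c1 = "d \<and> \<not> c \<and> \<not> (a \<and> \<not> b)" and ?c2 = "b \<and> \<not> a \<and> (d \<longrightarrow> c)"
  note N = Ncnt_rec[OF i(1), of S, folded abcd]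
  have N1: "Ncnt S k = Ncnt ?S1 k + of_bool (k = i)" if ?c1 for k
    using Ncnt_lower_bar[OF i(1)] that abcd by blast
  have N2: "Ncnt ?S2 k = Ncnt S k + of_bool (k = i)" if ?c2 for k
    using Ncnt_lower[OF i(1)] that abcd by blast
  have bd: "Ncnt S k \<le> k + 1" if "k \<le> n" for k using R that by (simp add: R5c_def)
  have tot: "m + Ncnt S n \<le> n + 1" "m + Ncnt S n = n + 1 \<or> (\<exists>k\<le>n. Ncnt S k = k + 1)" using R by (auto simp: R5c_def)
  note cs = colw_small[OF i, of S, folded abcd]
  \<comment> \<open>Raising \<open>i + 1\<close> to \<open>i\<close> adds one to N(i). The bound at
    \<open>i - 1\<close> leaves room for it if the bar of \<open>i\<close> is absent, the bound at
    \<open>i + 1\<close> if it is present.\<close>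
  have step2: "Ncnt S i + 1 \<le> i + 1" if ?c2
    using N that bd[of "i - 1"] bd[of "i + 1"] i by (cases d) auto
  have R1: "\<forall>k\<le>n. Ncnt ?S1 k \<le> k + 1" "m + Ncnt ?S1 n \<le> n + 1" "m + Ncnt ?S1 n = m + Ncnt S n" if ?c1
    using N1[OF that] bd tot i by (auto intro: le_trans[OF le_add1])
  have R2: "\<forall>k\<le>n. Ncnt ?S2 k \<le> k + 1" "m + Ncnt ?S2 n \<le> n + 1" "m + Ncnt ?S2 n = m + Ncnt S n" if ?c2
    using N2[OF that] bd tot i step2[OF that] by auto
  have en: "en n i u = (if ?c1 then Some (colw n ?S1 m) else if ?c2 then Some (colw n ?S2 m) else None)"
    unfolding u cs(3) by auto
  from v show ?thesis
  proof
    assume "\<exists>z\<le>n. lowest S z \<and> v = colw n (S - {int z, - int z}) m"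
    then obtain z where z: "z \<le> n" "lowest S z" and v: "v = colw n (S - {int z, - int z}) m" by blast
    have z1: "1 \<le> z" "Ncnt S z = z + 1" "\<And>k. k < z \<Longrightarrow> Ncnt S k \<le> k" and zS: "int z \<in> S" "- int z \<in> S"
      using z lowest_pair by (auto simp: lowest_def)
    have cp: "colpair n (colw n T m) (colw n (T - {int y, - int y}) m)"
      if "\<forall>k\<le>n. Ncnt T k \<le> k + 1" "m + Ncnt T n \<le> n + 1" "lowest T y" "y \<le> n" for T y
      unfolding colpair_def R5c_def using that lowest_def by blast
    let ?S0 = "S - {int z, - int z}"
    note cs0 = colw_small[OF i, of ?S0 m]
    consider "z = i" | "z = i + 1" | "z \<noteq> i" "z \<noteq> i + 1" by blast
    then show ?thesis
    proof cases
      case 1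
      have ad: "a" "d" using zS 1 abcd by auto
      \<comment> \<open>Since N(i) = i + 1, both letters together would give N(i + 1) = i + 3, above
        its bound.\<close>
      have bc: "\<not> (b \<and> c)" using N(2) bd[of "i + 1"] z1(2) 1 i by auto
      have m0: "int i \<in> ?S0 \<longleftrightarrow> False" "- int i \<in> ?S0 \<longleftrightarrow> False" "int i + 1 \<in> ?S0 \<longleftrightarrow> b" "- int i - 1 \<in> ?S0 \<longleftrightarrow> c"
        using 1 abcd by auto
      have "eps n i u = eps n i v" "phi n i u = phi n i v"
        unfolding u v cs cs0 m0 using ad bc by auto
      moreover have "\<exists>v'. en n i v = Some v' \<and> colpair n u' v'" if "en n i u = Some u'" for u'
      proof -
        have c1: ?c1 and u': "u' = colw n ?S1 m" using that ad unfolding en by (auto split: if_splits)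
        have b: "b" "\<not> c" using c1 ad by auto
        have "Ncnt ?S1 k \<le> k" if "k < i + 1" for k
          using N1[OF c1, of k] z1(2) z1(3)[of k] 1 that by (cases "k = i") auto
        moreover have "Ncnt ?S1 (i + 1) = i + 2" using N1[OF c1, of "i + 1"] N(2) b z1(2) 1 by simp
        ultimately have low: "lowest ?S1 (i + 1)" by (auto simp: lowest_def)
        have "en n i v = Some (colw n (insert (int i) (?S0 - {int i + 1})) m)"
          unfolding v cs0 m0 using b by auto
        moreover have e: "int (i + 1) = int i + 1" "- int (i + 1) = - int i - 1" by simp_all
        have "insert (int i) (?S0 - {int i + 1}) = ?S1 - {int (i + 1), - int (i + 1)}"
          unfolding e using 1 ad b i abcd by auto
        ultimately show ?thesis using cp[OF R1(1,2)[OF c1] low] i u' by auto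
      qed
      ultimately show ?thesis by blast
    next
      case 2
      have e: "int z = int i + 1" "- (int i + 1) = - int i - 1" using 2 by simp_all
      have bc: "b" "c" using zS unfolding e abcd by blast+
      have "Ncnt S (i + 1) = i + 2" using z1(2) unfolding 2 by (simp del: Ncnt.simps)
      then have Ni: "Ncnt S i = i" using N(2) bc by (simp del: Ncnt.simps)
      have "Ncnt S (i - 1) \<le> i - 1" using z1(3)[of "i - 1"] 2 by simp
      then have ad: "a \<or> d" using N(1) Ni i by (cases a; cases d) auto
      have m0: "int i \<in> ?S0 \<longleftrightarrow> a" "- int i \<in> ?S0 \<longleftrightarrow> d" "int i + 1 \<in> ?S0 \<longleftrightarrow> False" "- int i - 1 \<in> ?S0 \<longleftrightarrow> False"
        unfolding e using abcd by auto
      have "eps n i u = eps n i v" "phi n i u = phi n i v"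
        unfolding u v cs cs0 m0 using ad bc by auto
      moreover have "\<exists>v'. en n i v = Some v' \<and> colpair n u' v'" if "en n i u = Some u'" for u'
      proof -
        have c2: ?c2 and u': "u' = colw n ?S2 m" using that bc unfolding en by (auto split: if_splits)
        have a: "\<not> a" "d" using c2 ad by auto
        have "Ncnt ?S2 k \<le> k" if "k < i" for k
          using N2[OF c2, of k] z1(3) 2 that by auto
        moreover have "Ncnt ?S2 i = i + 1" using N2[OF c2, of i] Ni by simp
        ultimately have low: "lowest ?S2 i" using i by (auto simp: lowest_def)
        have "en n i v = Some (colw n (insert (- int i - 1) (?S0 - {- int i})) m)"
          unfolding v cs0 m0 using a by auto
        moreover have "insert (- int i - 1) (?S0 - {- int i}) = ?S2 - {int i, - int i}"
          unfolding e using a bc i abcd by auto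
        ultimately show ?thesis using cp[OF R2(1,2)[OF c2] low] i u' by auto
      qed
      ultimately show ?thesis by blast
    next
      case 3
      have m0: "int i \<in> ?S0 \<longleftrightarrow> a" "- int i \<in> ?S0 \<longleftrightarrow> d" "int i + 1 \<in> ?S0 \<longleftrightarrow> b" "- int i - 1 \<in> ?S0 \<longleftrightarrow> c"
        using 3 z1(1) abcd by auto
      have "eps n i u = eps n i v" "phi n i u = phi n i v"
        unfolding u v cs cs0 m0 by auto
      moreover have "\<exists>v'. en n i v = Some v' \<and> colpair n u' v'" if "en n i u = Some u'" for u'
      proof (cases ?c1)
        case True
        have "lowest ?S1 z" using N1[OF True] z1 3 by (fastforce simp: lowest_def)
        moreover have "u' = colw n ?S1 m" using that True unfolding en by auto
        moreover have "en n i v = Some (colw n (insert (- int i - 1) (?S0 - {- int i})) m)"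
          unfolding v cs0 m0 using True by auto
        moreover have "insert (- int i - 1) (?S0 - {- int i}) = ?S1 - {int z, - int z}"
          using 3 i z1(1) by auto
        ultimately show ?thesis using cp[OF R1(1,2)[OF True] _ z(1)] by auto
      next
        case False
        then have c2: ?c2 and u': "u' = colw n ?S2 m" using that unfolding en by (auto split: if_splits)
        \<comment> \<open>The increased N(i) must stay at most \<open>i\<close>; otherwise a letter
          smaller than \<open>z\<close> would have to be erased.\<close>
        have "Ncnt S i + 1 \<le> i" if "i < z"
        proof -
          have "Ncnt S (i - 1) \<le> i - 1" by (rule z1(3)) (use that in simp)
          moreover have "Ncnt S (i + 1) \<le> i + 1" by (rule z1(3)) (use that 3 in simp)
          ultimately show ?thesis using N i c2 by (cases d) (auto simp del: Ncnt.simps)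
        qed
        then have "lowest ?S2 z" using N2[OF c2] z1 3 by (auto simp: lowest_def)
        moreover have "en n i v = Some (colw n (insert (int i) (?S0 - {int i + 1})) m)"
          unfolding v cs0 m0 using c2 False by auto
        moreover have "insert (int i) (?S0 - {int i + 1}) = ?S2 - {int z, - int z}"
          using 3 i z1(1) by auto
        ultimately show ?thesis using cp[OF R2(1,2)[OF c2] _ z(1)] u' by auto
      qed
      ultimately show ?thesis by blast
    qed
  next
    assume B: "(\<forall>k\<le>n. Ncnt S k \<le> k) \<and> m > 0 \<and> v = colw n S (m - 1)"
    have t: "m + Ncnt S n = n + 1" using tot B by fastforce
    have cp: "colpair n (colw n T m) (colw n T (m - 1))" if "\<forall>k\<le>n. Ncnt T k \<le> k" "m + Ncnt T n = m + Ncnt S n" for T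
    proof -
      have "R5c n T m" using that t by (fastforce simp: R5c_def)
      then show ?thesis unfolding colpair_def using that B by blast
    qed
    have v: "v = colw n S (m - 1)" using B by blast
    have "eps n i u = eps n i v" "phi n i u = phi n i v"
      unfolding u v cs by auto
    moreover have "\<exists>v'. en n i v = Some v' \<and> colpair n u' v'" if "en n i u = Some u'" for u'
    proof (cases ?c1)
      case True
      have "\<forall>k\<le>n. Ncnt ?S1 k \<le> k" using N1[OF True] B by (metis le_add1 le_trans)
      moreover have "u' = colw n ?S1 m" using that True unfolding en by auto
      moreover have "en n i v = Some (colw n ?S1 (m - 1))" unfolding v cs using True by auto
      ultimately show ?thesis using cp R1(3)[OF True] by blast
    next
      case False
      then have c2: ?c2 and u': "u' = colw n ?S2 m" using that unfolding en by (auto split: if_splits)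
      have "Ncnt S (i - 1) \<le> i - 1" "Ncnt S (i + 1) \<le> i + 1"
        using B i by (auto simp del: Ncnt.simps)
      then have "Ncnt S i + 1 \<le> i" using N i c2 by (cases d) (auto simp del: Ncnt.simps)
      then have "\<forall>k\<le>n. Ncnt ?S2 k \<le> k" using N2[OF c2] B by auto
      moreover have "en n i v = Some (colw n ?S2 (m - 1))" unfolding v cs using c2 False by auto
      ultimately show ?thesis using cp R2(3)[OF c2] u' by blast
    qed
    ultimately show ?thesis by blast
  qed
qed

lemma colpair_ecompat_n:
  assumes n: "1 \<le> n" and uv: "colpair n u v"
  shows "eps n n u = eps n n v \<and> phi n n u = phi n n v \<and>
     (\<forall>u'. en n n u = Some u' \<longrightarrow> (\<exists>v'. en n n v = Some v' \<and> colpair n u' v'))"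
proof -
  obtain S m where R: "R5c n S m" and u: "u = colw n S m" and
     v: "(\<exists>z\<le>n. lowest S z \<and> v = colw n (S - {int z, - int z}) m) \<or>
      ((\<forall>k\<le>n. Ncnt S k \<le> k) \<and> m > 0 \<and> v = colw n S (m - 1))"
    using uv by (auto simp: colpair_def)
  define a d where "a = (int n \<in> S)" and "d = (- int n \<in> S)"
  note ad = a_def d_def
  let ?S1 = "S - {- int n}" and ?S2 = "insert (int n) S"
  have N: "Ncnt S n = Ncnt S (n - 1) + of_bool a + of_bool d" using Ncnt_rec(1)[OF n, of S] ad by simp
  have lt: "Ncnt ?S1 k = Ncnt S k" "Ncnt ?S2 k = Ncnt S k" if "k < n" for k
    using that by (auto intro!: Ncnt_cong)
  have N1: "Ncnt ?S1 n + 1 = Ncnt S n" if d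
    using Ncnt_rec(1)[OF n, of ?S1] lt(1)[of "n - 1"] N n that ad by auto
  have N2: "Ncnt ?S2 n = Ncnt S n + 1" if "\<not> a"
    using Ncnt_rec(1)[OF n, of ?S2] lt(2)[of "n - 1"] N n that ad by auto
  have bd: "Ncnt S k \<le> k + 1" if "k \<le> n" for k using R that by (simp add: R5c_def)
  have tot: "m + Ncnt S n \<le> n + 1" "m + Ncnt S n = n + 1 \<or> (\<exists>k\<le>n. Ncnt S k = k + 1)" using R by (auto simp: R5c_def)
  note cs = colw_n[OF n, of S, folded ad]
  from v show ?thesis
  proof
    assume "\<exists>z\<le>n. lowest S z \<and> v = colw n (S - {int z, - int z}) m"
    then obtain z where z: "z \<le> n" "lowest S z" and v: "v = colw n (S - {int z, - int z}) m" by blast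
    have z1: "1 \<le> z" "Ncnt S z = z + 1" "\<And>k. k < z \<Longrightarrow> Ncnt S k \<le> k" and zS: "int z \<in> S" "- int z \<in> S"
      using z lowest_pair by (auto simp: lowest_def)
    have cp: "colpair n (colw n T k) (colw n (T - {int z, - int z}) k)"
      if "\<forall>k\<le>n. Ncnt T k \<le> k + 1" "k + Ncnt T n \<le> n + 1" "lowest T z" for T k
      unfolding colpair_def R5c_def using that z(1) lowest_def by blast
    let ?S0 = "S - {int z, - int z}"
    note cs0 = colw_n[OF n, of ?S0 m]
    show ?thesis
    proof (cases "z = n")
      case True
      have "a" "d" using zS True ad by auto
      \<comment> \<open>The nonzero letters already make up the length \<open>n + 1\<close>, so no
        zero is left to act once the pair is erased.\<close>
      moreover have "m = 0" using z1(2) True tot(1) by simp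
      moreover have m0: "int n \<in> ?S0 \<longleftrightarrow> False" "- int n \<in> ?S0 \<longleftrightarrow> False" using True by auto
      ultimately show ?thesis unfolding u v cs cs0 m0 by auto
    next
      case False
      then have zn: "z < n" using z by simp
      have m0: "int n \<in> ?S0 \<longleftrightarrow> a" "- int n \<in> ?S0 \<longleftrightarrow> d" using zn ad z1(1) by auto
      have "eps n n u = eps n n v" "phi n n u = phi n n v"
        unfolding u v cs cs0 m0 by auto
      moreover have "\<exists>v'. en n n v = Some v' \<and> colpair n u' v'" if u': "en n n u = Some u'" for u'
      proof (cases d)
        case True
        have a: "\<not> a" and u'': "u' = colw n ?S1 (Suc m)" using u' True unfolding u cs by (auto split: if_splits)
        have "\<forall>k\<le>n. Ncnt ?S1 k \<le> k + 1"
        proof (intro allI impI)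
          fix k assume "k \<le> n"
          then show "Ncnt ?S1 k \<le> k + 1" using lt(1)[of k] bd[of k] N1[OF True] by (cases "k = n") auto
        qed
        moreover have "Suc m + Ncnt ?S1 n \<le> n + 1" using N1[OF True] tot(1) by simp
        moreover have "lowest ?S1 z" using z(2) zn lt(1) by (simp add: lowest_def)
        moreover have "?S1 - {int z, - int z} = ?S0 - {- int n}" by auto
        moreover have "en n n v = Some (colw n (?S0 - {- int n}) (Suc m))" unfolding v cs0 m0 using a True by simp
        ultimately show ?thesis using cp[of ?S1 "Suc m"] u'' by metis
      next
        case False
        have a: "\<not> a" "m > 0" and u'': "u' = colw n ?S2 (m - 1)" using u' False unfolding u cs by (auto split: if_splits)
        have t: "m - 1 + Ncnt ?S2 n \<le> n + 1" using N2[OF a(1)] tot(1) a(2) by simp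
        moreover have "\<forall>k\<le>n. Ncnt ?S2 k \<le> k + 1"
        proof (intro allI impI)
          fix k assume "k \<le> n"
          then show "Ncnt ?S2 k \<le> k + 1" using lt(2)[of k] bd[of k] t by (cases "k = n") auto
        qed
        moreover have "lowest ?S2 z" using z(2) zn lt(2) by (simp add: lowest_def)
        moreover have "?S2 - {int z, - int z} = insert (int n) ?S0" using zn by auto
        moreover have "en n n v = Some (colw n (insert (int n) ?S0) (m - 1))" unfolding v cs0 m0 using a False by simp
        ultimately show ?thesis using cp[of ?S2 "m - 1"] u'' by metis
      qed
      ultimately show ?thesis by blast
    qed
  next
    assume B: "(\<forall>k\<le>n. Ncnt S k \<le> k) \<and> m > 0 \<and> v = colw n S (m - 1)"
    have t: "m + Ncnt S n = n + 1" using tot B by fastforce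
    have cp: "colpair n (colw n T k) (colw n T (k - 1))" if "\<forall>k\<le>n. Ncnt T k \<le> k" "k + Ncnt T n = n + 1" "k > 0" for T k
    proof -
      have "R5c n T k" using that by (fastforce simp: R5c_def)
      then show ?thesis unfolding colpair_def using that by blast
    qed
    have v: "v = colw n S (m - 1)" using B by blast
    \<comment> \<open>Without \<open>n\<close> and its bar at most \<open>n - 1\<close> letters are
      nonzero. Hence at least two zeros occur, and erasing one of them does not change the
      signature.\<close>
    have m2: "m \<ge> 2" if "\<not> a" "\<not> d"
    proof -
      have "Ncnt S (n - 1) \<le> n - 1" using B by simp
      then show ?thesis using N t that n by simp
    qed
    have "eps n n u = eps n n v" "phi n n u = phi n n v"
      unfolding u v cs using m2 by auto
    moreover have "\<exists>v'. en n n v = Some v' \<and> colpair n u' v'" if u': "en n n u = Some u'" for u'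
    proof (cases d)
      case True
      have a: "\<not> a" and u'': "u' = colw n ?S1 (Suc m)" using u' True unfolding u cs by (auto split: if_splits)
      have "\<forall>k\<le>n. Ncnt ?S1 k \<le> k"
      proof (intro allI impI)
        fix k assume "k \<le> n"
        moreover have "Ncnt S k \<le> k" using B \<open>k \<le> n\<close> by blast
        ultimately show "Ncnt ?S1 k \<le> k" using lt(1)[of k] N1[OF True] by (cases "k = n") auto
      qed
      moreover have "Suc m + Ncnt ?S1 n = n + 1" using N1[OF True] t by simp
      moreover have "en n n v = Some (colw n ?S1 m)" unfolding v cs using a True B by simp
      ultimately show ?thesis using cp[of ?S1 "Suc m"] u'' by auto
    next
      case False
      have a: "\<not> a" "m > 0" and u'': "u' = colw n ?S2 (m - 1)" using u' False unfolding u cs by (auto split: if_splits)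
      have "\<forall>k\<le>n. Ncnt ?S2 k \<le> k"
      proof (intro allI impI)
        fix k assume "k \<le> n"
        moreover have "Ncnt S k \<le> k" using B \<open>k \<le> n\<close> by blast
        ultimately show "Ncnt ?S2 k \<le> k" using lt(2)[of k] N2[OF a(1)] t m2[OF a(1) False] by (cases "k = n") auto
      qed
      moreover have "m - 1 + Ncnt ?S2 n = n + 1" using N2[OF a(1)] t a(2) by simp
      moreover have "en n n v = Some (colw n ?S2 (m - 1 - 1))" unfolding v cs using a False m2[OF a(1) False] by simp
      ultimately show ?thesis using cp[of ?S2 "m - 1"] u'' m2[OF a(1) False] by auto
    qed
    ultimately show ?thesis by blast
  qed
qed

subsection \<open>The plactic congruence, highest weight words and tableaux\<close>

lemma rel_ecompat:
  assumes n: "0 < n" and i: "i \<in> {1..n}" and r: "rel n u v"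
  shows "ecompat n i u v"
proof (cases "R5_word n u \<and> v = R5_tilde n u")
  case False
  then show ?thesis using rel3_ecompat[OF n i r] by blast
next
  case True
  then have "colpair n u v" using R5_word_colpair by blast
  then have "eps n i u = eps n i v \<and> phi n i u = phi n i v \<and>
     (\<forall>u'. en n i u = Some u' \<longrightarrow> (\<exists>v'. en n i v = Some v' \<and> colpair n u' v'))"
    using colpair_ecompat_small[of i n u v] colpair_ecompat_n[of n u v] i by (cases "i = n") auto
  moreover have "colpair n u' v' \<Longrightarrow> rel n u' v'" for u' v' using R5_tilde_colw rel.R5 by metis
  ultimately show ?thesis unfolding ecompat_def by blast
qed

lemma congB_word:
  assumes n: "0 < n"
  shows "congB n u v \<Longrightarrow> is_word n u \<and> is_word n v"
proof (induction rule: congB.induct)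
  case (base u v)
  then show ?case using rel_word[OF n] by blast
qed auto

text \<open>In a context, the factor on which a raising acts depends only on the string lengths of
  the factors, and these agree for congruent ones.\<close>

lemma congB_ecompat:
  assumes n: "0 < n" and i: "i \<in> {1..n}"
  shows "congB n u v \<Longrightarrow> eps n i u = eps n i v \<and> phi n i u = phi n i v \<and> rel_option (congB n) (en n i u) (en n i v)"
proof (induction rule: congB.induct)
  case (base u v)
  then have e: "ecompat n i u v" using rel_ecompat[OF n i] by blast
  show ?case
  proof (cases "en n i u")
    case None
    then have "en n i v = None" using e en_None[OF n, of i u] en_None[OF n, of i v] by (auto simp: ecompat_def)
    then show ?thesis using e None by (auto simp: ecompat_def)
  next
    case (Some u')
    then show ?thesis using e by (auto simp: ecompat_def intro: congB.base)
  qed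
next
  case (refl w)
  then show ?case by (auto intro!: option.rel_refl_strong congB.refl dest: en_word[OF n])
next
  case (sym u v)
  then show ?case by (metis (mono_tags, lifting) congB.sym option.rel_cases option.rel_intros)
next
  case (trans u v w)
  have "rel_option (congB n OO congB n) (en n i u) (en n i w)" using trans.IH by (auto simp: option.rel_compp)
  then have "rel_option (congB n) (en n i u) (en n i w)"
    by (rule option.rel_mono_strong) (auto intro: congB.trans)
  then show ?case using trans.IH by auto
next
  case (ctxt u v x y)
  have w: "is_word n u" "is_word n v" using congB_word[OF n ctxt.hyps(1)] by auto
  note uv = ctxt.hyps(1) and xy = ctxt.hyps(2,3)
  have l: "rel_option (congB n) (map_option (\<lambda>x'. x' @ u @ y) (en n i x)) (map_option (\<lambda>x'. x' @ v @ y) (en n i x))"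
    unfolding option.rel_map
    by (rule option.rel_refl_strong) (auto intro!: congB.ctxt uv xy dest: en_word[OF n _ xy(1)])
  have m: "rel_option (congB n) (map_option (\<lambda>u'. x @ u' @ y) (en n i u)) (map_option (\<lambda>v'. x @ v' @ y) (en n i v))"
    unfolding option.rel_map
    by (rule option.rel_mono_strong[of "congB n"]) (use ctxt.IH in \<open>auto intro!: congB.ctxt xy\<close>)
  have r: "rel_option (congB n) (map_option (\<lambda>y'. x @ u @ y') (en n i y)) (map_option (\<lambda>y'. x @ v @ y') (en n i y))"
    unfolding option.rel_map
    by (rule option.rel_refl_strong) (auto intro!: congB.ctxt uv xy dest: en_word[OF n _ xy(2)])
  show ?case using l m r ctxt.IH
    by (auto simp: eps_append phi_append en_append[OF n] option.map_comp o_def)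
qed

section \<open>Duality for the congruence\<close>

lemma Ncnt_uminus: "Ncnt (uminus ` S) k = Ncnt S k"
proof (induction k)
  case (Suc k)
  have "int (Suc k) \<in> uminus ` S \<longleftrightarrow> - int (Suc k) \<in> S" "- int (Suc k) \<in> uminus ` S \<longleftrightarrow> int (Suc k) \<in> S"
    by (metis add.inverse_inverse image_eqI image_iff)+
  then show ?case using Suc by (simp del: of_nat_Suc)
qed simp

lemma rev_uminus_upto: "rev (map uminus [1..int n]) = [- int n..-1]" "rev (map uminus [- int n..-1]) = [1..int n]"
proof -
  show *: "rev (map uminus [1..int n]) = [- int n..-1]"
  proof (induction n)
    case (Suc n)
    have "[1..int (Suc n)] = [1..int n] @ [int (Suc n)]" using upto_rec2[of 1 "int (Suc n)"] by simp
    moreover have "[- int (Suc n)..-1] = (- int (Suc n)) # [- int n..-1]"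
      using upto_rec1[of "- int (Suc n)" "-1"] by simp
    ultimately show ?case using Suc by (simp del: of_nat_Suc)
  qed simp
  show "rev (map uminus [- int n..-1]) = [1..int n]" unfolding *[symmetric] by (simp add: rev_map o_def)
qed

lemma winv_colw: "winv (colw n S m) = colw n (uminus ` S) m"
proof -
  have f: "rev (map uminus (filter (\<lambda>x. x \<in> S) xs)) = filter (\<lambda>x. x \<in> uminus ` S) (rev (map uminus xs))" for xs :: "int list"
    by (induction xs) (auto simp: image_iff)
  show ?thesis
    unfolding colw_def winv_def rev_append map_append f rev_uminus_upto by simp
qed

lemma is_col_winv: "is_col n w \<Longrightarrow> is_col n (winv w)"
  using is_col_eq_colw[of n w] winv_colw is_col_colw by metis

text \<open>N counts a letter and its bar alike, so barring changes neither the minimality condition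
  nor the letter to be erased.\<close>

lemma colpair_winv:
  assumes "colpair n u v" shows "colpair n (winv u) (winv v)"
proof -
  have d: "uminus ` (S - {z, - z}) = uminus ` S - {z, - z}" for S and z :: int by force
  have R: "R5c n (uminus ` S) m = R5c n S m" "lowest (uminus ` S) z = lowest S z" for S m z
    by (auto simp: R5c_def lowest_def Ncnt_uminus)
  obtain S m where S: "R5c n S m" "u = colw n S m" and
     v: "(\<exists>z\<le>n. lowest S z \<and> v = colw n (S - {int z, - int z}) m) \<or>
      ((\<forall>k\<le>n. Ncnt S k \<le> k) \<and> m > 0 \<and> v = colw n S (m - 1))"
    using assms by (auto simp: colpair_def)
  have "(\<exists>z\<le>n. lowest (uminus ` S) z \<and> winv v = colw n (uminus ` S - {int z, - int z}) m) \<or>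
      ((\<forall>k\<le>n. Ncnt (uminus ` S) k \<le> k) \<and> m > 0 \<and> winv v = colw n (uminus ` S) (m - 1))"
    using v by (auto simp: R Ncnt_uminus winv_colw d)
  then show ?thesis unfolding colpair_def
    by (intro exI[of _ "uminus ` S"] exI[of _ m]) (use S in \<open>simp add: R winv_colw\<close>)
qed

lemma lt_uminus: "is_letter n x \<Longrightarrow> is_letter n y \<Longrightarrow> lt n (- x) (- y) = lt n y x"
  by (auto simp: lt_ltl ltl_def)

lemma le_uminus: "is_letter n x \<Longrightarrow> is_letter n y \<Longrightarrow> le n (- x) (- y) = le n y x"
  by (auto simp: le_ltl ltl_def)

text \<open>Duality exchanges the two halves of R1, R2, R3 and R4 and reverses the direction of the
  generators of length three; hence the conclusion is a congruence and not a generator.\<close>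

lemma rel_winv:
  assumes n: "0 < n" and r: "rel n u v" shows "congB n (winv u) (winv v)"
  using r
proof cases
  case (R1a x y z)
  then have "rel n [- z, - x, - y] [- x, - z, - y]"
    by (intro rel.R1b) (auto simp: lt_uminus)
  then show ?thesis using R1a congB.sym congB.base by simp
next
  case (R1b x y z)
  then have "rel n [- y, - x, - z] [- y, - z, - x]"
    by (intro rel.R1a) (auto simp: lt_uminus)
  then show ?thesis using R1b congB.sym congB.base by simp
next
  case (R2a x y)
  then have "rel n [- y, - x, - x] [- x, - y, - x]"
    by (intro rel.R2b) (auto simp: lt_uminus)
  then show ?thesis using R2a congB.sym congB.base by simp
next
  case (R2b x y)
  then have "rel n [- y, - x, - y] [- y, - y, - x]"
    by (intro rel.R2a) (auto simp: lt_uminus)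
  then show ?thesis using R2b congB.sym congB.base by simp
next
  case (R3a y x)
  have "is_letter n x" using R3a by (simp add: is_letter_def)
  then have "le n x (- y)" "le n (- y) (- x)"
    using R3a le_uminus[of n y x] le_uminus[of n "- x" y] by auto
  then have "rel n [x, - x, - y] [- (x - 1), x - 1, - y]"
    using R3a by (intro rel.R3b) auto
  then show ?thesis using R3a congB.sym congB.base by simp
next
  case (R3b y x)
  have "is_letter n x" using R3b by (simp add: is_letter_def)
  then have "le n x (- y)" "le n (- y) (- x)"
    using R3b le_uminus[of n y x] le_uminus[of n "- x" y] by auto
  then have "rel n [- y, - (x - 1), x - 1] [- y, x, - x]"
    using R3b by (intro rel.R3a) auto
  then show ?thesis using R3b congB.sym congB.base by simp
next
  case R3c
  then show ?thesis using rel.R3c[of n] congB.sym congB.base by simp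
next
  case (R4a x)
  then show ?thesis using rel.R4b[of x n] congB.sym congB.base by simp
next
  case (R4b x)
  then show ?thesis using rel.R4a[of x n] congB.sym congB.base by simp
next
  case R5
  then have "colpair n (winv u) (winv v)" using R5_word_colpair colpair_winv by blast
  then show ?thesis using R5_tilde_colw rel.R5 congB.base by metis
qed

lemma congB_winv:
  assumes n: "0 < n"
  shows "congB n u v \<Longrightarrow> congB n (winv u) (winv v)"
proof (induction rule: congB.induct)
  case (base u v)
  then show ?case using rel_winv[OF n] by blast
next
  case (ctxt u v x y)
  then show ?case using congB.ctxt[of n "winv u" "winv v" "winv y" "winv x"] by simp
qed (auto intro: congB.intros)

lemma congB_fcompat:
  assumes n: "0 < n" and i: "i \<in> {1..n}" and c: "congB n u v"
  shows "rel_option (congB n) (fn n i u) (fn n i v)"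
proof -
  have "rel_option (congB n) (en n i (winv u)) (en n i (winv v))"
    using congB_ecompat[OF n i congB_winv[OF n c]] by blast
  then show ?thesis unfolding fn_winv[OF n] option.rel_map
    by (rule option.rel_mono_strong) (auto intro: congB_winv[OF n])
qed

lemma fn_append: assumes "0 < n" shows "fn n i (u @ v) =
    (if eps n i v < phi n i u then map_option (\<lambda>u'. u' @ v) (fn n i u) else map_option ((@) u) (fn n i v))"
  by (auto simp: fn_winv[OF assms] en_append[OF assms] option.map_comp o_def)

section \<open>Columns and products of columns under the operators\<close>

lemma en_col:
  assumes "0 < n" "i \<in> {1..n}" "is_col n w" "en n i w = Some w'"
  shows "is_col n w'"
proof -
  obtain S m where w: "w = colw n S m" using is_col_eq_colw[OF assms(3)] by blast
  have "\<exists>S' m'. w' = colw n S' m'"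
  proof (cases "i = n")
    case True
    then show ?thesis using colw_n(3)[of n S m] assms w by (auto split: if_splits)
  next
    case False
    then have "1 \<le> i" "i < n" using assms(2) by auto
    from colw_small(3)[OF this, of S m] show ?thesis using assms(4) w by (auto split: if_splits)
  qed
  then show ?thesis using is_col_colw by blast
qed

lemma fn_col:
  assumes "0 < n" "i \<in> {1..n}" "is_col n w" "fn n i w = Some w'"
  shows "is_col n w'"
proof -
  obtain z where z: "en n i (winv w) = Some z" "w' = winv z" using assms by (auto simp: fn_winv)
  then show ?thesis using en_col[OF assms(1,2) is_col_winv[OF assms(3)] z(1)] is_col_winv by blast
qed

lemma fn_length: "0 < n \<Longrightarrow> fn n i w = Some w' \<Longrightarrow> length w' = length w"
  by (auto simp: fn_winv dest: en_length)

text \<open>A lowering operator acts inside a single factor of the product, where it keeps a column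
  a column of the same height.\<close>

lemma fn_concat_cols:
  assumes n: "0 < n" and i: "i \<in> {1..n}"
  shows "\<forall>C\<in>set Cs. is_col n C \<Longrightarrow> fn n i (concat Cs) = Some v \<Longrightarrow>
    \<exists>Ds. v = concat Ds \<and> map length Ds = map length Cs \<and> (\<forall>D\<in>set Ds. is_col n D)"
proof (induction Cs arbitrary: v)
  case (Cons C Cs)
  show ?case
  proof (cases "eps n i (concat Cs) < phi n i C")
    case True
    then obtain D where D: "fn n i C = Some D" "v = D @ concat Cs" using Cons.prems by (auto simp: fn_append[OF n])
    then show ?thesis using Cons.prems fn_col[OF n i _ D(1)] fn_length[OF n D(1)]
      by (intro exI[of _ "D # Cs"]) auto
  next
    case False
    then obtain v' where v': "fn n i (concat Cs) = Some v'" "v = C @ v'" using Cons.prems by (auto simp: fn_append[OF n])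
    then obtain Ds where "v' = concat Ds" "map length Ds = map length Cs" "\<forall>D\<in>set Ds. is_col n D"
      using Cons by auto
    then show ?thesis using Cons.prems v' by (intro exI[of _ "C # Ds"]) auto
  qed
qed simp


section \<open>Paths, components and congruence\<close>

lemma fs_congB:
  assumes n: "0 < n"
  shows "set is \<subseteq> {1..n} \<Longrightarrow> congB n h h' \<Longrightarrow> fs n is h = Some w \<Longrightarrow> \<exists>w'. fs n is h' = Some w' \<and> congB n w w'"
proof (induction "is" arbitrary: w)
  case (Cons i "is")
  then obtain u where u: "fs n is h = Some u" "fn n i u = Some w"
    by (auto simp: bind_eq_Some_conv fw_eq[OF n])
  then obtain u' where u': "fs n is h' = Some u'" "congB n u u'" using Cons by auto
  then have "rel_option (congB n) (fn n i u) (fn n i u')" using congB_fcompat[OF n] Cons.prems by simp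
  then show ?case using u u' by (auto simp: fw_eq[OF n] option_rel_Some1)
qed auto

lemma edge_fn: "0 < n \<Longrightarrow> i \<in> {1..n} \<Longrightarrow> is_word n u \<Longrightarrow> fn n i u = Some v \<Longrightarrow> edge n u v"
  by (auto simp: edge_def fw_eq intro: fn_word)

lemma comp_self: "w \<in> comp n w" by (simp add: comp_def)

lemma comp_step:
  assumes "v \<in> comp n w" "edge n v u \<or> edge n u v" shows "u \<in> comp n w"
  using assms unfolding comp_def by (auto intro: rtranclp.rtrancl_into_rtrancl)

lemma comp_trans: "v \<in> comp n w \<Longrightarrow> u \<in> comp n v \<Longrightarrow> u \<in> comp n w"
  unfolding comp_def by auto

lemma comp_sym: "v \<in> comp n w \<Longrightarrow> w \<in> comp n v"
  unfolding comp_def mem_Collect_eq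
proof (induction rule: rtranclp_induct)
  case (step u v)
  then show ?case by (auto intro: converse_rtranclp_into_rtranclp)
qed simp

lemma comp_word: "v \<in> comp n w \<Longrightarrow> is_word n w \<Longrightarrow> is_word n v"
  unfolding comp_def mem_Collect_eq by (induction rule: rtranclp_induct) (auto simp: edge_def)

lemma fs_comp:
  assumes n: "0 < n"
  shows "set is \<subseteq> {1..n} \<Longrightarrow> is_word n h \<Longrightarrow> fs n is h = Some w \<Longrightarrow> w \<in> comp n h \<and> is_word n w"
proof (induction "is" arbitrary: w)
  case Nil
  then show ?case by (simp add: comp_self)
next
  case (Cons i "is")
  then obtain u where u: "fs n is h = Some u" "fn n i u = Some w"
    by (auto simp: bind_eq_Some_conv fw_eq[OF n])
  then have "u \<in> comp n h" "is_word n u" using Cons by auto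
  then show ?case using comp_step edge_fn[OF n _ _ u(2)] fn_word[OF n u(2)] Cons.prems by auto
qed

lemma up_fs:
  assumes n: "0 < n"
  shows "(up n)\<^sup>*\<^sup>* w h \<Longrightarrow> \<exists>is. set is \<subseteq> {1..n} \<and> fs n is h = Some w"
proof (induction rule: converse_rtranclp_induct)
  case base
  show ?case by (intro exI[of _ "[]"]) simp
next
  case (step w v)
  then obtain "is" i where "set is \<subseteq> {1..n}" "fs n is h = Some v" "i \<in> {1..n}" "fn n i v = Some w"
    by (auto simp: up_def en_fn[OF n])
  then show ?case by (intro exI[of _ "i # is"]) (auto simp: fw_eq[OF n])
qed

lemma up_comp:
  assumes n: "0 < n" and w: "is_word n w"
  shows "(up n)\<^sup>*\<^sup>* w h \<Longrightarrow> h \<in> comp n w"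
proof (induction rule: rtranclp_induct)
  case base
  show ?case by (rule comp_self)
next
  case (step u v)
  then obtain i where i: "i \<in> {1..n}" "en n i u = Some v" by (auto simp: up_def)
  have "is_word n v" using comp_word[OF step.IH w] en_word[OF n i(2)] by blast
  then have "edge n v u" using edge_fn[OF n i(1)] i(2) en_fn[OF n] by blast
  then show ?case using comp_step[OF step.IH] by blast
qed

lemma highest_path:
  assumes n: "0 < n" and w: "is_word n w"
  obtains h "is" where "highest n h" "h \<in> comp n w" "set is \<subseteq> {1..n}" "fs n is h = Some w"
  using highest_exists[OF n, of w] up_fs[OF n] up_comp[OF n w] by metis

lemma highest_eps: "0 < n \<Longrightarrow> highest n w \<longleftrightarrow> (\<forall>i\<in>{1..n}. eps n i w = 0)"
  by (simp add: highest_def ew_eq en_None)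

lemma congB_highest: "0 < n \<Longrightarrow> congB n u v \<Longrightarrow> highest n u \<longleftrightarrow> highest n v"
  using congB_ecompat by (auto simp: highest_eps)

text \<open>A lowering path from the unique highest weight word leads to both words.\<close>

lemma congB_comp_eq:
  assumes n: "0 < n" and w: "is_word n w" and u: "u \<in> comp n w" and v: "v \<in> comp n w" and c: "congB n u v"
  shows "u = v"
proof -
  obtain h "is" where h: "highest n h" "h \<in> comp n u" "set is \<subseteq> {1..n}" "fs n is h = Some u"
    using highest_path[OF n comp_word[OF u w]] by blast
  have "\<exists>h'. fs n is h' = Some v \<and> congB n h h'"
    if "fs n is h = Some u" "set is \<subseteq> {1..n}" "congB n u v" for h "is" u v
    using that
  proof (induction "is" arbitrary: u v)
    case (Cons i "is")
    then obtain u1 where u1: "fs n is h = Some u1" "fn n i u1 = Some u"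
      by (auto simp: bind_eq_Some_conv fw_eq[OF n])
    have i: "i \<in> {1..n}" using Cons.prems by simp
    have "rel_option (congB n) (en n i u) (en n i v)" using congB_ecompat[OF n i] Cons.prems by blast
    moreover have "en n i u = Some u1" using u1 en_fn[OF n] by blast
    ultimately obtain v1 where v1: "en n i v = Some v1" "congB n u1 v1" by (auto simp: option_rel_Some1)
    then obtain h' where "fs n is h' = Some v1" "congB n h h'" using Cons.IH[OF u1(1) _ v1(2)] Cons.prems by auto
    moreover have "fn n i v1 = Some v" using v1(1) en_fn[OF n] by blast
    ultimately show ?case by (intro exI[of _ h']) (simp add: fw_eq[OF n])
  qed auto
  then obtain h' where h': "fs n is h' = Some v" "congB n h h'" using h c by blast
  have "highest n h'" using congB_highest[OF n h'(2)] h(1) by blast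
  moreover have "is_word n h'" using congB_word[OF n h'(2)] by blast
  then have "h' \<in> comp n w" using fs_comp[OF n h(3) _ h'(1)] v comp_sym comp_trans by blast
  moreover have "h \<in> comp n w" using h(2) u comp_trans by blast
  ultimately have "h = h'" using highest_unique[OF n] h(1) by blast
  then show ?thesis using h h' by simp
qed

lemma congB_transport:
  assumes n: "0 < n" and c: "congB n w1 w2" and x: "x \<in> comp n w1"
  shows "\<exists>y\<in>comp n w2. congB n x y"
proof -
  have "(\<lambda>x y. edge n x y \<or> edge n y x)\<^sup>*\<^sup>* w1 x" using x by (simp add: comp_def)
  then show ?thesis
  proof (induction rule: rtranclp_induct)
    case base
    show ?case using c comp_self by blast
  next
    case (step x x')
    then obtain y where y: "y \<in> comp n w2" "congB n x y" by blast
    have yw: "is_word n y" using congB_word[OF n y(2)] by blast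
    from step(2) show ?case
    proof
      assume "edge n x x'"
      then obtain i where i: "i \<in> {1..n}" "fn n i x = Some x'" by (auto simp: edge_def fw_eq[OF n])
      then obtain y' where "fn n i y = Some y'" "congB n x' y'"
        using congB_fcompat[OF n i(1) y(2)] by (auto simp: option_rel_Some1)
      then show ?thesis using comp_step[OF y(1)] edge_fn[OF n i(1) yw] by blast
    next
      assume "edge n x' x"
      then obtain i where i: "i \<in> {1..n}" "en n i x = Some x'" by (auto simp: edge_def fw_eq[OF n] en_fn[OF n])
      then obtain y' where y': "en n i y = Some y'" "congB n x' y'"
        using congB_ecompat[OF n i(1) y(2)] by (auto simp: option_rel_Some1)
      then have "edge n y' y" using edge_fn[OF n i(1)] en_word[OF n y'(1) yw] en_fn[OF n] by blast
      then show ?thesis using comp_step[OF y(1)] y' by blast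
    qed
  qed
qed

text \<open>Congruent words of one component are equal, so every vertex has exactly one congruent
  partner in the other component. Passing to the partner is the isomorphism.\<close>

lemma congB_imp_crys_sim:
  assumes n: "0 < n" and c: "congB n w1 w2"
  shows "crys_sim n w1 w2"
proof -
  have w: "is_word n w1" "is_word n w2" using congB_word[OF n c] by auto
  define g where "g x = (SOME y. y \<in> comp n w2 \<and> congB n x y)" for x
  have g: "g x \<in> comp n w2" "congB n x (g x)" if "x \<in> comp n w1" for x
    using someI_ex[of "\<lambda>y. y \<in> comp n w2 \<and> congB n x y"] congB_transport[OF n c that] unfolding g_def by blast+
  have gu: "g x = y" if "x \<in> comp n w1" "y \<in> comp n w2" "congB n x y" for x y
    using congB_comp_eq[OF n w(2) g(1)[OF that(1)] that(2)] g(2)[OF that(1)] that(3) congB.sym congB.trans by blast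
  have "inj_on g (comp n w1)"
  proof (rule inj_onI)
    fix x y assume "x \<in> comp n w1" "y \<in> comp n w1" "g x = g y"
    then show "x = y" using congB_comp_eq[OF n w(1)] g(2) congB.sym congB.trans by metis
  qed
  moreover have "g ` comp n w1 = comp n w2"
  proof
    show "g ` comp n w1 \<subseteq> comp n w2" using g by blast
    show "comp n w2 \<subseteq> g ` comp n w1"
    proof
      fix y assume y: "y \<in> comp n w2"
      then obtain x where "x \<in> comp n w1" "congB n y x" using congB_transport[OF n congB.sym[OF c]] by blast
      then show "y \<in> g ` comp n w1" using gu[of x y] y congB.sym by blast
    qed
  qed
  moreover have "fw n i x = Some y \<longleftrightarrow> fw n i (g x) = Some (g y)"
    if x: "x \<in> comp n w1" and y: "y \<in> comp n w1" and i: "i \<in> {1..n}" for x y i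
  proof -
    have r: "rel_option (congB n) (fn n i x) (fn n i (g x))" using congB_fcompat[OF n i g(2)[OF x]] .
    have c1: "fn n i u = Some v \<Longrightarrow> u \<in> comp n w' \<Longrightarrow> is_word n w' \<Longrightarrow> v \<in> comp n w'" for u v w'
      using comp_step edge_fn[OF n i] comp_word by blast
    show ?thesis unfolding fw_eq[OF n]
    proof
      assume a: "fn n i x = Some y"
      then obtain y' where "fn n i (g x) = Some y'" "congB n y y'" using r by (auto simp: option_rel_Some1)
      then show "fn n i (g x) = Some (g y)" using gu[OF y] c1[OF _ g(1)[OF x] w(2)] by simp
    next
      assume a: "fn n i (g x) = Some (g y)"
      then obtain x' where x': "fn n i x = Some x'" "congB n x' (g y)" using r by (auto simp: option_rel_Some2)
      then have "x' = y" using congB_comp_eq[OF n w(1) c1[OF x'(1) x w(1)] y] g(2)[OF y] congB.sym congB.trans by blast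
      then show "fn n i x = Some y" using x' by simp
    qed
  qed
  moreover obtain h "is" where h: "highest n h" "h \<in> comp n w1" "set is \<subseteq> {1..n}" "fs n is h = Some w1"
    using highest_path[OF n w(1)] by blast
  moreover have "highest n (g h)" using congB_highest[OF n g(2)[OF h(2)]] h(1) by blast
  moreover obtain w' where w': "fs n is (g h) = Some w'" "congB n w1 w'" using fs_congB[OF n h(3) g(2)[OF h(2)] h(4)] by blast
  moreover have "w' = w2"
  proof -
    have "w' \<in> comp n w2" using fs_comp[OF n h(3) comp_word[OF g(1)[OF h(2)] w(2)] w'(1)] g(1)[OF h(2)] comp_trans by blast
    then show ?thesis using congB_comp_eq[OF n w(2) _ comp_self] w'(2) c congB.sym congB.trans by blast
  qed
  ultimately show ?thesis unfolding crys_sim_def bij_betw_def using g(1) by blast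
qed


section \<open>Products of initial columns\<close>

definition hcol :: "nat \<Rightarrow> int list" where "hcol c = [1..int c]"

definition hword :: "nat list \<Rightarrow> int list" where "hword hs = concat (map hcol hs)"

lemma hword_simps [simp]: "hword [] = []" "hword (c # hs) = hcol c @ hword hs" "hword (as @ bs) = hword as @ hword bs"
  by (auto simp: hword_def)

lemma hcol_word: "c \<le> n \<Longrightarrow> is_word n (hcol c)"
  by (auto simp: hcol_def is_word_def is_letter_def)

lemma hword_word: "set hs \<subseteq> {1..n} \<Longrightarrow> is_word n (hword hs)"
  by (induction hs) (auto simp: hcol_word)

lemma pos_word: "\<forall>x\<in>set w. 1 \<le> x \<and> x \<le> int n \<Longrightarrow> is_word n w"
  by (auto simp: is_word_def is_letter_def)

text \<open>The letter \<open>x\<close> travels left through the larger letters by R1, and finally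
  past \<open>x + 1\<close> by R2, until it meets its own copy.\<close>

lemma letter_past_upper:
  assumes x: "1 \<le> x"
  shows "x \<le> int c \<Longrightarrow> c \<le> n \<Longrightarrow> congB n ([x..int c] @ [x]) (x # [x..int c])"
proof (induction c)
  case (Suc c)
  show ?case
  proof (cases "x = int (Suc c)")
    case True
    then have "is_word n [x, x]" using Suc.prems x by (auto simp: is_letter_def)
    then show ?thesis using True congB.refl by simp
  next
    case False
    then have xc: "x \<le> int c" using Suc.prems by simp
    let ?d = "int (Suc c)"
    have u: "[x..?d] = [x..int c] @ [?d]" using Suc.prems upto_rec2[of x ?d] by simp
    have w: "is_word n [x..int c]" "is_word n [x]" "is_word n [?d]" using x Suc.prems by (auto intro!: pos_word simp: is_letter_def)
    have IH: "congB n ([x..int c] @ [x]) (x # [x..int c])" using Suc xc by simp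
    then have 1: "congB n ([x..int c] @ [x] @ [?d]) (x # [x..?d])"
      using congB.ctxt[OF IH, of "[]" "[?d]"] w u by simp
    have "congB n ([x..int c] @ [?d] @ [x]) ([x..int c] @ [x] @ [?d])"
    proof (cases "x = int c")
      case True
      have "rel n [x, ?d, x] [x, x, ?d]"
        using x True Suc.prems by (intro rel.R2a) (auto simp: lt_def rk_def is_letter_def)
      then show ?thesis using True congB.base by simp
    next
      case False
      have v: "[x..int c] = [x..int c - 1] @ [int c]" using xc upto_rec2[of x "int c"] by simp
      have "rel n [int c, ?d, x] [int c, x, ?d]"
        using x xc False Suc.prems by (intro rel.R1a) (auto simp: lt_def rk_def is_letter_def)
      moreover have "is_word n [x..int c - 1]" using x Suc.prems by (auto intro!: pos_word simp: is_letter_def)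
      ultimately show ?thesis unfolding v using congB.ctxt[OF congB.base, of n _ _ "[x..int c - 1]" "[]"] by fastforce
    qed
    from congB.trans[OF this 1] show ?thesis unfolding u by simp
  qed
qed (use x in simp)

text \<open>The first copy of \<open>x\<close> travels left through the smaller letters. The second
  copy makes the first move an instance of R2; the later moves are instances of R1.\<close>

lemma letter_past_lower:
  assumes x: "x \<le> n"
  shows "Suc k \<le> x \<Longrightarrow> congB n ([int x - int k..int x - 1] @ [int x, int x]) (int x # [int x - int k..int x - 1] @ [int x])"
proof (induction k)
  case 0
  then have "is_word n [int x, int x]" using x by (auto simp: is_letter_def)
  then show ?case using congB.refl by simp
next
  case (Suc k)
  let ?a = "int x - int (Suc k)"
  have u: "[?a..int x - 1] = ?a # [int x - int k..int x - 1]" using Suc.prems upto_rec1[of ?a "int x - 1"] by simp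
  have w: "is_word n [?a]" "is_word n [int x - int k..int x - 1]" "is_word n [int x]"
    using Suc.prems x by (auto intro!: pos_word simp: is_letter_def)
  have IH: "congB n ([int x - int k..int x - 1] @ [int x, int x]) (int x # [int x - int k..int x - 1] @ [int x])"
    using Suc by simp
  have 1: "congB n (?a # [int x - int k..int x - 1] @ [int x, int x]) (?a # int x # [int x - int k..int x - 1] @ [int x])"
    using congB.ctxt[OF IH w(1), of "[]"] by simp
  have "congB n (?a # int x # [int x - int k..int x - 1] @ [int x]) (int x # ?a # [int x - int k..int x - 1] @ [int x])"
  proof (cases k)
    case 0
    have "rel n [?a, int x, int x] [int x, ?a, int x]"
      using Suc.prems x by (intro rel.R2b) (auto simp: lt_def rk_def is_letter_def)
    then show ?thesis using 0 congB.base by simp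
  next
    case (Suc j)
    let ?b = "int x - int k"
    have v: "[?b..int x - 1] = ?b # [?b + 1..int x - 1]" using Suc upto_rec1[of ?b "int x - 1"] by simp
    have "rel n [?a, int x, ?b] [int x, ?a, ?b]"
      using Suc Suc.prems x by (intro rel.R1b) (auto simp: lt_def rk_def is_letter_def)
    moreover have "is_word n ([?b + 1..int x - 1] @ [int x])" using Suc.prems x by (intro pos_word) auto
    ultimately show ?thesis unfolding v using congB.ctxt[OF congB.base, of n "[?a, int x, ?b]" "[int x, ?a, ?b]" "[]"] by fastforce
  qed
  from congB.trans[OF 1 this] show ?case unfolding u by simp
qed

text \<open>The new \<open>x\<close> crosses the larger letters of the column; the copy of
  \<open>x\<close> already present then helps it across the smaller ones. Two columns will commute
  because the letters of the shorter one all occur in the longer one.\<close>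

lemma hcol_letter:
  assumes "1 \<le> x" "x \<le> c" "c \<le> n"
  shows "congB n (hcol c @ [int x]) (int x # hcol c)"
proof -
  have u: "hcol c = [1..int x - 1] @ [int x..int c]" "[int x..int c] = int x # [int x + 1..int c]"
    using assms upto_split1[of 1 "int x" "int c"] upto_rec1[of "int x" "int c"] by (auto simp: hcol_def)
  have w: "is_word n [1..int x - 1]" "is_word n [int x + 1..int c]" using assms by (auto intro!: pos_word simp: is_letter_def)
  have "congB n ([int x..int c] @ [int x]) (int x # [int x..int c])" using letter_past_upper[of "int x" c n] assms by simp
  then have "congB n (hcol c @ [int x]) ([1..int x - 1] @ [int x, int x] @ [int x + 1..int c])"
    using congB.ctxt[of n _ _ "[1..int x - 1]" "[]"] w u by fastforce
  moreover have "congB n ([1..int x - 1] @ [int x, int x]) (int x # [1..int x - 1] @ [int x])"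
    using letter_past_lower[of x n "x - 1"] assms by (simp add: of_nat_diff)
  then have "congB n ([1..int x - 1] @ [int x, int x] @ [int x + 1..int c]) (int x # hcol c)"
    using congB.ctxt[of n _ _ "[]" "[int x + 1..int c]"] w u by fastforce
  ultimately show ?thesis by (rule congB.trans)
qed

lemma hcol_letters:
  assumes "c \<le> n"
  shows "\<forall>x\<in>set xs. 1 \<le> x \<and> x \<le> int c \<Longrightarrow> congB n (hcol c @ xs) (xs @ hcol c)"
proof (induction xs)
  case Nil
  then show ?case using congB.refl[OF hcol_word[OF assms]] by simp
next
  case (Cons x xs)
  have "congB n (hcol c @ [x]) (x # hcol c)" using hcol_letter[of "nat x" c n] Cons.prems assms by (simp add: nat_le_iff Suc_le_eq)
  moreover have "is_word n xs" "is_word n [x]" using Cons.prems assms by (auto intro!: pos_word simp: is_letter_def)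
  ultimately have "congB n (hcol c @ x # xs) (x # hcol c @ xs)" "congB n (x # hcol c @ xs) (x # xs @ hcol c)"
    using congB.ctxt[of n "hcol c @ [x]" "x # hcol c" "[]" xs] congB.ctxt[of n "hcol c @ xs" "xs @ hcol c" "[x]" "[]"] Cons by auto
  then show ?case using congB.trans by fastforce
qed

lemma hcol_commute: assumes "c \<le> n" "d \<le> n" shows "congB n (hcol c @ hcol d) (hcol d @ hcol c)"
proof (cases "d \<le> c")
  case True
  then show ?thesis using hcol_letters[OF assms(1), of "hcol d"] by (auto simp: hcol_def)
next
  case False
  then show ?thesis using hcol_letters[OF assms(2), of "hcol c"] congB.sym by (auto simp: hcol_def)
qed

lemma hword_hcol:
  assumes "c \<le> n"
  shows "set hs \<subseteq> {1..n} \<Longrightarrow> congB n (hword hs @ hcol c) (hcol c @ hword hs)"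
proof (induction hs)
  case Nil
  then show ?case using congB.refl[OF hcol_word[OF assms]] by simp
next
  case (Cons d hs)
  have w: "is_word n (hcol d)" "is_word n (hword hs)" using Cons.prems by (auto simp: hcol_word hword_word)
  have "congB n (hword hs @ hcol c) (hcol c @ hword hs)" using Cons by simp
  from congB.ctxt[OF this w(1), of "[]"]
  have "congB n (hcol d @ hword hs @ hcol c) (hcol d @ hcol c @ hword hs)" by simp
  moreover have "congB n (hcol d @ hcol c @ hword hs) (hcol c @ hcol d @ hword hs)"
    using congB.ctxt[OF hcol_commute[of d n c], of "[]" "hword hs"] Cons.prems assms w by simp
  ultimately show ?case using congB.trans by fastforce
qed

lemma hword_perm:
  "mset xs = mset ys \<Longrightarrow> set xs \<subseteq> {1..n} \<Longrightarrow> congB n (hword xs) (hword ys)"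
proof (induction xs arbitrary: ys)
  case Nil
  then show ?case using congB.refl by simp
next
  case (Cons a xs)
  have "a \<in> set ys" using Cons.prems(1) by (metis list.set_intros(1) mset_eq_setD)
  then obtain p q where ys: "ys = p @ a # q" by (meson split_list)
  have a: "a \<in> {1..n}" and pq: "set p \<subseteq> {1..n}" "set q \<subseteq> {1..n}"
    using Cons.prems ys mset_eq_setD[OF Cons.prems(1)] by auto
  have w: "is_word n (hcol a)" "is_word n (hword q)" using a pq by (auto simp: hcol_word hword_word)
  have "mset xs = mset (p @ q)" using Cons.prems(1) ys by simp
  then have "congB n (hword xs) (hword (p @ q))" using Cons.IH[of "p @ q"] Cons.prems by simp
  then have 1: "congB n (hcol a @ hword xs) (hcol a @ hword p @ hword q)" using congB.ctxt[OF _ w(1), of _ _ "[]"] by fastforce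
  have "congB n (hword p @ hcol a) (hcol a @ hword p)" using hword_hcol[of a n p] a pq by simp
  then have "congB n (hword p @ hcol a @ hword q) (hcol a @ hword p @ hword q)"
    using congB.ctxt[of n _ _ "[]" "hword q"] w by fastforce
  from congB.trans[OF 1 congB.sym[OF this]] show ?case using ys by simp
qed

text \<open>The lowering strings are the coordinates of the weight: a fundamental weight for 1 \<le>
  c < n, but twice the spin weight for \<open>c = n\<close>, whence the factor 2.\<close>

lemma hcol_eps: "0 < n \<Longrightarrow> i \<in> {1..n} \<Longrightarrow> c \<le> n \<Longrightarrow>
   eps n i (hcol c) = 0 \<and> phi n i (hcol c) = (if c = i then if i = n then 2 else 1 else 0)"
proof (induction c)
  case (Suc c)
  have u: "hcol (Suc c) = hcol c @ [int (Suc c)]" using upto_rec2[of 1 "int (Suc c)"] by (simp add: hcol_def)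
  show ?case unfolding u eps_append phi_append using Suc by (auto simp: el_def pl_alt)
qed (simp add: hcol_def)

lemma hword_eps: assumes "0 < n" "i \<in> {1..n}" shows "set hs \<subseteq> {1..n} \<Longrightarrow>
   eps n i (hword hs) = 0 \<and> phi n i (hword hs) = (if i = n then 2 else 1) * count_list hs i"
  by (induction hs) (use hcol_eps[OF assms] in \<open>auto simp: eps_append phi_append\<close>)

lemma hword_highest: "0 < n \<Longrightarrow> set hs \<subseteq> {1..n} \<Longrightarrow> highest n (hword hs)"
  using hword_eps by (auto simp: highest_eps)

lemma hcol_colw: "c \<le> n \<Longrightarrow> colw n {1..int c} 0 = hcol c"
proof -
  assume c: "c \<le> n"
  then have "[1..int n] = [1..int c] @ [int c + 1..int n]" by (cases "c = 0") (auto intro: upto_split2)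
  then show ?thesis by (auto simp: colw_def hcol_def filter_empty_conv filter_id_conv)
qed

lemma congB_colpair: "colpair n u v \<Longrightarrow> congB n u v"
  using R5_tilde_colw rel.R5 congB.base by metis

lemma Ncnt_initial: "Ncnt {1..int c} k = min k c"
  by (induction k) (auto simp: min_def)

text \<open>The length is \<open>n + 1\<close> while every count stays within its index, so the
  column relation erases the zero.\<close>

lemma hcol_zero:
  assumes n: "0 < n"
  shows "congB n (hcol n @ [0]) (hcol n)"
proof -
  have "filter (\<lambda>x. x \<in> {1..int n}) [- int n..-1] = []" "filter (\<lambda>x. x \<in> {1..int n}) [1..int n] = [1..int n]"
    by (auto simp: filter_empty_conv filter_id_conv)
  then have u: "colw n {1..int n} 1 = hcol n @ [0]" "colw n {1..int n} 0 = hcol n"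
    by (auto simp: colw_def hcol_def)
  have "colpair n (colw n {1..int n} 1) (colw n {1..int n} (1 - 1))"
    unfolding colpair_def R5c_def Ncnt_initial
    by (rule exI[of _ "{1..int n}"], rule exI[of _ 1]) (auto simp: Ncnt_initial)
  then show ?thesis using congB_colpair u by simp
qed

text \<open>The index \<open>k\<close> is the first whose count exceeds it, so the column relation
  erases \<open>k\<close> together with its bar.\<close>

lemma hcol_bar:
  assumes k: "1 \<le> k" "k \<le> n"
  shows "congB n (hcol k @ [- int k]) (hcol (k - 1))"
proof -
  let ?S = "insert (- int k) {1..int k}"
  have N: "Ncnt ?S j = (if j < k then j else k + 1)" for j
  proof (induction j)
    case 0
    then show ?case using k by simp
  next
    case (Suc j)
    have "int (Suc j) \<in> ?S \<longleftrightarrow> Suc j \<le> k" "- int (Suc j) \<in> ?S \<longleftrightarrow> Suc j = k" by auto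
    then show ?case using Suc by (auto simp del: of_nat_Suc)
  qed
  have "[1..int n] = [1..int k] @ [int k + 1..int n]" using k by (intro upto_split2) auto
  moreover have "[- int n..-1] = [- int n..- int k - 1] @ - int k # [- int k + 1..-1]" using k by (intro upto_split3) auto
  moreover have "filter (\<lambda>x. x \<in> ?S) [1..int k] = [1..int k]" "filter (\<lambda>x. x \<in> ?S) [int k + 1..int n] = []"
     "filter (\<lambda>x. x \<in> ?S) [- int n..- int k - 1] = []" "filter (\<lambda>x. x \<in> ?S) [- int k + 1..-1] = []"
    using k by (auto simp: filter_empty_conv filter_id_conv)
  ultimately have u: "colw n ?S 0 = hcol k @ [- int k]" by (simp add: colw_def hcol_def)
  have "?S - {int k, - int k} = {1..int (k - 1)}" using k by auto
  then have v: "colw n (?S - {int k, - int k}) 0 = hcol (k - 1)" using hcol_colw[of "k - 1" n] k by simp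
  have "R5c n ?S 0" using k unfolding R5c_def N by auto
  moreover have "lowest ?S k" using k unfolding lowest_def N by auto
  ultimately have "colpair n (colw n ?S 0) (colw n (?S - {int k, - int k}) 0)"
    unfolding colpair_def using k by blast
  then show ?thesis using congB_colpair u v by simp
qed

text \<open>Columns commute, so a column whose height matches the last letter can be moved to the end,
  where it absorbs that letter.\<close>

lemma highest_canonical:
  assumes n: "0 < n"
  shows "is_word n w \<Longrightarrow> highest n w \<Longrightarrow> \<exists>hs. set hs \<subseteq> {1..n} \<and> congB n w (hword hs)"
proof (induction w rule: rev_induct)
  case Nil
  show ?case using congB.refl[of n "[]"] by (intro exI[of _ "[]"]) simp
next
  case (snoc x w)
  have e: "eps n i w = 0 \<and> el n i x \<le> phi n i w" if "i \<in> {1..n}" for i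
    using snoc.prems(2) that unfolding highest_eps[OF n] eps_append by fastforce
  have x: "is_letter n x" using snoc.prems by simp
  have "highest n w" using e by (simp add: highest_eps[OF n])
  then obtain hs where hs: "set hs \<subseteq> {1..n}" "congB n w (hword hs)" using snoc by auto
  have ph: "phi n i w = (if i = n then 2 else 1) * count_list hs i" if "i \<in> {1..n}" for i
    using congB_ecompat[OF n that hs(2)] hword_eps[OF n that hs(1)] by simp
  have app: "congB n (w @ [x]) (hword hs @ [x])" using congB.ctxt[OF hs(2), of "[]" "[x]"] x by simp
  have key: "\<exists>hs'. set hs' \<subseteq> {1..n} \<and> congB n (w @ [x]) (hword hs')"
    if k: "k \<in> {1..n}" "0 < el n k x" and c: "congB n (hcol k @ [x]) (hcol k')" and k': "k' \<le> n" for k k'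
  proof -
    \<comment> \<open>The letter \<open>x\<close> can be raised along \<open>k\<close> while
      \<open>w @ [x]\<close> cannot, so \<open>phi n k w\<close> is positive and a column of height
      \<open>k\<close> must occur.\<close>
    have "count_list hs k \<noteq> 0"
    proof
      assume "count_list hs k = 0"
      then show False using e[OF k(1)] ph[OF k(1)] k(2) by simp
    qed
    then have kh: "k \<in> set hs" by (meson count_list_0_iff)
    let ?r = "remove1 k hs"
    have r: "set ?r \<subseteq> {1..n}" using hs(1) set_remove1_subset by fast
    have "mset hs = mset (?r @ [k])" using kh by simp
    then have "congB n (hword hs) (hword ?r @ hcol k)" using hword_perm hs(1) by fastforce
    from congB.ctxt[OF this, of "[]" "[x]"] x
    have 1: "congB n (hword hs @ [x]) (hword ?r @ hcol k @ [x])" by simp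
    have 2: "congB n (hword ?r @ hcol k @ [x]) (hword ?r @ hcol k')"
      using congB.ctxt[OF c hword_word[OF r], of "[]"] by simp
    have 3: "congB n (w @ [x]) (hword ?r @ hcol k')" using app 1 2 congB.trans by blast
    show ?thesis
    proof (cases "k' = 0")
      case True
      then show ?thesis using 3 r by (intro exI[of _ ?r]) (simp add: hcol_def)
    next
      case False
      then show ?thesis using 3 r k' by (intro exI[of _ "?r @ [k']"]) auto
    qed
  qed
  have bx: "- int n \<le> x" "x \<le> int n" using x by (auto simp: is_letter_def)
  \<comment> \<open>The letter 1 opens a column, \<open>k + 1\<close> extends one of height
    \<open>k\<close>, 0 vanishes in one of height \<open>n\<close>, and the bar of \<open>k\<close>
    shortens one of height \<open>k\<close>.\<close>
  consider "x = 1" | "2 \<le> x" | "x = 0" | "x < 0" by linarith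
  then show ?case
  proof cases
    case 1
    then show ?thesis using app hs(1) n by (intro exI[of _ "hs @ [1]"]) (auto simp: hcol_def)
  next
    case 2
    define k where "k = nat (x - 1)"
    have k: "k \<in> {1..n}" "k < n" "x = int k + 1" using 2 bx by (auto simp: k_def)
    have "hcol k @ [x] = hcol (Suc k)" using k upto_rec2[of 1 "int (Suc k)"] by (simp add: hcol_def add.commute)
    then have "congB n (hcol k @ [x]) (hcol (Suc k))" using congB.refl[OF hcol_word[of "Suc k" n]] k by simp
    moreover have "0 < el n k x" using k by (auto simp: el_def)
    ultimately show ?thesis using key[OF k(1)] k(2) by auto
  next
    case 3
    have "0 < el n n x" "n \<in> {1..n}" using 3 n by (auto simp: el_def)
    then show ?thesis using key[of n n] hcol_zero[OF n] 3 by simp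
  next
    case 4
    define k where "k = nat (- x)"
    have k: "k \<in> {1..n}" "x = - int k" using 4 bx by (auto simp: k_def)
    have "0 < el n k x" using k by (auto simp: el_def)
    then show ?thesis using key[OF k(1) _ _, of "k - 1"] hcol_bar[of k n] k by auto
  qed
qed


section \<open>The highest weight determines the congruence class\<close>

lemma mset_from_phi:
  assumes n: "0 < n" and hs: "set hs \<subseteq> {1..n}" "set ks \<subseteq> {1..n}"
    and e: "\<And>i. i \<in> {1..n} \<Longrightarrow> phi n i (hword hs) = phi n i (hword ks)"
  shows "mset hs = mset ks"
proof (rule multiset_eqI)
  fix i
  show "count (mset hs) i = count (mset ks) i"
  proof (cases "i \<in> {1..n}")
    case True
    then show ?thesis using e[OF True] hword_eps[OF n True hs(1)] hword_eps[OF n True hs(2)]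
      by (simp add: count_mset split: if_splits)
  next
    case False
    then have "i \<notin> set hs" "i \<notin> set ks" using hs by auto
    then show ?thesis by (metis count_mset_0_iff)
  qed
qed

lemma highest_same_phi_congB:
  assumes n: "0 < n" and u: "is_word n u" "highest n u" and v: "is_word n v" "highest n v"
    and e: "\<And>i. i \<in> {1..n} \<Longrightarrow> phi n i u = phi n i v"
  shows "congB n u v"
proof -
  obtain hs where hs: "set hs \<subseteq> {1..n}" "congB n u (hword hs)" using highest_canonical[OF n u] by blast
  obtain ks where ks: "set ks \<subseteq> {1..n}" "congB n v (hword ks)" using highest_canonical[OF n v] by blast
  have "phi n i (hword hs) = phi n i (hword ks)" if "i \<in> {1..n}" for i
    using e[OF that] congB_ecompat[OF n that hs(2)] congB_ecompat[OF n that ks(2)] by simp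
  then have "congB n (hword hs) (hword ks)" using mset_from_phi[OF n hs(1) ks(1)] hword_perm hs(1) by blast
  from congB.trans[OF hs(2) congB.trans[OF this congB.sym[OF ks(2)]]] show ?thesis .
qed

text \<open>An isomorphism carries source to source and preserves lowering strings, hence
  \<open>phi\<close>. So the two highest weight words are congruent, and the common lowering path
  takes this congruence down to \<open>w1\<close> and \<open>w2\<close>.\<close>

lemma crys_sim_imp_congB:
  assumes n: "0 < n" and w: "is_word n w1" "is_word n w2" and s: "crys_sim n w1 w2"
  shows "congB n w1 w2"
proof -
  obtain g where g: "bij_betw g (comp n w1) (comp n w2)"
    and gf: "\<And>x y i. x \<in> comp n w1 \<Longrightarrow> y \<in> comp n w1 \<Longrightarrow> i \<in> {1..n} \<Longrightarrow> fn n i x = Some y \<longleftrightarrow> fn n i (g x) = Some (g y)"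
    using s unfolding crys_sim_def fw_eq[OF n] by blast
  obtain h1 h2 "is" where h: "h1 \<in> comp n w1" "highest n h1" "h2 \<in> comp n w2" "highest n h2"
      "set is \<subseteq> {1..n}" "fs n is h1 = Some w1" "fs n is h2 = Some w2"
    using s unfolding crys_sim_def by blast
  have gi: "g x \<in> comp n w2" if "x \<in> comp n w1" for x using g that by (auto simp: bij_betw_def)
  have gs: "\<exists>x\<in>comp n w1. y = g x" if "y \<in> comp n w2" for y using g that by (auto simp: bij_betw_def)
  have c1: "fn n i u = Some v \<Longrightarrow> u \<in> comp n w \<Longrightarrow> is_word n w \<Longrightarrow> i \<in> {1..n} \<Longrightarrow> v \<in> comp n w" for i u v w
    using comp_step edge_fn[OF n] comp_word by blast
  have c2: "en n i u = Some v \<Longrightarrow> u \<in> comp n w \<Longrightarrow> is_word n w \<Longrightarrow> i \<in> {1..n} \<Longrightarrow> v \<in> comp n w" for i u v w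
    using comp_step edge_fn[OF n] comp_word en_word[OF n] en_fn[OF n] by meson
  \<comment> \<open>An arrow into \<open>g h1\<close> would be the image of an arrow into
    \<open>h1\<close>.\<close>
  have "en n i (g h1) = None" if i: "i \<in> {1..n}" for i
  proof (rule ccontr)
    assume "en n i (g h1) \<noteq> None"
    then obtain v where v: "en n i (g h1) = Some v" by auto
    then obtain u where u: "u \<in> comp n w1" "v = g u" using c2[OF v gi[OF h(1)] w(2) i] gs by blast
    then have "fn n i u = Some h1" using gf[OF u(1) h(1) i] v en_fn[OF n] by blast
    then have "en n i h1 = Some u" using en_fn[OF n] by blast
    then show False using h(2) i by (auto simp: highest_def ew_eq[OF n])
  qed
  then have "highest n (g h1)" by (auto simp: highest_def ew_eq[OF n])
  then have gh: "g h1 = h2" using highest_unique[OF n gi[OF h(1)] h(3)] h(4) by blast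
  have ph: "x \<in> comp n w1 \<Longrightarrow> phi n i x = phi n i (g x)" if i: "i \<in> {1..n}" for i x
  proof (induction "phi n i x" arbitrary: x)
    case 0
    then have "fn n i x = None" using fn_None[OF n] by metis
    then have "fn n i (g x) = None"
      using gf[OF 0(2) _ i] gs c1[OF _ gi[OF 0(2)] w(2) i] by (metis not_None_eq)
    then show ?case using 0 fn_None[OF n] by metis
  next
    case (Suc k)
    then obtain y where y: "fn n i x = Some y" using fn_None[OF n, of i x] by fastforce
    have yc: "y \<in> comp n w1" using c1[OF y Suc.prems w(1) i] .
    have "fn n i (g x) = Some (g y)" using gf[OF Suc.prems yc i] y by blast
    then have "phi n i (g x) = Suc (phi n i (g y))" "phi n i x = Suc (phi n i y)"
      using y en_Some[OF n] en_fn[OF n] by metis+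
    then show ?case using Suc.hyps yc by auto
  qed
  have "congB n h1 h2"
    by (rule highest_same_phi_congB[OF n]) (use h comp_word w ph[OF _ h(1)] gh in auto)
  then obtain w' where "fs n is h2 = Some w'" "congB n w1 w'" using fs_congB[OF n h(5) _ h(6)] by blast
  then show ?thesis using h(7) by simp
qed

section \<open>Orthogonal tableaux: shape, uniqueness and existence\<close>

lemma hcol_map: "hcol c = map int [1..<Suc c]"
proof (induction c)
  case (Suc c)
  have "hcol (Suc c) = hcol c @ [int (Suc c)]" using upto_rec2[of 1 "int (Suc c)"] by (simp add: hcol_def)
  then show ?case using Suc by simp
qed (simp add: hcol_def)

lemma reading_TY: "reading (TY T) = hword (rev (map length T))"
  by (simp add: reading_def TY_def hword_def rev_map hcol_map o_def)

lemma orth_heights: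
  assumes "orth_tableau n T"
  shows "set (map length T) \<subseteq> {1..n}" "sorted (rev (map length T))" "is_word n (reading T)"
proof -
  have t: "tabloid n T" "is_word n (reading (TY T))" "reading T \<in> comp n (reading (TY T))"
    using assms by (auto simp: orth_tableau_def)
  show "is_word n (reading T)" using t comp_word by blast
  have "length C \<in> {1..n}" if C: "C \<in> set T" for C
  proof -
    have "C \<noteq> []" using t(1) C by (auto simp: tabloid_def)
    \<comment> \<open>The last entry of the column in the highest weight tableau is its height,
      which is therefore a letter.\<close>
    moreover have "int (length C) \<in> set (reading (TY T))"
      using C \<open>C \<noteq> []\<close> by (force simp: reading_def TY_def Suc_le_eq)
    ultimately show ?thesis using t(2) by (auto simp: is_word_def is_letter_def Suc_le_eq)
  qed
  then show "set (map length T) \<subseteq> {1..n}" by auto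
  have "sorted_wrt (\<ge>) (map length T)"
    using t(1) by (subst sorted_wrt_iff_nth_Suc_transp) (auto simp: tabloid_def transp_def)
  then show "sorted (rev (map length T))" by (simp add: sorted_wrt_rev)
qed

lemma concat_eq_lengths: "concat xs = concat ys \<Longrightarrow> map length xs = map length ys \<Longrightarrow> xs = ys"
proof (induction xs arbitrary: ys)
  case (Cons x xs)
  then obtain y ys' where "ys = y # ys'" by (cases ys) auto
  then show ?case using Cons by auto
qed simp

text \<open>Congruence fixes the multiset of heights and hence the shape. Both readings then lie in
  one component, where congruent words are equal, and the heights recover the columns from the
  reading.\<close>

lemma orth_unique:
  assumes n: "0 < n" and T: "orth_tableau n T" and T': "orth_tableau n T'" and c: "congB n (reading T) (reading T')"
  shows "T = T'"
proof -
  have t: "reading T \<in> comp n (reading (TY T))" "reading T' \<in> comp n (reading (TY T'))"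
    using T T' by (auto simp: orth_tableau_def)
  note o = orth_heights[OF T] and o' = orth_heights[OF T']
  let ?hs = "rev (map length T)" and ?ks = "rev (map length T')"
  have s: "set ?hs \<subseteq> {1..n}" "set ?ks \<subseteq> {1..n}" using o(1) o'(1) by auto
  have hw: "highest n (hword ?hs)" "highest n (hword ?ks)" using hword_highest[OF n] s by blast+
  obtain h "is" where h: "highest n h" "h \<in> comp n (reading T)" "set is \<subseteq> {1..n}" "fs n is h = Some (reading T)"
    using highest_path[OF n o(3)] by blast
  have hY: "h = hword ?hs"
    using highest_unique[OF n comp_trans[OF t(1) h(2)] comp_self h(1)] hw(1) by (simp add: reading_TY)
  obtain y where y: "y \<in> comp n (reading T')" "congB n h y" using congB_transport[OF n c h(2)] by blast
  have "highest n y" using congB_highest[OF n y(2)] h(1) by blast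
  then have "y = hword ?ks"
    using highest_unique[OF n comp_trans[OF t(2) y(1)] comp_self] hw(2) by (simp add: reading_TY)
  then have "congB n (hword ?hs) (hword ?ks)" using y hY by simp
  then have "mset ?hs = mset ?ks" using mset_from_phi[OF n s] congB_ecompat[OF n] by blast
  then have l: "?hs = ?ks" using o(2) o'(2) by (metis properties_for_sort sorted_sort_id)
  then have "reading T' \<in> comp n (reading (TY T))" using t(2) by (simp add: reading_TY)
  then have "reading T = reading T'"
    using congB_comp_eq[OF n _ t(1) _ c] T by (auto simp: orth_tableau_def)
  then have "rev T = rev T'" using concat_eq_lengths[of "rev T" "rev T'"] l by (simp add: reading_def rev_map)
  then show ?thesis by simp
qed

lemma fs_concat_cols:
  assumes n: "0 < n"
  shows "set is \<subseteq> {1..n} \<Longrightarrow> \<forall>C\<in>set Cs. is_col n C \<Longrightarrow> fs n is (concat Cs) = Some v \<Longrightarrow>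
    \<exists>Ds. v = concat Ds \<and> map length Ds = map length Cs \<and> (\<forall>D\<in>set Ds. is_col n D)"
proof (induction "is" arbitrary: v)
  case (Cons i "is")
  then obtain u where u: "fs n is (concat Cs) = Some u" "fn n i u = Some v"
    by (auto simp: bind_eq_Some_conv fw_eq[OF n])
  then obtain Ds where Ds: "u = concat Ds" "map length Ds = map length Cs" "\<forall>D\<in>set Ds. is_col n D"
    using Cons by auto
  then show ?case using fn_concat_cols[OF n, of i Ds v] Cons.prems u by auto
qed auto

lemma orth_exists:
  assumes n: "0 < n" and w: "is_word n w"
  shows "\<exists>T. orth_tableau n T \<and> congB n (reading T) w"
proof -
  obtain h "is" where h: "highest n h" "h \<in> comp n w" "set is \<subseteq> {1..n}" "fs n is h = Some w"
    using highest_path[OF n w] by blast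
  obtain ks where ks: "set ks \<subseteq> {1..n}" "congB n h (hword ks)"
    using highest_canonical[OF n comp_word[OF h(2) w] h(1)] by blast
  \<comment> \<open>Increasing order, because a tableau is read from its last, shortest column; the
    rearrangement is possible since the initial columns commute.\<close>
  let ?hs = "sort ks"
  have hs: "set ?hs \<subseteq> {1..n}" "congB n h (hword ?hs)"
    using ks(1) congB.trans[OF ks(2) hword_perm[of ks ?hs n]] by auto
  obtain v where v: "fs n is (hword ?hs) = Some v" "congB n w v" using fs_congB[OF n h(3) hs(2) h(4)] by blast
  have "is_col n (hcol c)" if "c \<le> n" for c using hcol_colw[OF that] is_col_colw by metis
  then have "\<forall>C\<in>set (map hcol ?hs). is_col n C" using hs(1) by auto
  then obtain Ds where Ds: "v = concat Ds" "map length Ds = map length (map hcol ?hs)" "\<forall>D\<in>set Ds. is_col n D"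
    using fs_concat_cols[OF n h(3)] v(1) unfolding hword_def by blast
  have len: "map length Ds = ?hs" using Ds(2) by (simp add: hcol_def o_def)
  let ?T = "rev Ds"
  have r: "reading ?T = v" "reading (TY ?T) = hword ?hs" using Ds(1) len by (simp_all add: reading_def[of "rev Ds"] reading_TY rev_map)
  have "sorted (map length Ds)" unfolding len by simp
  then have "sorted_wrt (\<ge>) (map length ?T)" unfolding rev_map[symmetric] sorted_wrt_rev .
  then have "\<forall>j. Suc j < length ?T \<longrightarrow> length (?T ! Suc j) \<le> length (?T ! j)"
    by (auto simp: sorted_wrt_iff_nth_less)
  moreover have "length D \<ge> 1" if "D \<in> set Ds" for D
  proof -
    have "length D \<in> set ?hs" using that unfolding len[symmetric] by simp
    then show ?thesis using hs(1) by auto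
  qed
  then have "\<forall>C\<in>set ?T. is_col n C \<and> C \<noteq> []" using Ds(3) by force
  ultimately have "tabloid n ?T" unfolding tabloid_def by blast
  then have "orth_tableau n ?T" unfolding orth_tableau_def r
    using fs_comp[OF n h(3) hword_word[OF hs(1)] v(1)] hword_word[OF hs(1)] by blast
  then show ?thesis using r(1) v(2) congB.sym by metis
qed

theorem mainTheorem8:
  fixes n :: nat
  assumes "n \<ge> 2"
  shows "(\<forall>w. is_word n w \<longrightarrow> (\<exists>!P. orth_tableau n P \<and> crys_sim n (reading P) w)) \<and>
         (\<forall>w1 w2. is_word n w1 \<longrightarrow> is_word n w2 \<longrightarrow>
            (crys_sim n w1 w2 \<longleftrightarrow> congB n w1 w2) \<and>
            (congB n w1 w2 \<longleftrightarrow> PB n w1 = PB n w2))"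
proof -
  have n: "0 < n" using assms by simp
  have iff: "crys_sim n u v \<longleftrightarrow> congB n u v" if "is_word n u" "is_word n v" for u v
    using congB_imp_crys_sim[OF n] crys_sim_imp_congB[OF n that] by blast
  have ex1: "\<exists>!P. orth_tableau n P \<and> crys_sim n (reading P) w" if w: "is_word n w" for w
  proof -
    obtain T where T: "orth_tableau n T" "congB n (reading T) w" using orth_exists[OF n w] by blast
    show ?thesis
    proof (rule ex1I[of _ T])
      show "orth_tableau n T \<and> crys_sim n (reading T) w" using T congB_imp_crys_sim[OF n] by blast
      fix P assume P: "orth_tableau n P \<and> crys_sim n (reading P) w"
      then have "congB n (reading P) w" using crys_sim_imp_congB[OF n orth_heights(3) w] by blast
      from congB.trans[OF this congB.sym[OF T(2)]] show "P = T" using orth_unique[OF n] P T(1) by blast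
    qed
  qed
  have PB: "orth_tableau n (PB n w)" "congB n (reading (PB n w)) w" if w: "is_word n w" for w
    using theI'[OF ex1[OF w]] crys_sim_imp_congB[OF n orth_heights(3) w] unfolding PB_def by blast+
  have "congB n w1 w2 \<longleftrightarrow> PB n w1 = PB n w2" if w: "is_word n w1" "is_word n w2" for w1 w2
  proof
    assume "congB n w1 w2"
    from congB.trans[OF PB(2)[OF w(1)] congB.trans[OF this congB.sym[OF PB(2)[OF w(2)]]]]
    have "congB n (reading (PB n w1)) (reading (PB n w2))" .
    then show "PB n w1 = PB n w2" using orth_unique[OF n] PB w by blast
  next
    assume "PB n w1 = PB n w2"
    then show "congB n w1 w2" using congB.trans[OF congB.sym[OF PB(2)[OF w(1)]]] PB(2)[OF w(2)] by simp
  qed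
  then show ?thesis using iff ex1 by blast
qed

end
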